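(* Let $\phi$ be an MITL formula over a finite set $AP$ built only with the operators $\neg$, $\wedge$, $\mathbf{U}_{(0,+\infty)}$, $\mathbf{F}_{\langle a,b]}$ and $\mathbf{F}_{\langle a,+\infty)}$ (with $a<b$ natural numbers and $\langle\in\{[,(\}$). Then $\phi$ is satisfiable (i.e. there is a non-Zeno l.c.r.o. signal $M$ with $M,0\models\phi$) if and only if the CLTL-oc formula $$\mathrm{Up}_\phi\ \wedge \bigwedge_{\theta\in sub(\phi)}\mathbf{G}\, m(\theta)\ \wedge\ \mathtt{events}_\phi\ \wedge \bigwedge_{\theta\in sub(\phi),\ \theta=\mathbf{F}_{\langle a,b]}\psi,\ b<\infty}\mathtt{auxclocks}_\theta$$ is satisfiable (at position $0$, in a CLTL-oc model with divergent time).
   Context: MITL semantics over signals $M:\mathbb{R}_+\to 2^{AP}$: $M,t\models p$ iff $p\in M(t)$; Boolean connectives as usual; $M,t\models\gamma\,\mathbf{U}_{(0,+\infty)}\psi$ iff there is $t'>t$ with $M,t'\models\psi$ and $M,t''\models\gamma$ for all $t''\in(t,t')$; $M,t\models\mathbf{F}_I\psi$ iff there is $t'\in t+I$ with $M,t'\models\psi$. A signal is l.c.r.o. and non-Zeno if there is a strictly increasing sequence $0=t_0<t_1<\cdots$ with $t_i\to\infty$ such that $M$ is constant on each $[t_i,t_{i+1})$. $sub(\phi)$ is the set of subformulas of $\phi$. CLTL-oc: models are triples $(\pi,\sigma,\delta)$ over positions $i\in\mathbb{N}$, with $\pi(i)$ a set of propositions, $\delta(i)>0$ real with $\sum_i\delta(i)=\infty$,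 and $\sigma(i,x)\ge 0$ the value of clock $x$, where for every clock either $\sigma(i+1,x)=\sigma(i,x)+\delta(i)$ or $\sigma(i+1,x)=0$ (reset). Atomic formulas are propositions and comparisons $x\sim c$ of a clock with a natural constant ($\sim\in\{<,\le,=,\ge,>,\ne\}$). Temporal operators have the usual discrete LTL meaning: $\mathbf{X}$ (next), $\mathbf{Y}$ (previous; false at position 0), $\alpha\mathbf{U}\beta$ at $i$ iff some $j\ge i$ satisfies $\beta$ and all $n$ with $i\le n<j$ satisfy $\alpha$; $\alpha\mathbf{R}\beta=\neg(\neg\alpha\mathbf{U}\neg\beta)$; $\mathbf{G}\alpha=\neg(\top\mathbf{U}\neg\alpha)$. Let $O=\neg\mathbf{Y}\top$ (true exactly at position 0). Vocabulary: for each $\theta\in sub(\phi)$ a proposition $\top_\theta$ (for $p\in AP$, $\top_p$ represents $p$), with $\bot_\theta=\neg\top_\theta$, and clocks $z^0_\theta,z^1_\theta$; for each $\theta=\mathbf{F}_{\langle a,b]}\psi$ with $b<\infty$, $d=2\lceil b/(b-a)\rceil$ clocks $x^0_\theta,\dots,x^{d-1}_\theta$. Abbreviations: $\mathrm{Up}_\theta=\neg\mathbf{Y}(\top_\theta)\wedge\top_\theta$, $\mathrm{Dn}_\theta=\neg\mathbf{Y}(\bot_\theta)\wedge\bot_\theta$. Indices of $x$ are taken mod $d$. $\mathtt{events}_\phi=\bigwedge_{\theta}(z^0_\theta=0)\wedge\mathbf{G}\bigwedge_\theta\Big[(\mathrm{Up}_\theta\vee\mathrm{Dn}_\theta\Leftrightarrow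 z^0_\theta=0\vee z^1_\theta=0)\wedge\bigwedge_{i\in\{0,1\}}\big(z^i_\theta=0\Rightarrow\mathbf{X}((z^{1-i}_\theta=0)\mathbf{R}(z^i_\theta\ne0))\big)\Big]$, conjunctions over $\theta\in sub(\phi)$. $\mathtt{auxclocks}_\theta=(x^0_\theta=0)\wedge\mathbf{G}\Big[(\mathrm{Up}_\theta\vee\mathrm{Dn}_\theta\Leftrightarrow\bigvee_{j}x^j_\theta=0)\wedge\bigwedge_{i\ne j}\neg(x^i_\theta=0\wedge x^j_\theta=0)\wedge\bigwedge_i\big(x^i_\theta=0\Rightarrow\mathbf{X}((x^{i+1}_\theta=0)\mathbf{R}\bigwedge_{k\ne i+1}x^k_\theta>0)\big)\Big]$. $m(\theta)$: for $p\in AP$, $m(p)=\top$; $m(\neg\psi)=\top_\theta\Leftrightarrow\bot_\psi$; $m(\gamma\wedge\psi)=\top_\theta\Leftrightarrow\top_\gamma\wedge\top_\psi$; $m(\gamma\mathbf{U}_{(0,+\infty)}\psi)=\top_\theta\Leftrightarrow\top_\gamma\wedge(\top_\gamma\mathbf{U}\top_\psi)$. For $\theta=\mathbf{F}_{\langle a,b]}\psi$, $a>0$, $b<\infty$, $m(\theta)$ is the conjunction of: (i) $\mathrm{Up}_\theta\Leftrightarrow\big[\neg O\wedge\bigvee_j\big(x^j_\theta=0\wedge\mathbf{X}(x^j_\theta>0\ \mathbf{U}\ (\mathrm{Up}_\psi\wedge x^j_\theta=b\wedge\bigvee_{i\in\{0,1\}}z^i_\psi>b-a))\big)\big]\vee\big[O\wedge((O\vee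 x^0_\theta>0)\ \mathbf{U}\ (\top_\psi\wedge(a\le x^0_\theta\le b\ \vee\ (x^0_\theta<a\wedge\mathbf{X}(x^0_\theta>a)))))\big]$; (ii) $\mathrm{Up}_\psi\wedge\bigvee_i z^i_\psi>b-a\Rightarrow\bigvee_j x^j_\theta=b$; (iii) $\mathrm{Dn}_\theta\Leftrightarrow\bigvee_j\big(x^j_\theta=0\wedge\mathbf{X}(x^j_\theta>0\ \mathbf{U}\ (\mathrm{Dn}_\psi\wedge x^j_\theta=a\wedge(\mathrm{Up}_\psi\mathbf{R}\neg(\mathrm{Up}_\psi\wedge x^j_\theta\le b))))\big)\vee(O\wedge\neg\mathrm{Up}_\theta)$; (iv) $\mathrm{Dn}_\psi\wedge(\mathrm{Up}_\psi\mathbf{R}\neg(\mathrm{Up}_\psi\wedge\bigwedge_i z^i_\psi\le b-a))\Rightarrow\bigvee_j x^j_\theta=a$. For $\theta=\mathbf{F}_{\langle0,b]}\psi$, $m(\theta)$ is the conjunction of: $\mathrm{Up}_\theta\Leftrightarrow\big[\neg O\wedge\bot_\psi\wedge\bigvee_{j\in\{0,1\}}\big(z^j_\theta=0\wedge\mathbf{X}(z^j_\theta>0\ \mathbf{U}\ (\mathrm{Up}_\psi\wedge z^j_\theta=b\wedge\bigvee_i z^i_\psi>b))\big)\big]\vee\big[O\wedge((O\vee z^0_\theta>0)\ \mathbf{U}\ (\top_\psi\wedge z^0_\theta\le b))\big]$; $\mathrm{Up}_\psi\wedge\bigvee_i z^i_\psi>b\Rightarrow\bigvee_{j\in\{0,1\}}z^j_\theta=b$;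 $\mathrm{Dn}_\theta\Leftrightarrow\mathrm{Dn}_\psi\wedge(\mathrm{Up}_\psi\mathbf{R}\neg(\mathrm{Up}_\psi\wedge\bigwedge_i z^i_\psi\le b))$. For $\theta=\mathbf{F}_{\langle a,+\infty)}\psi$, $m(\theta)$ is the conjunction of: $\mathrm{Up}_\theta\Leftrightarrow O\wedge((O\vee z^0_\theta>0)\ \mathbf{U}\ (\top_\psi\wedge(a\le z^0_\theta\vee(z^0_\theta<a\wedge\mathbf{X}(z^0_\theta>a)))))$; $\mathrm{Dn}_\theta\Leftrightarrow\big(z^1_\theta=0\wedge\mathbf{X}(z^1_\theta>0\ \mathbf{U}\ (\mathrm{Dn}_\psi\wedge z^1_\theta=a\wedge\mathbf{G}\neg\mathrm{Up}_\psi))\big)\vee(O\wedge\neg\mathrm{Up}_\theta)$; $\mathrm{Dn}_\psi\wedge\mathbf{G}\neg\mathrm{Up}_\psi\Rightarrow z^1_\theta=a$.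
   Formalization: The formal theorem additionally requires a>0 in every subformula F_⟨a,+∞)ψ, since for a=0 the equivalence fails (e.g. φ = θ ∧ F_[1,+∞)¬θ with θ = F_[0,+∞)p is satisfiable but its CLTL-oc formula is not). *)

theory Defs
  imports "HOL-Analysis.Analysis"
begin

section \<open>MITL over continuous-time signals\<close>

datatype bracket = Closed | Open

text \<open>\<open>FBnd l a b \<psi>\<close> is \<open>F\<close> over the right-closed interval from \<open>a\<close> to \<open>b\<close> and
  \<open>FInf l a \<psi>\<close> is \<open>F\<close> over the interval from \<open>a\<close> to infinity; \<open>l\<close> is the type of the left
  bracket.\<close>

datatype 'p mitl =
    Atom 'p
  | Neg "'p mitl"
  | Conj "'p mitl" "'p mitl"
  | Until "'p mitl" "'p mitl"
  | FBnd bracket nat nat "'p mitl"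
  | FInf bracket nat "'p mitl"

primrec mitl_over :: "'p set \<Rightarrow> 'p mitl \<Rightarrow> bool" where
  "mitl_over AP (Atom p) \<longleftrightarrow> p \<in> AP"
| "mitl_over AP (Neg \<psi>) \<longleftrightarrow> mitl_over AP \<psi>"
| "mitl_over AP (Conj \<gamma> \<psi>) \<longleftrightarrow> mitl_over AP \<gamma> \<and> mitl_over AP \<psi>"
| "mitl_over AP (Until \<gamma> \<psi>) \<longleftrightarrow> mitl_over AP \<gamma> \<and> mitl_over AP \<psi>"
| "mitl_over AP (FBnd l a b \<psi>) \<longleftrightarrow> a < b \<and> mitl_over AP \<psi>"
| "mitl_over AP (FInf l a \<psi>) \<longleftrightarrow> mitl_over AP \<psi>"

text \<open>The subformulas, as a list so that the conjunctions over \<open>sub(\<phi>)\<close> below are formulas.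
  A subformula with several occurrences is listed once.\<close>

primrec sub :: "'p mitl \<Rightarrow> 'p mitl list" where
  "sub (Atom p) = [Atom p]"
| "sub (Neg \<psi>) = remdups (Neg \<psi> # sub \<psi>)"
| "sub (Conj \<gamma> \<psi>) = remdups (Conj \<gamma> \<psi> # sub \<gamma> @ sub \<psi>)"
| "sub (Until \<gamma> \<psi>) = remdups (Until \<gamma> \<psi> # sub \<gamma> @ sub \<psi>)"
| "sub (FBnd l a b \<psi>) = remdups (FBnd l a b \<psi> # sub \<psi>)"
| "sub (FInf l a \<psi>) = remdups (FInf l a \<psi> # sub \<psi>)"

fun from_bound :: "bracket \<Rightarrow> nat \<Rightarrow> real set" where
  "from_bound Closed a = {real a..}"
| "from_bound Open a = {real a<..}"

text \<open>A signal is a function on the reals of which only the values at \<open>t \<ge> 0\<close> matter.\<close>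

primrec mitl_sat :: "(real \<Rightarrow> 'p set) \<Rightarrow> real \<Rightarrow> 'p mitl \<Rightarrow> bool" where
  "mitl_sat M t (Atom p) \<longleftrightarrow> p \<in> M t"
| "mitl_sat M t (Neg \<psi>) \<longleftrightarrow> \<not> mitl_sat M t \<psi>"
| "mitl_sat M t (Conj \<gamma> \<psi>) \<longleftrightarrow> mitl_sat M t \<gamma> \<and> mitl_sat M t \<psi>"
| "mitl_sat M t (Until \<gamma> \<psi>) \<longleftrightarrow>
     (\<exists>t'>t. mitl_sat M t' \<psi> \<and> (\<forall>t''\<in>{t<..<t'}. mitl_sat M t'' \<gamma>))"
| "mitl_sat M t (FBnd l a b \<psi>) \<longleftrightarrow>
     (\<exists>t' \<in> (+) t ` (from_bound l a \<inter> {..real b}). mitl_sat M t' \<psi>)"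
| "mitl_sat M t (FInf l a \<psi>) \<longleftrightarrow>
     (\<exists>t' \<in> (+) t ` from_bound l a. mitl_sat M t' \<psi>)"

definition lcro_nonzeno :: "(real \<Rightarrow> 'p set) \<Rightarrow> bool" where
  "lcro_nonzeno M \<longleftrightarrow>
     (\<exists>\<tau> :: nat \<Rightarrow> real. \<tau> 0 = 0 \<and> strict_mono \<tau> \<and> filterlim \<tau> at_top sequentially \<and>
        (\<forall>i. M constant_on {\<tau> i..<\<tau> (Suc i)}))"

definition mitl_satisfiable :: "'p set \<Rightarrow> 'p mitl \<Rightarrow> bool" where
  "mitl_satisfiable AP \<phi> \<longleftrightarrow>
     (\<exists>M. (\<forall>t\<ge>0. M t \<subseteq> AP) \<and> lcro_nonzeno M \<and> mitl_sat M 0 \<phi>)"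


section \<open>CLTL-oc\<close>

datatype cmp = LT | LE | EQ | GE | GT | NE

datatype ('q, 'c) cltl =
    CTrue  (\<open>\<^bold>\<top>\<close>)
  | Prop 'q
  | Cmp 'c cmp nat
  | CNot "('q, 'c) cltl"  (\<open>\<^bold>\<not> _\<close> [65] 65)
  | CAnd "('q, 'c) cltl" "('q, 'c) cltl"  (infixr \<open>\<^bold>\<and>\<close> 56)
  | Next "('q, 'c) cltl"
  | Prev "('q, 'c) cltl"
  | CUntil "('q, 'c) cltl" "('q, 'c) cltl"  (infixr \<open>\<^bold>U\<close> 60)

primrec compare :: "cmp \<Rightarrow> real \<Rightarrow> real \<Rightarrow> bool" where
  "compare LT u v \<longleftrightarrow> u < v"
| "compare LE u v \<longleftrightarrow> u \<le> v"
| "compare EQ u v \<longleftrightarrow> u = v"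
| "compare GE u v \<longleftrightarrow> u \<ge> v"
| "compare GT u v \<longleftrightarrow> u > v"
| "compare NE u v \<longleftrightarrow> u \<noteq> v"

primrec cltl_sat ::
    "(nat \<Rightarrow> 'q set) \<Rightarrow> (nat \<Rightarrow> 'c \<Rightarrow> real) \<Rightarrow> nat \<Rightarrow> ('q, 'c) cltl \<Rightarrow> bool" where
  "cltl_sat \<pi> \<sigma> i \<^bold>\<top> \<longleftrightarrow> True"
| "cltl_sat \<pi> \<sigma> i (Prop q) \<longleftrightarrow> q \<in> \<pi> i"
| "cltl_sat \<pi> \<sigma> i (Cmp x r c) \<longleftrightarrow> compare r (\<sigma> i x) (real c)"
| "cltl_sat \<pi> \<sigma> i (\<^bold>\<not> \<alpha>) \<longleftrightarrow> \<not> cltl_sat \<pi> \<sigma> i \<alpha>"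
| "cltl_sat \<pi> \<sigma> i (\<alpha> \<^bold>\<and> \<beta>) \<longleftrightarrow> cltl_sat \<pi> \<sigma> i \<alpha> \<and> cltl_sat \<pi> \<sigma> i \<beta>"
| "cltl_sat \<pi> \<sigma> i (Next \<alpha>) \<longleftrightarrow> cltl_sat \<pi> \<sigma> (Suc i) \<alpha>"
| "cltl_sat \<pi> \<sigma> i (Prev \<alpha>) \<longleftrightarrow> 0 < i \<and> cltl_sat \<pi> \<sigma> (i - 1) \<alpha>"
| "cltl_sat \<pi> \<sigma> i (\<alpha> \<^bold>U \<beta>) \<longleftrightarrow>
     (\<exists>j\<ge>i. cltl_sat \<pi> \<sigma> j \<beta> \<and> (\<forall>n. i \<le> n \<and> n < j \<longrightarrow> cltl_sat \<pi> \<sigma> n \<alpha>))"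

definition cltl_model :: "(nat \<Rightarrow> 'c \<Rightarrow> real) \<Rightarrow> (nat \<Rightarrow> real) \<Rightarrow> bool" where
  "cltl_model \<sigma> \<delta> \<longleftrightarrow>
     (\<forall>i. \<delta> i > 0) \<and> filterlim (\<lambda>n. \<Sum>i<n. \<delta> i) at_top sequentially \<and>
     (\<forall>i x. \<sigma> i x \<ge> 0) \<and>
     (\<forall>i x. \<sigma> (Suc i) x = \<sigma> i x + \<delta> i \<or> \<sigma> (Suc i) x = 0)"

definition cltl_satisfiable :: "('q, 'c) cltl \<Rightarrow> bool" where
  "cltl_satisfiable \<alpha> \<longleftrightarrow> (\<exists>\<pi> \<sigma> \<delta>. cltl_model \<sigma> \<delta> \<and> cltl_sat \<pi> \<sigma> 0 \<alpha>)"

definition COr :: "('q, 'c) cltl \<Rightarrow> ('q, 'c) cltl \<Rightarrow> ('q, 'c) cltl"  (infixr \<open>\<^bold>\<or>\<close> 54) where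
  "\<alpha> \<^bold>\<or> \<beta> = \<^bold>\<not> (\<^bold>\<not> \<alpha> \<^bold>\<and> \<^bold>\<not> \<beta>)"

definition CImp :: "('q, 'c) cltl \<Rightarrow> ('q, 'c) cltl \<Rightarrow> ('q, 'c) cltl"  (infixr \<open>\<^bold>\<Rightarrow>\<close> 52) where
  "(\<alpha> \<^bold>\<Rightarrow> \<beta>) = (\<^bold>\<not> \<alpha> \<^bold>\<or> \<beta>)"

definition CIff :: "('q, 'c) cltl \<Rightarrow> ('q, 'c) cltl \<Rightarrow> ('q, 'c) cltl"  (infixr \<open>\<^bold>\<Leftrightarrow>\<close> 52) where
  "(\<alpha> \<^bold>\<Leftrightarrow> \<beta>) = ((\<alpha> \<^bold>\<Rightarrow> \<beta>) \<^bold>\<and> (\<beta> \<^bold>\<Rightarrow> \<alpha>))"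

definition CRelease :: "('q, 'c) cltl \<Rightarrow> ('q, 'c) cltl \<Rightarrow> ('q, 'c) cltl"  (infixr \<open>\<^bold>R\<close> 60) where
  "\<alpha> \<^bold>R \<beta> = \<^bold>\<not> ((\<^bold>\<not> \<alpha>) \<^bold>U (\<^bold>\<not> \<beta>))"

definition Globally :: "('q, 'c) cltl \<Rightarrow> ('q, 'c) cltl" where
  "Globally \<alpha> = \<^bold>\<not> (\<^bold>\<top> \<^bold>U (\<^bold>\<not> \<alpha>))"

definition Orig :: "('q, 'c) cltl" where
  "Orig = \<^bold>\<not> (Prev \<^bold>\<top>)"

definition Conjs :: "('q, 'c) cltl list \<Rightarrow> ('q, 'c) cltl" where
  "Conjs \<alpha>s = foldr CAnd \<alpha>s \<^bold>\<top>"

definition Disjs :: "('q, 'c) cltl list \<Rightarrow> ('q, 'c) cltl" where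
  "Disjs \<alpha>s = foldr COr \<alpha>s (\<^bold>\<not> \<^bold>\<top>)"

abbreviation clk_lt (infix \<open>\<^bold><\<close> 70) where "x \<^bold>< c \<equiv> Cmp x LT c"
abbreviation clk_le (infix \<open>\<^bold>\<le>\<close> 70) where "x \<^bold>\<le> c \<equiv> Cmp x LE c"
abbreviation clk_eq (infix \<open>\<^bold>=\<close> 70) where "x \<^bold>= c \<equiv> Cmp x EQ c"
abbreviation clk_ge (infix \<open>\<^bold>\<ge>\<close> 70) where "x \<^bold>\<ge> c \<equiv> Cmp x GE c"
abbreviation clk_gt (infix \<open>\<^bold>>\<close> 70) where "x \<^bold>> c \<equiv> Cmp x GT c"
abbreviation clk_ne (infix \<open>\<^bold>\<noteq>\<close> 70) where "x \<^bold>\<noteq> c \<equiv> Cmp x NE c"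

lemma cltl_sat_derived [simp]:
  "cltl_sat \<pi> \<sigma> i (\<alpha> \<^bold>\<or> \<beta>) \<longleftrightarrow> cltl_sat \<pi> \<sigma> i \<alpha> \<or> cltl_sat \<pi> \<sigma> i \<beta>"
  "cltl_sat \<pi> \<sigma> i (\<alpha> \<^bold>\<Rightarrow> \<beta>) \<longleftrightarrow> (cltl_sat \<pi> \<sigma> i \<alpha> \<longrightarrow> cltl_sat \<pi> \<sigma> i \<beta>)"
  "cltl_sat \<pi> \<sigma> i (\<alpha> \<^bold>\<Leftrightarrow> \<beta>) \<longleftrightarrow> (cltl_sat \<pi> \<sigma> i \<alpha> \<longleftrightarrow> cltl_sat \<pi> \<sigma> i \<beta>)"
  "cltl_sat \<pi> \<sigma> i (Globally \<alpha>) \<longleftrightarrow> (\<forall>j\<ge>i. cltl_sat \<pi> \<sigma> j \<alpha>)"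
  "cltl_sat \<pi> \<sigma> i Orig \<longleftrightarrow> i = 0"
  by (auto simp: COr_def CImp_def CIff_def Globally_def Orig_def)

lemma cltl_sat_release:
  "cltl_sat \<pi> \<sigma> i (\<alpha> \<^bold>R \<beta>) \<longleftrightarrow>
     (\<forall>j\<ge>i. cltl_sat \<pi> \<sigma> j \<beta> \<or> (\<exists>n. i \<le> n \<and> n < j \<and> cltl_sat \<pi> \<sigma> n \<alpha>))"
  by (auto simp: CRelease_def)

lemma cltl_sat_Conjs [simp]:
  "cltl_sat \<pi> \<sigma> i (Conjs \<alpha>s) \<longleftrightarrow> (\<forall>\<alpha>\<in>set \<alpha>s. cltl_sat \<pi> \<sigma> i \<alpha>)"
  by (induction \<alpha>s) (auto simp: Conjs_def)

lemma cltl_sat_Disjs [simp]: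
  "cltl_sat \<pi> \<sigma> i (Disjs \<alpha>s) \<longleftrightarrow> (\<exists>\<alpha>\<in>set \<alpha>s. cltl_sat \<pi> \<sigma> i \<alpha>)"
  by (induction \<alpha>s) (auto simp: Disjs_def)


section \<open>The reduction\<close>

text \<open>The proposition \<open>\<top>\<^sub>\<theta>\<close> is \<open>Prop \<theta>\<close>; the clocks \<open>z\<^sup>i\<^sub>\<theta>\<close> and \<open>x\<^sup>j\<^sub>\<theta>\<close> are
  \<open>Z \<theta> i\<close> and \<open>X \<theta> j\<close>.  The types also contain names outside the vocabulary of a given
  formula; these do not occur in the formulas below.\<close>

datatype 'p clock = Z "'p mitl" nat | X "'p mitl" nat

type_synonym 'p tformula = "('p mitl, 'p clock) cltl"

abbreviation Tt :: "'p mitl \<Rightarrow> 'p tformula" where "Tt \<theta> \<equiv> Prop \<theta>"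
abbreviation Bt :: "'p mitl \<Rightarrow> 'p tformula" where "Bt \<theta> \<equiv> \<^bold>\<not> Tt \<theta>"

definition Up :: "'p mitl \<Rightarrow> 'p tformula" where
  "Up \<theta> = \<^bold>\<not> (Prev (Tt \<theta>)) \<^bold>\<and> Tt \<theta>"

definition Dn :: "'p mitl \<Rightarrow> 'p tformula" where
  "Dn \<theta> = \<^bold>\<not> (Prev (Bt \<theta>)) \<^bold>\<and> Bt \<theta>"

text \<open>The number \<open>d\<close> of clocks \<open>X \<theta> j\<close>; used only for \<open>\<theta> = FBnd l a b \<psi>\<close>.\<close>

fun nclocks :: "'p mitl \<Rightarrow> nat" where
  "nclocks (FBnd l a b \<psi>) = nat (2 * \<lceil>real b / (real b - real a)\<rceil>)"
| "nclocks _ = 0"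

definition events :: "'p mitl \<Rightarrow> 'p tformula" where
  "events \<phi> =
     Conjs (map (\<lambda>\<theta>. Z \<theta> 0 \<^bold>= 0) (sub \<phi>)) \<^bold>\<and>
     Globally (Conjs (map (\<lambda>\<theta>.
       ((Up \<theta> \<^bold>\<or> Dn \<theta>) \<^bold>\<Leftrightarrow> (Z \<theta> 0 \<^bold>= 0 \<^bold>\<or> Z \<theta> 1 \<^bold>= 0)) \<^bold>\<and>
       Conjs (map (\<lambda>i. Z \<theta> i \<^bold>= 0 \<^bold>\<Rightarrow> Next ((Z \<theta> (1 - i) \<^bold>= 0) \<^bold>R (Z \<theta> i \<^bold>\<noteq> 0))) [0, 1]))
       (sub \<phi>)))"

definition auxclocks :: "'p mitl \<Rightarrow> 'p tformula" where
  "auxclocks \<theta> =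
    (let d = nclocks \<theta> in
     X \<theta> 0 \<^bold>= 0 \<^bold>\<and>
     Globally (
       ((Up \<theta> \<^bold>\<or> Dn \<theta>) \<^bold>\<Leftrightarrow> Disjs (map (\<lambda>j. X \<theta> j \<^bold>= 0) [0..<d])) \<^bold>\<and>
       Conjs [\<^bold>\<not> (X \<theta> i \<^bold>= 0 \<^bold>\<and> X \<theta> j \<^bold>= 0). i \<leftarrow> [0..<d], j \<leftarrow> [0..<d], i \<noteq> j] \<^bold>\<and>
       Conjs (map (\<lambda>i. X \<theta> i \<^bold>= 0 \<^bold>\<Rightarrow>
           Next ((X \<theta> ((i + 1) mod d) \<^bold>= 0) \<^bold>R
                 Conjs [X \<theta> k \<^bold>> 0. k \<leftarrow> [0..<d], k \<noteq> (i + 1) mod d])) [0..<d])))"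

text \<open>All differences \<open>b - a\<close> below are differences of naturals with \<open>a < b\<close>.

  The clause for \<open>FInf l a \<psi>\<close> is meant for \<open>a > 0\<close>.  With \<open>a = 0\<close> a falling edge after
  position 0 would need \<open>Z \<theta> 1\<close> to be reset there and to be 0 again at a strictly later
  position, so \<open>\<top>\<^sub>\<theta>\<close> could never fall.\<close>

fun m :: "'p mitl \<Rightarrow> 'p tformula" where
  "m (Atom p) = \<^bold>\<top>"
| "m (Neg \<psi>) = (Tt (Neg \<psi>) \<^bold>\<Leftrightarrow> Bt \<psi>)"
| "m (Conj \<gamma> \<psi>) = (Tt (Conj \<gamma> \<psi>) \<^bold>\<Leftrightarrow> Tt \<gamma> \<^bold>\<and> Tt \<psi>)"
| "m (Until \<gamma> \<psi>) = (Tt (Until \<gamma> \<psi>) \<^bold>\<Leftrightarrow> Tt \<gamma> \<^bold>\<and> (Tt \<gamma> \<^bold>U Tt \<psi>))"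
| "m (FBnd l a b \<psi>) =
    (let \<theta> = FBnd l a b \<psi>; d = nclocks \<theta> in
     if 0 < a then
       (Up \<theta> \<^bold>\<Leftrightarrow>
          (\<^bold>\<not> Orig \<^bold>\<and>
             Disjs (map (\<lambda>j. X \<theta> j \<^bold>= 0 \<^bold>\<and>
               Next ((X \<theta> j \<^bold>> 0) \<^bold>U
                 (Up \<psi> \<^bold>\<and> X \<theta> j \<^bold>= b \<^bold>\<and> Disjs (map (\<lambda>i. Z \<psi> i \<^bold>> (b - a)) [0, 1])))) [0..<d])) \<^bold>\<or>
          (Orig \<^bold>\<and>
             ((Orig \<^bold>\<or> X \<theta> 0 \<^bold>> 0) \<^bold>U
               (Tt \<psi> \<^bold>\<and> ((X \<theta> 0 \<^bold>\<ge> a \<^bold>\<and> X \<theta> 0 \<^bold>\<le> b) \<^bold>\<or>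
                         (X \<theta> 0 \<^bold>< a \<^bold>\<and> Next (X \<theta> 0 \<^bold>> a))))))) \<^bold>\<and>
       (Up \<psi> \<^bold>\<and> Disjs (map (\<lambda>i. Z \<psi> i \<^bold>> (b - a)) [0, 1]) \<^bold>\<Rightarrow>
          Disjs (map (\<lambda>j. X \<theta> j \<^bold>= b) [0..<d])) \<^bold>\<and>
       (Dn \<theta> \<^bold>\<Leftrightarrow>
          Disjs (map (\<lambda>j. X \<theta> j \<^bold>= 0 \<^bold>\<and>
            Next ((X \<theta> j \<^bold>> 0) \<^bold>U
              (Dn \<psi> \<^bold>\<and> X \<theta> j \<^bold>= a \<^bold>\<and> (Up \<psi> \<^bold>R \<^bold>\<not> (Up \<psi> \<^bold>\<and> X \<theta> j \<^bold>\<le> b))))) [0..<d]) \<^bold>\<or>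
          (Orig \<^bold>\<and> \<^bold>\<not> Up \<theta>)) \<^bold>\<and>
       (Dn \<psi> \<^bold>\<and> (Up \<psi> \<^bold>R \<^bold>\<not> (Up \<psi> \<^bold>\<and> Conjs (map (\<lambda>i. Z \<psi> i \<^bold>\<le> (b - a)) [0, 1]))) \<^bold>\<Rightarrow>
          Disjs (map (\<lambda>j. X \<theta> j \<^bold>= a) [0..<d]))
     else
       (Up \<theta> \<^bold>\<Leftrightarrow>
          (\<^bold>\<not> Orig \<^bold>\<and> Bt \<psi> \<^bold>\<and>
             Disjs (map (\<lambda>j. Z \<theta> j \<^bold>= 0 \<^bold>\<and>
               Next ((Z \<theta> j \<^bold>> 0) \<^bold>U
                 (Up \<psi> \<^bold>\<and> Z \<theta> j \<^bold>= b \<^bold>\<and> Disjs (map (\<lambda>i. Z \<psi> i \<^bold>> b) [0, 1])))) [0, 1])) \<^bold>\<or>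
          (Orig \<^bold>\<and>
             ((Orig \<^bold>\<or> Z \<theta> 0 \<^bold>> 0) \<^bold>U (Tt \<psi> \<^bold>\<and> Z \<theta> 0 \<^bold>\<le> b)))) \<^bold>\<and>
       (Up \<psi> \<^bold>\<and> Disjs (map (\<lambda>i. Z \<psi> i \<^bold>> b) [0, 1]) \<^bold>\<Rightarrow>
          Disjs (map (\<lambda>j. Z \<theta> j \<^bold>= b) [0, 1])) \<^bold>\<and>
       (Dn \<theta> \<^bold>\<Leftrightarrow>
          Dn \<psi> \<^bold>\<and> (Up \<psi> \<^bold>R \<^bold>\<not> (Up \<psi> \<^bold>\<and> Conjs (map (\<lambda>i. Z \<psi> i \<^bold>\<le> b) [0, 1])))))"
| "m (FInf l a \<psi>) =
    (let \<theta> = FInf l a \<psi> in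
       (Up \<theta> \<^bold>\<Leftrightarrow>
          Orig \<^bold>\<and>
            ((Orig \<^bold>\<or> Z \<theta> 0 \<^bold>> 0) \<^bold>U
              (Tt \<psi> \<^bold>\<and> (Z \<theta> 0 \<^bold>\<ge> a \<^bold>\<or> (Z \<theta> 0 \<^bold>< a \<^bold>\<and> Next (Z \<theta> 0 \<^bold>> a)))))) \<^bold>\<and>
       (Dn \<theta> \<^bold>\<Leftrightarrow>
          (Z \<theta> 1 \<^bold>= 0 \<^bold>\<and>
             Next ((Z \<theta> 1 \<^bold>> 0) \<^bold>U (Dn \<psi> \<^bold>\<and> Z \<theta> 1 \<^bold>= a \<^bold>\<and> Globally (\<^bold>\<not> Up \<psi>)))) \<^bold>\<or>
          (Orig \<^bold>\<and> \<^bold>\<not> Up \<theta>)) \<^bold>\<and>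
       (Dn \<psi> \<^bold>\<and> Globally (\<^bold>\<not> Up \<psi>) \<^bold>\<Rightarrow> Z \<theta> 1 \<^bold>= a))"

fun is_FBnd :: "'p mitl \<Rightarrow> bool" where
  "is_FBnd (FBnd l a b \<psi>) \<longleftrightarrow> True"
| "is_FBnd _ \<longleftrightarrow> False"

end

theory Submission
  imports Defs
begin

text \<open>
  Each subformula defines a right-continuous, locally finite truth function of time, and such
  functions are determined by their rising and falling edges at positive times together with the
  value at \<open>0\<close>. For \<open>F\<close> over \<open>[a, b]\<close> applied to \<open>\<psi>\<close>, a rising edge at \<open>T > 0\<close> corresponds to a
  rising edge of \<open>\<psi>\<close> at \<open>T + b\<close> that ends a gap longer than \<open>b - a\<close>, and a falling edge at \<open>T\<close> to a
  falling edge of \<open>\<psi>\<close> at \<open>T + a\<close> that begins such a gap; a bracket open on the left makes no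
  difference. In a CLTL-oc model the clauses of \<open>m \<theta>\<close> force the edges of \<open>\<top>\<^sub>\<theta>\<close> at positive times to be
  exactly these, and when there are none they force the right value at \<open>0\<close>. Conversely, the change
  points of all subformulas of a signal, together with the natural numbers, serve as positions of a
  model. There the \<open>d\<close> clocks suffice because any time window \<open>(y, y + a]\<close> contains at most \<open>d - 2\<close> edges.
\<close>

section \<open>Piecewise constant truth values over real time\<close>

text \<open>Position 0 shapes the proof. It is an event whatever holds there, and the clocks other
  than number 0 start at values that the formula leaves open. For soundness this is harmless: a
  clock that reads less than the elapsed time has been reset at a positive position, and for
  \<open>a > 0\<close> the origin clause is consulted only when no event follows, so that clock 0
  shows absolute time. For completeness the start values have to be chosen. Edges whose time would
  be negative still make the clauses demand a clock that reads \<open>a\<close> or \<open>b\<close>;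
  such a clock must start as if it had been reset before time 0. On the other hand, if
  \<open>\<psi>\<close> holds at 0, then \<open>Z \<psi> 1\<close> must not start above
  \<open>b - a\<close>, or the initial rise would look like the end of a long gap. The natural
  numbers are positions because the origin clause compares successive values of clock 0: with steps
  of at most 1 \<le> a, a reset is never followed directly by a value above \<open>a\<close>, and
  time \<open>a\<close> is available as a witness. The factor 2 in \<open>d\<close> accounts for
  rising and falling edges separately.\<close>

definition locfin :: "real set \<Rightarrow> bool" where
  "locfin D \<longleftrightarrow> (\<forall>w. finite (D \<inter> {0<..w}))"

text \<open>The interval misses \<open>u\<close> and contains \<open>v\<close>: a change announced
  by a point of \<open>D\<close> is already in force at that point. For locally finite
  \<open>D\<close> this says that \<open>f\<close> is right-continuous with all its changes in
  \<open>D\<close>.\<close>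

definition adapted :: "real set \<Rightarrow> (real \<Rightarrow> bool) \<Rightarrow> bool" where
  "adapted D f \<longleftrightarrow> (\<forall>u v. 0 \<le> u \<longrightarrow> u \<le> v \<longrightarrow> D \<inter> {u<..v} = {} \<longrightarrow> f u = f v)"

lemma adaptedD: "adapted D f \<Longrightarrow> 0 \<le> u \<Longrightarrow> u \<le> v \<Longrightarrow> D \<inter> {u<..v} = {} \<Longrightarrow> f u = f v"
  by (auto simp: adapted_def)

lemma adapted_mono: "adapted D f \<Longrightarrow> D \<subseteq> D' \<Longrightarrow> adapted D' f"
  unfolding adapted_def by blast

lemma locfin_Un: "locfin D \<Longrightarrow> locfin D' \<Longrightarrow> locfin (D \<union> D')"
  by (auto simp: locfin_def Int_Un_distrib2)

lemma locfin_UN: "finite I \<Longrightarrow> (\<And>i. i \<in> I \<Longrightarrow> locfin (D i)) \<Longrightarrow> locfin (\<Union>i\<in>I. D i)"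
  unfolding locfin_def by (metis (no_types, lifting) finite_UN_I Int_UN_distrib2 Int_commute Int_UN_distrib)

lemma locfin_shift:
  assumes "locfin D" "0 \<le> c"
  shows "locfin ((\<lambda>d. d - c) ` D)"
  unfolding locfin_def
proof
  fix w
  have "((\<lambda>d. d - c) ` D) \<inter> {0<..w} \<subseteq> (\<lambda>d. d - c) ` (D \<inter> {0<..w + c})"
    using assms(2) by auto
  then show "finite (((\<lambda>d. d - c) ` D) \<inter> {0<..w})"
    using assms(1) by (meson finite_imageI finite_subset locfin_def)
qed

lemma locfin_right:
  assumes "locfin D" "0 \<le> t"
  obtains v where "v > t" "D \<inter> {t<..v} = {}"
proof (cases "D \<inter> {t<..t+1} = {}")
  case True
  then show ?thesis using that[of "t+1"] by auto
next
  case False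
  have "finite (D \<inter> {t<..t+1})"
    by (rule finite_subset[of _ "D \<inter> {0<..t+1}"]) (use assms in \<open>auto simp: locfin_def\<close>)
  define l where "l = Min (D \<inter> {t<..t+1})"
  have l: "l \<in> D \<inter> {t<..t+1}" "\<And>x. x \<in> D \<inter> {t<..t+1} \<Longrightarrow> l \<le> x"
    unfolding l_def using False \<open>finite _\<close> by (auto intro: Min_in simp del: Int_iff)
  show ?thesis
    by (rule that[of "(t + l)/2"]) (use l in fastforce)+
qed

lemma locfin_left:
  assumes "locfin D" "0 < T"
  obtains u where "0 \<le> u" "u < T" "D \<inter> {u<..<T} = {}"
proof (cases "D \<inter> {0<..<T} = {}")
  case True
  then show ?thesis using that[of 0] assms by auto
next
  case False
  have fin: "finite (D \<inter> {0<..<T})"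
    by (rule finite_subset[of _ "D \<inter> {0<..T}"]) (use assms in \<open>auto simp: locfin_def\<close>)
  define l where "l = Max (D \<inter> {0<..<T})"
  have l: "l \<in> D \<inter> {0<..<T}" "\<And>x. x \<in> D \<inter> {0<..<T} \<Longrightarrow> x \<le> l"
    unfolding l_def using False fin by (auto intro: Max_in simp del: Int_iff)
  show ?thesis
    by (rule that[of l]) (use l in fastforce)+
qed

lemma adapted_right:
  assumes "locfin D" "adapted D f" "0 \<le> t"
  obtains v where "v > t" "\<And>w. t \<le> w \<Longrightarrow> w \<le> v \<Longrightarrow> f w = f t"
proof -
  obtain v where v: "v > t" "D \<inter> {t<..v} = {}" using locfin_right assms by blast
  have "f w = f t" if "t \<le> w" "w \<le> v" for w
    using adaptedD[OF assms(2,3) that(1)] v(2) that by fastforce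
  then show ?thesis using that v by blast
qed

definition up_edge :: "(real \<Rightarrow> bool) \<Rightarrow> real \<Rightarrow> bool" where
  "up_edge f T \<longleftrightarrow> f T \<and> (\<exists>u. 0 \<le> u \<and> u < T \<and> (\<forall>w. u \<le> w \<and> w < T \<longrightarrow> \<not> f w))"

definition dn_edge :: "(real \<Rightarrow> bool) \<Rightarrow> real \<Rightarrow> bool" where
  "dn_edge f T \<longleftrightarrow> \<not> f T \<and> (\<exists>u. 0 \<le> u \<and> u < T \<and> (\<forall>w. u \<le> w \<and> w < T \<longrightarrow> f w))"

lemma edge_iff:
  assumes "0 \<le> u" "u < T" "\<And>x. u \<le> x \<Longrightarrow> x < T \<Longrightarrow> h x = h u"
  shows "up_edge h T \<longleftrightarrow> h T \<and> \<not> h u" "dn_edge h T \<longleftrightarrow> \<not> h T \<and> h u"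
proof -
  have *: "\<exists>y. x \<le> y \<and> y < T \<and> h y = h u" if "x < T" for x
    using that assms(1,2) assms(3)[of "max x u"] by (intro exI[of _ "max x u"]) simp
  show "up_edge h T \<longleftrightarrow> h T \<and> \<not> h u"
  proof
    assume "up_edge h T"
    then obtain v where "h T" "v < T" "\<forall>w. v \<le> w \<and> w < T \<longrightarrow> \<not> h w" by (auto simp: up_edge_def)
    with * show "h T \<and> \<not> h u" by metis
  next
    assume "h T \<and> \<not> h u"
    then show "up_edge h T" using assms unfolding up_edge_def by blast
  qed
  show "dn_edge h T \<longleftrightarrow> \<not> h T \<and> h u"
  proof
    assume "dn_edge h T"
    then obtain v where "\<not> h T" "v < T" "\<forall>w. v \<le> w \<and> w < T \<longrightarrow> h w" by (auto simp: dn_edge_def)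
    with * show "\<not> h T \<and> h u" by metis
  next
    assume "\<not> h T \<and> h u"
    then show "dn_edge h T" using assms unfolding dn_edge_def by blast
  qed
qed

text \<open>Equal edges make the truth value of \<open>f = g\<close> invariant across every point of
  \<open>D\<close>, so \<open>f\<close> and \<open>g\<close> agree everywhere or are complementary
  everywhere. A single edge rules out the second case, because it fixes the value of both functions
  at its time; \<open>init\<close> covers functions without edges.\<close>

lemma agree_if_same_edges:
  assumes D: "locfin D" "adapted D f" "adapted D g"
    and up: "\<And>T. 0 < T \<Longrightarrow> up_edge f T \<longleftrightarrow> up_edge g T"
    and dn: "\<And>T. 0 < T \<Longrightarrow> dn_edge f T \<longleftrightarrow> dn_edge g T"
    and init: "(\<And>T. 0 < T \<Longrightarrow> \<not> up_edge g T \<and> \<not> dn_edge g T) \<Longrightarrow> f 0 = g 0"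
    and "0 \<le> w"
  shows "f w = g w"
proof -
  have const: "(f w = g w) = (f 0 = g 0)" if "0 \<le> w" for w
    using that
  proof (induction "card (D \<inter> {0<..w})" arbitrary: w rule: less_induct)
    case less
    have fin: "finite (D \<inter> {0<..w})" using D(1) by (simp add: locfin_def)
    show ?case
    proof (cases "D \<inter> {0<..w} = {}")
      case True
      then show ?thesis using adaptedD[OF D(2) _ less.prems] adaptedD[OF D(3) _ less.prems] by simp
    next
      case False
      define T where "T = Max (D \<inter> {0<..w})"
      have T: "T \<in> D \<inter> {0<..w}" "\<And>x. x \<in> D \<inter> {0<..w} \<Longrightarrow> x \<le> T"
        unfolding T_def using False fin by (auto intro: Max_in simp del: Int_iff)
      have "D \<inter> {T<..w} = {}" using T by fastforce
      then have wT: "f w = f T" "g w = g T"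
        using adaptedD[OF D(2), of T w] adaptedD[OF D(3), of T w] T(1) by auto
      have "0 < T" using T(1) by auto
      obtain u where u: "0 \<le> u" "u < T" "D \<inter> {u<..<T} = {}"
        using locfin_left[OF D(1) \<open>0 < T\<close>] by blast
      have cu: "f x = f u" "g x = g u" if "u \<le> x" "x < T" for x
      proof -
        have "D \<inter> {u<..x} = {}" using u(3) that by fastforce
        then show "f x = f u" "g x = g u"
          using adaptedD[OF D(2) u(1) that(1)] adaptedD[OF D(3) u(1) that(1)] by simp_all
      qed
      have "card (D \<inter> {0<..u}) < card (D \<inter> {0<..w})"
      proof (rule psubset_card_mono[OF fin])
        show "D \<inter> {0<..u} \<subset> D \<inter> {0<..w}"
        proof
          show "D \<inter> {0<..u} \<subseteq> D \<inter> {0<..w}" using T(1) u by fastforce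
          have "T \<in> D \<inter> {0<..w}" "T \<notin> D \<inter> {0<..u}" using T(1) u by simp_all
          then show "D \<inter> {0<..u} \<noteq> D \<inter> {0<..w}" by blast
        qed
      qed
      then have IH: "(f u = g u) = (f 0 = g 0)" using less.hyps u(1) by blast
      have edges: "up_edge h T \<longleftrightarrow> h T \<and> \<not> h u" "dn_edge h T \<longleftrightarrow> \<not> h T \<and> h u"
        if h: "\<And>x. u \<le> x \<Longrightarrow> x < T \<Longrightarrow> h x = h u" for h
        using edge_iff[OF u(1,2), of h] h by blast+
      \<comment> \<open>At \<open>T\<close> either both functions switch in the same direction, or
        neither switches and both keep the value that they had at \<open>u\<close>.\<close>
      have "(f T = g T) = (f u = g u)"
        using up[OF \<open>0 < T\<close>] dn[OF \<open>0 < T\<close>] edges[of f, OF cu(1)] edges[of g, OF cu(2)] by metis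
      then show ?thesis using IH wT by simp
    qed
  qed
  have "f 0 = g 0"
  proof (rule ccontr)
    assume ne: "f 0 \<noteq> g 0"
    then obtain T where "0 < T" "up_edge g T \<or> dn_edge g T" using init by blast
    then have "(f T \<and> g T) \<or> (\<not> f T \<and> \<not> g T)"
      using up[of T] dn[of T] unfolding up_edge_def dn_edge_def by blast
    then show False using const[of T] ne \<open>0 < T\<close> by simp
  qed
  then show ?thesis using const[OF \<open>0 \<le> w\<close>] by simp
qed

section \<open>Bounded, unbounded and until operators on truth functions, and their change
  points\<close>

definition FB :: "real \<Rightarrow> real \<Rightarrow> (real \<Rightarrow> bool) \<Rightarrow> real \<Rightarrow> bool" where
  "FB a b f t \<longleftrightarrow> (\<exists>w. t + a \<le> w \<and> w \<le> t + b \<and> f w)"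

definition FI :: "real \<Rightarrow> (real \<Rightarrow> bool) \<Rightarrow> real \<Rightarrow> bool" where
  "FI a f t \<longleftrightarrow> (\<exists>w. t + a \<le> w \<and> f w)"

definition UT :: "(real \<Rightarrow> bool) \<Rightarrow> (real \<Rightarrow> bool) \<Rightarrow> real \<Rightarrow> bool" where
  "UT f g t \<longleftrightarrow> (\<exists>w>t. g w \<and> (\<forall>v\<in>{t<..<w}. f v))"

text \<open>The value can change only when one of the ends \<open>t + a\<close>,
  \<open>t + b\<close> of the window passes a point of \<open>D\<close>. If the witness drops out of
  the window, the nearer end of the new window serves instead, since nothing changes in
  between.\<close>

lemma adapted_FB:
  assumes f: "adapted D f" and ab: "0 \<le> a" "a \<le> b"
  shows "adapted ((\<lambda>d. d - a) ` D \<union> (\<lambda>d. d - b) ` D) (FB a b f)"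
  unfolding adapted_def
proof (intro allI impI)
  fix u v :: real
  assume uv: "0 \<le> u" "u \<le> v" and e: "((\<lambda>d. d - a) ` D \<union> (\<lambda>d. d - b) ` D) \<inter> {u<..v} = {}"
  have ea: "D \<inter> {u+a<..v+a} = {}"
  proof -
    have False if "d \<in> D" "u+a < d" "d \<le> v+a" for d
    proof -
      have "d - a \<in> {u<..v}" using that by auto
      then show False using e that(1) by blast
    qed
    then show ?thesis by auto
  qed
  have eb: "D \<inter> {u+b<..v+b} = {}"
  proof -
    have False if "d \<in> D" "u+b < d" "d \<le> v+b" for d
    proof -
      have "d - b \<in> {u<..v}" using that by auto
      then show False using e that(1) by blast
    qed
    then show ?thesis by auto
  qed
  show "FB a b f u = FB a b f v"
  proof
    assume "FB a b f u"
    then obtain w where w: "u + a \<le> w" "w \<le> u + b" "f w" by (auto simp: FB_def)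
    show "FB a b f v"
    proof (cases "v + a \<le> w")
      case True
      then show ?thesis using w uv by (auto simp: FB_def intro!: exI[of _ w])
    next
      case False
      have "f w = f (v + a)"
        by (rule adaptedD[OF f]) (use w uv ab False ea in fastforce)+
      then show ?thesis using w ab by (auto simp: FB_def intro!: exI[of _ "v+a"])
    qed
  next
    assume "FB a b f v"
    then obtain w where w: "v + a \<le> w" "w \<le> v + b" "f w" by (auto simp: FB_def)
    show "FB a b f u"
    proof (cases "w \<le> u + b")
      case True
      then show ?thesis using w uv by (auto simp: FB_def intro!: exI[of _ w])
    next
      case False
      have "f (u + b) = f w"
        by (rule adaptedD[OF f]) (use w uv ab False eb in fastforce)+
      then show ?thesis using w ab by (auto simp: FB_def intro!: exI[of _ "u+b"])
    qed
  qed
qed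

lemma adapted_FI:
  assumes f: "adapted D f" and ab: "0 \<le> a"
  shows "adapted ((\<lambda>d. d - a) ` D) (FI a f)"
  unfolding adapted_def
proof (intro allI impI)
  fix u v :: real
  assume uv: "0 \<le> u" "u \<le> v" and e: "((\<lambda>d. d - a) ` D) \<inter> {u<..v} = {}"
  have ea: "D \<inter> {u+a<..v+a} = {}"
  proof -
    have False if "d \<in> D" "u+a < d" "d \<le> v+a" for d
    proof -
      have "d - a \<in> {u<..v}" using that by auto
      then show False using e that(1) by blast
    qed
    then show ?thesis by auto
  qed
  show "FI a f u = FI a f v"
  proof
    assume "FI a f u"
    then obtain w where w: "u + a \<le> w" "f w" by (auto simp: FI_def)
    show "FI a f v"
    proof (cases "v + a \<le> w")
      case True
      then show ?thesis using w uv by (auto simp: FI_def intro!: exI[of _ w])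
    next
      case False
      have "f w = f (v + a)"
        by (rule adaptedD[OF f]) (use w uv ab False ea in fastforce)+
      then show ?thesis using w ab by (auto simp: FI_def intro!: exI[of _ "v+a"])
    qed
  next
    assume "FI a f v"
    then obtain w where w: "v + a \<le> w" "f w" by (auto simp: FI_def)
    then show "FI a f u"
      using w uv by (auto simp: FI_def intro!: exI[of _ w])
  qed
qed

text \<open>No change points are added: a witness inside a stretch \<open>(u, v]\<close> where
  \<open>f\<close> and \<open>g\<close> are constant can be moved to a time just after
  \<open>v\<close>, where right-continuity leaves room.\<close>

lemma adapted_UT:
  assumes D: "locfin D" and f: "adapted D f" and g: "adapted D g"
  shows "adapted D (UT f g)"
  unfolding adapted_def
proof (intro allI impI)
  fix u v :: real
  assume uv: "0 \<le> u" "u \<le> v" and e: "D \<inter> {u<..v} = {}"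
  have cf: "f x = f v" "g x = g v" if "u \<le> x" "x \<le> v" for x
  proof -
    have *: "D \<inter> {x<..v} = {}" "0 \<le> x" using e that uv by auto
    show "f x = f v" "g x = g v"
      using adaptedD[OF f *(2) that(2) *(1)] adaptedD[OF g *(2) that(2) *(1)] by auto
  qed
  show "UT f g u = UT f g v"
  proof (cases "u = v")
    case False
    show ?thesis
    proof
      assume "UT f g u"
      then obtain w where w: "w > u" "g w" "\<forall>y\<in>{u<..<w}. f y" by (auto simp: UT_def)
      show "UT f g v"
      proof (cases "v < w")
        case True
        then show ?thesis using w uv by (auto simp: UT_def intro!: exI[of _ w])
      next
        case le: False
        have "v \<ge> 0" using uv by simp
        obtain r where r: "r > v" "\<And>y. v \<le> y \<Longrightarrow> y \<le> r \<Longrightarrow> f y = f v"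
          using adapted_right[OF D f \<open>v \<ge> 0\<close>] by blast
        obtain r' where r': "r' > v" "\<And>y. v \<le> y \<Longrightarrow> y \<le> r' \<Longrightarrow> g y = g v"
          using adapted_right[OF D g \<open>v \<ge> 0\<close>] by blast
        \<comment> \<open>The witness \<open>w\<close> lies in \<open>(u, v]\<close>. As
          \<open>(u, w)\<close> is nonempty, \<open>f\<close> holds in it and hence, by constancy,
          at \<open>v\<close>; a time shortly after \<open>v\<close> is then a new witness.\<close>
        have "f ((u+w)/2)" using w by auto
        then have "f v" using cf(1)[of "(u+w)/2"] w le by auto
        moreover have "g v" using cf(2)[of w] w le by auto
        moreover have "f y" if "v < y" "y < r" for y using r(2)[of y] that \<open>f v\<close> by simp
        moreover have "g (min r r')" using r'(2)[of "min r r'"] r(1) r'(1) \<open>g v\<close> by simp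
        ultimately show ?thesis unfolding UT_def
          by (intro exI[of _ "min r r'"]) (use r(1) r'(1) in auto)
      qed
    next
      assume "UT f g v"
      then obtain w where w: "w > v" "g w" "\<forall>y\<in>{v<..<w}. f y" by (auto simp: UT_def)
      have "v \<ge> 0" using uv by simp
      obtain r where r: "r > v" "\<And>y. v \<le> y \<Longrightarrow> y \<le> r \<Longrightarrow> f y = f v"
        using adapted_right[OF D f \<open>v \<ge> 0\<close>] by blast
      have "min r ((v+w)/2) \<in> {v<..<w}" using w(1) r(1) by (auto simp: min_def field_simps)
      then have "f (min r ((v+w)/2))" using w(3) by blast
      then have "f v" using r(2)[of "min r ((v+w)/2)"] w r(1) by auto
      have "f y" if "u < y" "y < w" for y
        using cf(1)[of y] w(3) that \<open>f v\<close> by (cases "y \<le> v") auto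
      then show "UT f g u" using w uv unfolding UT_def
        by (intro exI[of _ w]) auto
    qed
  qed simp
qed

text \<open>Only an open left bracket needs an argument: a witness at the excluded end point can be
  moved slightly to the right by right-continuity, and \<open>a < b\<close> keeps it inside the
  window.\<close>

lemma sat_FBnd:
  assumes "locfin D" "adapted D (\<lambda>t. mitl_sat M t \<psi>)" "0 \<le> t" "a < b"
  shows "mitl_sat M t (FBnd l a b \<psi>) = FB a b (\<lambda>t. mitl_sat M t \<psi>) t"
proof
  assume "mitl_sat M t (FBnd l a b \<psi>)"
  then obtain x where "x \<in> from_bound l a" "x \<le> real b" "mitl_sat M (t + x) \<psi>" by auto
  moreover from this(1) have "real a \<le> x" by (cases l) auto
  ultimately show "FB a b (\<lambda>t. mitl_sat M t \<psi>) t"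
    by (auto simp: FB_def intro!: exI[of _ "t + x"])
next
  assume "FB a b (\<lambda>t. mitl_sat M t \<psi>) t"
  then obtain w where w: "t + a \<le> w" "w \<le> t + b" "mitl_sat M w \<psi>" by (auto simp: FB_def)
  show "mitl_sat M t (FBnd l a b \<psi>)"
  proof (cases "l = Open \<and> w = t + a")
    case True
    have "0 \<le> w" using w assms by simp
    obtain v where v: "v > w" "\<And>y. w \<le> y \<Longrightarrow> y \<le> v \<Longrightarrow> mitl_sat M y \<psi> = mitl_sat M w \<psi>"
      using adapted_right[OF assms(1,2) \<open>0 \<le> w\<close>] by blast
    have "mitl_sat M (min v (t+b)) \<psi>" using v(1) v(2)[of "min v (t+b)"] w True assms(4) by simp
    then show ?thesis using True v(1) w assms(4)
      by (auto intro!: bexI[of _ "min v (t+b) - t"])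
  next
    case False
    then show ?thesis using w
      by (cases l) (auto intro!: bexI[of _ "w - t"])
  qed
qed

lemma sat_FInf:
  assumes "locfin D" "adapted D (\<lambda>t. mitl_sat M t \<psi>)" "0 \<le> t"
  shows "mitl_sat M t (FInf l a \<psi>) = FI a (\<lambda>t. mitl_sat M t \<psi>) t"
proof
  assume "mitl_sat M t (FInf l a \<psi>)"
  then obtain x where "x \<in> from_bound l a" "mitl_sat M (t + x) \<psi>" by auto
  moreover from this(1) have "real a \<le> x" by (cases l) auto
  ultimately show "FI a (\<lambda>t. mitl_sat M t \<psi>) t"
    by (auto simp: FI_def intro!: exI[of _ "t + x"])
next
  assume "FI a (\<lambda>t. mitl_sat M t \<psi>) t"
  then obtain w where w: "t + a \<le> w" "mitl_sat M w \<psi>" by (auto simp: FI_def)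
  show "mitl_sat M t (FInf l a \<psi>)"
  proof (cases "l = Open \<and> w = t + a")
    case True
    have "0 \<le> w" using w assms by simp
    obtain v where v: "v > w" "\<And>y. w \<le> y \<Longrightarrow> y \<le> v \<Longrightarrow> mitl_sat M y \<psi> = mitl_sat M w \<psi>"
      using adapted_right[OF assms(1,2) \<open>0 \<le> w\<close>] by blast
    have "mitl_sat M v \<psi>" using v(1) v(2)[of v] w by simp
    then show ?thesis using True v(1) w
      by (auto intro!: bexI[of _ "v - t"])
  next
    case False
    then have "w - t \<in> from_bound l a" using w by (cases l) auto
    then have "w \<in> (+) t ` from_bound l a" by (rule image_eqI[rotated]) simp
    then show ?thesis using w(2) by auto
  qed
qed

lemma sat_Until: "mitl_sat M t (Until \<gamma> \<psi>) = UT (\<lambda>t. mitl_sat M t \<gamma>) (\<lambda>t. mitl_sat M t \<psi>) t"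
  by (simp add: UT_def)

lemma adapted_cong:
  assumes "adapted D f" "\<And>t. 0 \<le> t \<Longrightarrow> f t = g t"
  shows "adapted D g"
  using assms unfolding adapted_def by (metis order_trans)

section \<open>Timelines and events\<close>

text \<open>As with the formulas \<open>Up\<close> and \<open>Dn\<close>, whose \<open>Prev\<close>
  fails at the origin, position 0 always counts as a rise or as a fall.\<close>

definition up :: "(nat \<Rightarrow> bool) \<Rightarrow> nat \<Rightarrow> bool" where
  "up P k \<longleftrightarrow> P k \<and> (k = 0 \<or> \<not> P (k - 1))"

definition dn :: "(nat \<Rightarrow> bool) \<Rightarrow> nat \<Rightarrow> bool" where
  "dn P k \<longleftrightarrow> \<not> P k \<and> (k = 0 \<or> P (k - 1))"

lemma event_iff: "up P k \<or> dn P k \<longleftrightarrow> k = 0 \<or> P k \<noteq> P (k - 1)"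
  by (auto simp: up_def dn_def)

lemma const_without_events:
  assumes "p \<le> n" "\<And>i. p < i \<Longrightarrow> i \<le> n \<Longrightarrow> \<not> (up P i \<or> dn P i)"
  shows "P n = P p"
  using assms
proof (induction n rule: dec_induct)
  case (step n)
  have "P (Suc n) = P n" using step.prems[of "Suc n"] step.hyps by (auto simp: event_iff)
  then show ?case using step by auto
qed simp

lemma first_up:
  assumes "\<not> P q" "q < s" "P s"
  obtains s' where "q < s'" "s' \<le> s" "up P s'" "\<And>n. q \<le> n \<Longrightarrow> n < s' \<Longrightarrow> \<not> P n"
proof -
  define s' where "s' = (LEAST s. q < s \<and> P s)"
  have s': "q < s'" "P s'" using LeastI[of "\<lambda>s. q < s \<and> P s" s] assms by (auto simp: s'_def)
  have min: "\<not> P n" if "q \<le> n" "n < s'" for n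
    using not_less_Least[of n "\<lambda>s. q < s \<and> P s"] that assms(1) by (cases "n = q") (auto simp: s'_def)
  have "s' \<le> s" using assms by (auto simp: s'_def intro: Least_le)
  moreover have "up P s'" using s' min[of "s' - 1"] by (auto simp: up_def)
  ultimately show ?thesis using that s' min by blast
qed

text \<open>A release with \<open>up P\<close> as releasing condition tests \<open>A\<close> only at
  the first rise after \<open>q\<close>; that rise lifts the obligation for all later ones. Since
  \<open>P q\<close> fails, \<open>q\<close> itself is not a rise.\<close>

lemma release_first_up:
  assumes "\<not> P q"
  shows "(\<forall>s\<ge>q. \<not> (up P s \<and> A s) \<or> (\<exists>n. q \<le> n \<and> n < s \<and> up P n)) \<longleftrightarrow>
    (\<forall>s>q. up P s \<longrightarrow> (\<forall>n. q \<le> n \<and> n < s \<longrightarrow> \<not> P n) \<longrightarrow> \<not> A s)" (is "?L \<longleftrightarrow> ?R")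
proof
  assume L: ?L
  show ?R
  proof (intro allI impI)
    fix s assume "q < s" "up P s" "\<forall>n. q \<le> n \<and> n < s \<longrightarrow> \<not> P n"
    moreover from this have "\<not> up P n" if "q \<le> n" "n < s" for n using that by (auto simp: up_def)
    ultimately show "\<not> A s" using L[rule_format, of s] by fastforce
  qed
next
  assume R: ?R
  show ?L
  proof (intro allI impI)
    fix s assume "q \<le> s"
    show "\<not> (up P s \<and> A s) \<or> (\<exists>n. q \<le> n \<and> n < s \<and> up P n)"
    proof (cases "up P s \<and> A s")
      case True
      then have "q < s" using \<open>q \<le> s\<close> assms by (cases "q = s") (auto simp: up_def)
      then obtain s' where s': "q < s'" "s' \<le> s" "up P s'" "\<And>n. q \<le> n \<Longrightarrow> n < s' \<Longrightarrow> \<not> P n"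
        using first_up[of P q s] assms True unfolding up_def by blast
      then show ?thesis using R True by (metis le_neq_implies_less less_imp_le)
    qed simp
  qed
qed

locale timeline =
  fixes t :: "nat \<Rightarrow> real"
  assumes t0: "t 0 = 0"
    and mono: "strict_mono t"
    and lim: "filterlim t at_top sequentially"
begin

lemma t_less [simp]: "t i < t j \<longleftrightarrow> i < j"
  by (simp add: strict_mono_less mono)

lemma t_le [simp]: "t i \<le> t j \<longleftrightarrow> i \<le> j"
  by (simp add: strict_mono_less_eq mono)

lemma t_eq [simp]: "t i = t j \<longleftrightarrow> i = j"
  by (simp add: strict_mono_eq mono)

lemma t_nonneg: "0 \<le> t k"
  using t_le[of 0 k] by (simp add: t0)

lemma t_pos: "0 < t k \<longleftrightarrow> 0 < k"
  using t_less[of 0 k] by (simp add: t0)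

lemma ex_beyond: "\<exists>n. w < t n"
proof -
  have "eventually (\<lambda>n. w < t n) sequentially"
    using lim by (simp add: filterlim_at_top_dense)
  then show ?thesis by (auto simp: eventually_sequentially)
qed

lemma ex_pos:
  assumes "0 \<le> w"
  obtains k where "t k \<le> w" "w < t (Suc k)"
proof -
  define n where "n = (LEAST n. w < t n)"
  have n: "w < t n" unfolding n_def using ex_beyond by (rule LeastI_ex)
  then have "n \<noteq> 0" using assms t0 by (cases n) auto
  then have "\<not> w < t (n - 1)" unfolding n_def by (intro not_less_Least) (simp add: n_def)
  then show ?thesis using that[of "n - 1"] n \<open>n \<noteq> 0\<close> by simp
qed

lemma finite_le: "finite {k. t k \<le> w}"
proof -
  obtain n where "w < t n" using ex_beyond by blast
  have "k < n" if "t k \<le> w" for k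
  proof -
    have "t k < t n" using \<open>w < t n\<close> that by linarith
    then show ?thesis by simp
  qed
  then have "{k. t k \<le> w} \<subseteq> {..<n}" by blast
  then show ?thesis using finite_lessThan finite_subset by blast
qed

lemma locfin_range: "locfin (range t)"
  unfolding locfin_def
proof
  fix w
  have "range t \<inter> {0<..w} \<subseteq> t ` {k. t k \<le> w}" by auto
  then show "finite (range t \<inter> {0<..w})" using finite_le finite_imageI finite_subset by blast
qed

section \<open>Truth functions sampled at the positions of a timeline\<close>

definition tracks :: "(nat \<Rightarrow> bool) \<Rightarrow> (real \<Rightarrow> bool) \<Rightarrow> bool" where
  "tracks P f \<longleftrightarrow> (\<forall>k w. t k \<le> w \<longrightarrow> w < t (Suc k) \<longrightarrow> f w = P k)"

lemma tracksD: "tracks P f \<Longrightarrow> t k \<le> w \<Longrightarrow> w < t (Suc k) \<Longrightarrow> f w = P k"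
  by (auto simp: tracks_def)

lemma tracks_at: "tracks P f \<Longrightarrow> f (t k) = P k"
  by (rule tracksD) auto

lemma tracks_adapted:
  assumes "tracks P f"
  shows "adapted (range t) f"
  unfolding adapted_def
proof (intro allI impI)
  fix u v assume uv: "0 \<le> u" "u \<le> v" "range t \<inter> {u<..v} = {}"
  obtain k where k: "t k \<le> u" "u < t (Suc k)" using ex_pos uv(1) by blast
  have "v < t (Suc k)" using k uv(3) by (meson disjoint_iff greaterThanAtMost_iff not_le rangeI)
  then show "f u = f v" using tracksD[OF assms, of k] k uv(2) by auto
qed

lemma tracks_if_adapted:
  assumes "adapted D f" "\<And>x. x \<in> D \<Longrightarrow> 0 < x \<Longrightarrow> x \<in> range t"
  shows "tracks (\<lambda>k. f (t k)) f"
  unfolding tracks_def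
proof (intro allI impI)
  fix k w assume kw: "t k \<le> w" "w < t (Suc k)"
  have "x \<notin> D" if "t k < x" "x \<le> w" for x
  proof
    assume "x \<in> D"
    moreover have "0 < x" using that t_nonneg[of k] by linarith
    ultimately obtain i where "x = t i" using assms(2) by blast
    then have "t k < t i" "t i < t (Suc k)" using that kw by linarith+
    then show False by simp
  qed
  then have "D \<inter> {t k<..w} = {}" by auto
  then show "f w = f (t k)" using adaptedD[OF assms(1) t_nonneg kw(1)] by simp
qed

lemma tracks_edges:
  assumes "tracks P f" "0 < T"
  shows "up_edge f T \<longleftrightarrow> (\<exists>k>0. t k = T \<and> up P k)" (is ?up)
    and "dn_edge f T \<longleftrightarrow> (\<exists>k>0. t k = T \<and> dn P k)" (is ?dn)
proof -
  obtain k where k: "t k \<le> T" "T < t (Suc k)" using ex_pos[of T] assms(2) by auto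
  have "?up \<and> ?dn"
  proof (cases "t k = T")
    case True
    have "0 < k" using True assms(2) t_pos by auto
    have c: "f x = f (t (k - 1))" if "t (k - 1) \<le> x" "x < T" for x
      using tracksD[OF assms(1), of "k - 1" x] tracks_at[OF assms(1), of "k - 1"] that True \<open>0 < k\<close> by simp
    have *: "up_edge f T \<longleftrightarrow> P k \<and> \<not> P (k-1)" "dn_edge f T \<longleftrightarrow> \<not> P k \<and> P (k-1)"
      using edge_iff[of "t (k - 1)" T f] c t_nonneg tracks_at[OF assms(1)] \<open>0 < k\<close> True t_less[of "k-1" k]
      by auto
    have **: "t i = T \<longleftrightarrow> i = k" for i using True t_eq by metis
    show ?thesis unfolding * ** using \<open>0 < k\<close> by (auto simp: up_def dn_def)
  next
    case False
    have c: "f x = f (t k)" if "t k \<le> x" "x < T" for x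
      using tracksD[OF assms(1), of k x] tracks_at[OF assms(1), of k] that k by simp
    have "f T = f (t k)" using tracksD[OF assms(1), of k T] tracks_at[OF assms(1), of k] k by simp
    moreover have "t k < T" using k False by simp
    ultimately have "\<not> up_edge f T" "\<not> dn_edge f T"
      using edge_iff[of "t k" T f, OF t_nonneg _ c] by blast+
    moreover have "t i \<noteq> T" for i
    proof
      assume "t i = T"
      then have "t k < t i" "t i < t (Suc k)" using k False by linarith+
      then show False by simp
    qed
    ultimately show ?thesis by auto
  qed
  then show ?up ?dn by auto
qed

text \<open>These describe the rising and falling edges of \<open>\<psi>\<close> that produce an edge of \<open>F\<close> over
  \<open>[a, b]\<close>, where \<open>g = b - a\<close>. A fall at position \<open>0\<close> counts as an edge, a rise there does not.\<close>

definition GU :: "real \<Rightarrow> (nat \<Rightarrow> bool) \<Rightarrow> nat \<Rightarrow> bool" where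
  "GU g P q \<longleftrightarrow> up P q \<and> (\<exists>p<q. t p < t q - g \<and> (\<forall>n. p \<le> n \<and> n < q \<longrightarrow> \<not> P n))"

definition GD :: "real \<Rightarrow> (nat \<Rightarrow> bool) \<Rightarrow> nat \<Rightarrow> bool" where
  "GD g P q \<longleftrightarrow> dn P q \<and> (\<forall>s>q. t s \<le> t q + g \<longrightarrow> \<not> P s)"

text \<open>The windows of the times just before \<open>T\<close> contain no true point while
  \<open>[T + a, T + b]\<close> does, so that point is the right end \<open>T + b\<close>, where
  \<open>f\<close> rises. Those windows start before \<open>T + a\<close>, hence the preceding false
  stretch is strictly longer than \<open>b - a\<close>.\<close>

lemma up_edge_FB:
  assumes tr: "tracks P f" and "0 < T" "0 \<le> a" "a < b"
  shows "up_edge (FB a b f) T \<longleftrightarrow> (\<exists>q. t q = T + b \<and> GU (b - a) P q)"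
proof
  assume "\<exists>q. t q = T + b \<and> GU (b - a) P q"
  then obtain q p where q: "t q = T + b" "up P q" "p < q" "t p < t q - (b - a)"
    and P: "\<And>n. p \<le> n \<Longrightarrow> n < q \<Longrightarrow> \<not> P n" by (auto simp: GU_def)
  have "f (T + b)" using tracks_at[OF tr, of q] q by (simp add: up_def)
  then have "FB a b f T" using assms by (auto simp: FB_def intro!: exI[of _ "T + b"])
  moreover have "\<not> FB a b f w" if w: "max 0 (t p - a) \<le> w" "w < T" for w
  proof
    assume "FB a b f w"
    then obtain x where x: "w + a \<le> x" "x \<le> w + b" "f x" by (auto simp: FB_def)
    have "t p \<le> x" "x < t q" "0 \<le> x" using x w q assms by auto
    obtain n where n: "t n \<le> x" "x < t (Suc n)" using ex_pos \<open>0 \<le> x\<close> by blast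
    have "t p < t (Suc n)" "t n < t q" using n \<open>t p \<le> x\<close> \<open>x < t q\<close> by linarith+
    then have "p \<le> n" "n < q" by (simp_all add: less_Suc_eq_le)
    then show False using P tracksD[OF tr n] x by simp
  qed
  moreover have "max 0 (t p - a) < T" using q assms by auto
  ultimately show "up_edge (FB a b f) T" unfolding up_edge_def
    using max.cobounded1[of 0 "t p - a"] by blast
next
  assume "up_edge (FB a b f) T"
  then obtain u where T: "FB a b f T" and u: "0 \<le> u" "u < T" "\<And>w. u \<le> w \<Longrightarrow> w < T \<Longrightarrow> \<not> FB a b f w"
    by (auto simp: up_edge_def)
  \<comment> \<open>The windows of the times in \<open>[u, T)\<close> together cover
    \<open>[u + a, T + b)\<close>.\<close>
  have F: "\<not> f x" if "u + a \<le> x" "x < T + b" for x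
  proof -
    have "\<not> FB a b f (max u (x - b))" using u(2) that by (intro u(3)) auto
    then show ?thesis unfolding FB_def using that assms by (auto dest!: spec[of _ x])
  qed
  obtain y where y: "T + a \<le> y" "y \<le> T + b" "f y" using T by (auto simp: FB_def)
  then have "f (T + b)" using F[of y] u by (cases "y = T + b") auto
  have "0 \<le> T + b" using assms by simp
  then obtain q where q: "t q \<le> T + b" "T + b < t (Suc q)" using ex_pos by blast
  have "P q" using tracksD[OF tr q] \<open>f (T + b)\<close> by simp
  have tq: "t q = T + b"
  proof (rule ccontr)
    assume "t q \<noteq> T + b"
    then have "max (t q) (u + a) < T + b" using q u assms by auto
    then have "\<not> f (max (t q) (u + a))" by (intro F) auto
    moreover have "f (max (t q) (u + a)) = P q"
      using q \<open>max (t q) (u + a) < T + b\<close> by (intro tracksD[OF tr]) auto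
    ultimately show False using \<open>P q\<close> by simp
  qed
  have "0 \<le> u + a" using u assms by simp
  then obtain p where p: "t p \<le> u + a" "u + a < t (Suc p)" using ex_pos by blast
  have "t p < t q - (b - a)" using p tq u by auto
  then have "t p < t q" using assms by linarith
  then have "p < q" by simp
  have nP: "\<not> P n" if "p \<le> n" "n < q" for n
  proof -
    have "t (Suc p) \<le> t (Suc n)" "t n < t (Suc n)" "t n < t q" using that by simp_all
    then have "\<not> f (max (t n) (u + a))" using tq u assms by (intro F) auto
    moreover have "f (max (t n) (u + a)) = P n"
    proof (rule tracksD[OF tr])
      show "max (t n) (u + a) < t (Suc n)"
        unfolding max_less_iff_conj using p \<open>t (Suc p) \<le> t (Suc n)\<close> \<open>t n < t (Suc n)\<close> by linarith
    qed simp
    ultimately show ?thesis by simp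
  qed
  have "up P q" using \<open>P q\<close> nP[of "q - 1"] \<open>p < q\<close> by (auto simp: up_def)
  then show "\<exists>q. t q = T + b \<and> GU (b - a) P q"
    using tq \<open>p < q\<close> \<open>t p < t q - (b - a)\<close> nP unfolding GU_def by blast
qed

text \<open>The last true point leaves through the left end, so \<open>f\<close> falls at
  \<open>T + a\<close>. The window at \<open>T\<close> contains its right end, which is why
  \<open>GD\<close> demands falsity up to and including distance \<open>b - a\<close>, in contrast
  to the strict bound in \<open>GU\<close>.\<close>

lemma dn_edge_FB:
  assumes tr: "tracks P f" and "0 < T" "0 \<le> a" "a < b"
  shows "dn_edge (FB a b f) T \<longleftrightarrow> (\<exists>q. t q = T + a \<and> GD (b - a) P q)"
proof
  assume "\<exists>q. t q = T + a \<and> GD (b - a) P q"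
  then obtain q where q: "t q = T + a" "dn P q" and P: "\<And>s. q < s \<Longrightarrow> t s \<le> t q + (b - a) \<Longrightarrow> \<not> P s"
    by (auto simp: GD_def)
  have "0 < q" using q assms t_pos[of q] by simp
  have "P (q - 1)" "\<not> P q" using q \<open>0 < q\<close> by (auto simp: dn_def)
  have "\<not> f x" if x: "T + a \<le> x" "x \<le> T + b" for x
  proof -
    have "0 \<le> x" using x assms by simp
    then obtain n where n: "t n \<le> x" "x < t (Suc n)" using ex_pos by blast
    have "t q < t (Suc n)" using n x q by linarith
    then have "q \<le> n" by simp
    then have "\<not> P n" using P[of n] \<open>\<not> P q\<close> n x q by (cases "n = q") auto
    then show ?thesis using tracksD[OF tr n] by simp
  qed
  then have "\<not> FB a b f T" by (auto simp: FB_def)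
  moreover have "FB a b f w" if w: "max 0 (t (q - 1) - a) \<le> w" "w < T" for w
  proof -
    have "f (w + a) = P (q - 1)" using w q \<open>0 < q\<close> by (intro tracksD[OF tr]) auto
    then show ?thesis using \<open>P (q - 1)\<close> assms by (auto simp: FB_def intro!: exI[of _ "w + a"])
  qed
  moreover have "max 0 (t (q - 1) - a) < T" using q assms t_less[of "q - 1" q] \<open>0 < q\<close> by auto
  ultimately show "dn_edge (FB a b f) T" unfolding dn_edge_def
    using max.cobounded1[of 0 "t (q - 1) - a"] by blast
next
  assume "dn_edge (FB a b f) T"
  then obtain u where T: "\<not> FB a b f T" and u: "0 \<le> u" "u < T" "\<And>w. u \<le> w \<Longrightarrow> w < T \<Longrightarrow> FB a b f w"
    by (auto simp: dn_edge_def)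
  have F: "\<not> f x" if "T + a \<le> x" "x \<le> T + b" for x using T that by (auto simp: FB_def)
  \<comment> \<open>The window at such a \<open>w\<close> has a true point, which must lie to the
    left of \<open>T + a\<close> because the window at \<open>T\<close> has none.\<close>
  have before: "\<exists>x. w + a \<le> x \<and> x < T + a \<and> f x" if w: "u \<le> w" "w < T" for w
  proof -
    obtain x where x: "w + a \<le> x" "x \<le> w + b" "f x" using u(3)[OF w] by (auto simp: FB_def)
    then have "x < T + a" using F[of x] w by (meson add_mono_thms_linordered_field(1) less_imp_le not_le order_trans)
    then show ?thesis using x by blast
  qed
  have "0 \<le> T + a" using assms by simp
  then obtain q where q: "t q \<le> T + a" "T + a < t (Suc q)" using ex_pos by blast
  have "\<not> P q" using tracksD[OF tr q] F[of "T + a"] assms by simp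
  have tq: "t q = T + a"
  proof (rule ccontr)
    assume "t q \<noteq> T + a"
    then obtain x where "max u (t q - a) + a \<le> x" "x < T + a" "f x"
      using before[of "max u (t q - a)"] u q by auto
    moreover from this have "f x = P q" using q by (intro tracksD[OF tr]) auto
    ultimately show False using \<open>\<not> P q\<close> by simp
  qed
  have "0 < q" using tq assms t_pos[of q] by simp
  have "t (q - 1) < T + a" using \<open>0 < q\<close> tq t_less[of "q - 1" q] by simp
  then obtain x where x: "max u (t (q - 1) - a) + a \<le> x" "x < T + a" "f x"
    using before[of "max u (t (q - 1) - a)"] u by auto
  then have "f x = P (q - 1)" using tq \<open>0 < q\<close> by (intro tracksD[OF tr]) auto
  then have "dn P q" using x \<open>\<not> P q\<close> by (auto simp: dn_def)
  moreover have "\<not> P s" if "q < s" "t s \<le> t q + (b - a)" for s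
    using F[of "t s"] tracks_at[OF tr, of s] that tq t_less[of q s] by simp
  ultimately show "\<exists>q. t q = T + a \<and> GD (b - a) P q" using tq by (auto simp: GD_def)
qed

text \<open>The condition on \<open>k\<close> says that \<open>[t k, t (Suc k))\<close> meets
  \<open>[a, b]\<close>, which is what the origin clause tests through clock 0.\<close>

lemma FB_0:
  assumes tr: "tracks P f" and "0 \<le> a" "a \<le> b"
  shows "FB a b f 0 \<longleftrightarrow> (\<exists>k. P k \<and> t k \<le> b \<and> a < t (Suc k))"
proof
  assume "FB a b f 0"
  then obtain x where x: "a \<le> x" "x \<le> b" "f x" by (auto simp: FB_def)
  then have "0 \<le> x" using assms by simp
  then obtain k where k: "t k \<le> x" "x < t (Suc k)" using ex_pos by blast
  then show "\<exists>k. P k \<and> t k \<le> b \<and> a < t (Suc k)" using tracksD[OF tr k] x by (intro exI[of _ k]) auto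
next
  assume "\<exists>k. P k \<and> t k \<le> b \<and> a < t (Suc k)"
  then obtain k where k: "P k" "t k \<le> b" "a < t (Suc k)" by blast
  have "f (max a (t k)) = P k" using k by (intro tracksD[OF tr]) auto
  then show "FB a b f 0" using k assms by (auto simp: FB_def intro!: exI[of _ "max a (t k)"])
qed

lemma FI_0:
  assumes tr: "tracks P f" and "0 \<le> a"
  shows "FI a f 0 \<longleftrightarrow> (\<exists>k. P k \<and> a < t (Suc k))"
proof
  assume "FI a f 0"
  then obtain x where x: "a \<le> x" "f x" by (auto simp: FI_def)
  then have "0 \<le> x" using assms by simp
  then obtain k where k: "t k \<le> x" "x < t (Suc k)" using ex_pos by blast
  then show "\<exists>k. P k \<and> a < t (Suc k)" using tracksD[OF tr k] x by (intro exI[of _ k]) auto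
next
  assume "\<exists>k. P k \<and> a < t (Suc k)"
  then obtain k where k: "P k" "a < t (Suc k)" by blast
  have "f (max a (t k)) = P k" using k by (intro tracksD[OF tr]) auto
  then show "FI a f 0" using k assms by (auto simp: FI_def intro!: exI[of _ "max a (t k)"])
qed

lemma no_up_edge_FI: "\<not> up_edge (FI a f) T"
proof
  assume "up_edge (FI a f) T"
  then obtain u where "FI a f T" "u < T" "\<not> FI a f u" by (auto simp: up_edge_def)
  then show False by (auto simp: FI_def)
qed

text \<open>With an unbounded window a false value stays false forever, so the only fall mirrors the
  final fall of \<open>P\<close>.\<close>

lemma dn_edge_FI:
  assumes tr: "tracks P f" and "0 < T" "0 \<le> a"
  shows "dn_edge (FI a f) T \<longleftrightarrow> (\<exists>q. t q = T + a \<and> dn P q \<and> (\<forall>s>q. \<not> P s))"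
proof
  assume "\<exists>q. t q = T + a \<and> dn P q \<and> (\<forall>s>q. \<not> P s)"
  then obtain q where q: "t q = T + a" "dn P q" and P: "\<And>s. q < s \<Longrightarrow> \<not> P s" by auto
  have "0 < q" using q assms t_pos[of q] by simp
  have "P (q - 1)" "\<not> P q" using q \<open>0 < q\<close> by (auto simp: dn_def)
  have "\<not> f x" if x: "T + a \<le> x" for x
  proof -
    have "0 \<le> x" using x assms by simp
    then obtain n where n: "t n \<le> x" "x < t (Suc n)" using ex_pos by blast
    have "t q < t (Suc n)" using n x q by linarith
    then have "q \<le> n" by simp
    then have "\<not> P n" using P[of n] \<open>\<not> P q\<close> by (cases "n = q") auto
    then show ?thesis using tracksD[OF tr n] by simp
  qed
  then have "\<not> FI a f T" by (auto simp: FI_def)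
  moreover have "FI a f w" if w: "max 0 (t (q - 1) - a) \<le> w" "w < T" for w
  proof -
    have "f (w + a) = P (q - 1)" using w q \<open>0 < q\<close> by (intro tracksD[OF tr]) auto
    then show ?thesis using \<open>P (q - 1)\<close> by (auto simp: FI_def intro!: exI[of _ "w + a"])
  qed
  moreover have "max 0 (t (q - 1) - a) < T" using q assms t_less[of "q - 1" q] \<open>0 < q\<close> by auto
  ultimately show "dn_edge (FI a f) T" unfolding dn_edge_def
    using max.cobounded1[of 0 "t (q - 1) - a"] by blast
next
  assume "dn_edge (FI a f) T"
  then obtain u where T: "\<not> FI a f T" and u: "0 \<le> u" "u < T" "\<And>w. u \<le> w \<Longrightarrow> w < T \<Longrightarrow> FI a f w"
    by (auto simp: dn_edge_def)
  have F: "\<not> f x" if "T + a \<le> x" for x using T that by (auto simp: FI_def)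
  have before: "\<exists>x. w + a \<le> x \<and> x < T + a \<and> f x" if w: "u \<le> w" "w < T" for w
  proof -
    obtain x where x: "w + a \<le> x" "f x" using u(3)[OF w] by (auto simp: FI_def)
    then have "x < T + a" using F[of x] w by (meson not_le)
    then show ?thesis using x by blast
  qed
  have "0 \<le> T + a" using assms by simp
  then obtain q where q: "t q \<le> T + a" "T + a < t (Suc q)" using ex_pos by blast
  have "\<not> P q" using tracksD[OF tr q] F[of "T + a"] assms by simp
  have tq: "t q = T + a"
  proof (rule ccontr)
    assume "t q \<noteq> T + a"
    then obtain x where "max u (t q - a) + a \<le> x" "x < T + a" "f x"
      using before[of "max u (t q - a)"] u q by auto
    moreover from this have "f x = P q" using q by (intro tracksD[OF tr]) auto
    ultimately show False using \<open>\<not> P q\<close> by simp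
  qed
  have "0 < q" using tq assms t_pos[of q] by simp
  have "t (q - 1) < T + a" using \<open>0 < q\<close> tq t_less[of "q - 1" q] by simp
  then obtain x where x: "max u (t (q - 1) - a) + a \<le> x" "x < T + a" "f x"
    using before[of "max u (t (q - 1) - a)"] u by auto
  then have "f x = P (q - 1)" using tq \<open>0 < q\<close> by (intro tracksD[OF tr]) auto
  then have "dn P q" using x \<open>\<not> P q\<close> by (auto simp: dn_def)
  moreover have "\<not> P s" if "q < s" for s
    using F[of "t s"] tracks_at[OF tr, of s] that tq t_less[of q s] by simp
  ultimately show "\<exists>q. t q = T + a \<and> dn P q \<and> (\<forall>s>q. \<not> P s)" using tq by auto
qed

section \<open>Clocks along a timeline, and the two event clocks of a subformula\<close>

definition clock :: "(nat \<Rightarrow> real) \<Rightarrow> bool" where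
  "clock c \<longleftrightarrow> (\<forall>k. 0 \<le> c k) \<and> (\<forall>k. c (Suc k) = c k + (t (Suc k) - t k) \<or> c (Suc k) = 0)"

lemma clock_nonneg: "clock c \<Longrightarrow> 0 \<le> c k"
  by (simp add: clock_def)

lemma clock_unreset:
  assumes "clock c" "k \<le> q" "\<And>n. k < n \<Longrightarrow> n \<le> q \<Longrightarrow> c n \<noteq> 0"
  shows "c q = c k + (t q - t k)"
  using assms(2,3)
proof (induction q rule: dec_induct)
  case (step n)
  have "c (Suc n) = c n + (t (Suc n) - t n)"
    using assms(1) step.prems[of "Suc n"] step.hyps by (auto simp: clock_def)
  then show ?case using step by auto
qed simp

lemma clock_le:
  assumes "clock c" "k \<le> q"
  shows "c q \<le> c k + (t q - t k)"
  using assms(2)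
proof (induction q rule: dec_induct)
  case (step n)
  have "c (Suc n) = c n + (t (Suc n) - t n) \<or> c (Suc n) = 0" using assms(1) by (auto simp: clock_def)
  moreover have "0 \<le> c k" "t k \<le> t (Suc n)" using assms step.hyps by (auto simp: clock_def)
  ultimately show ?case using step by auto
qed simp

text \<open>The initial value of a clock is unknown but nonnegative, so without a reset at a
  positive position the clock would read at least \<open>t q\<close>. This turns clock tests into
  statements about positions whatever the initial values are.\<close>

lemma clock_last_reset:
  assumes "clock c" "c q < t q"
  obtains k where "0 < k" "k \<le> q" "c k = 0" "t q - t k = c q" "\<And>n. k < n \<Longrightarrow> n \<le> q \<Longrightarrow> c n \<noteq> 0"
proof -
  define R where "R = {k. 0 < k \<and> k \<le> q \<and> c k = 0}"
  have "R \<noteq> {}"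
  proof
    assume "R = {}"
    then have "c q = c 0 + (t q - t 0)" by (intro clock_unreset[OF assms(1)]) (auto simp: R_def)
    then show False using assms clock_nonneg[OF assms(1), of 0] t0 by simp
  qed
  have "finite R" by (simp add: R_def)
  define k where "k = Max R"
  have k: "k \<in> R" "\<And>n. n \<in> R \<Longrightarrow> n \<le> k" using \<open>R \<noteq> {}\<close> \<open>finite R\<close> by (auto simp: k_def)
  have nz: "c n \<noteq> 0" if "k < n" "n \<le> q" for n
    using k(2)[of n] that by (auto simp: R_def)
  have "c q = c k + (t q - t k)" using k nz by (intro clock_unreset[OF assms(1)]) (auto simp: R_def)
  then show ?thesis using k(1) nz that[of k] by (auto simp: R_def)
qed

definition evts :: "(nat \<Rightarrow> bool) \<Rightarrow> (nat \<Rightarrow> nat \<Rightarrow> real) \<Rightarrow> bool" where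
  "evts Q z \<longleftrightarrow> clock (z 0) \<and> clock (z 1) \<and> z 0 0 = 0 \<and>
     (\<forall>k. (up Q k \<or> dn Q k) \<longleftrightarrow> (z 0 k = 0 \<or> z 1 k = 0)) \<and>
     (\<forall>i<2. \<forall>k. z i k = 0 \<longrightarrow> (\<forall>j>k. z i j \<noteq> 0 \<or> (\<exists>n. k < n \<and> n < j \<and> z (1 - i) n = 0)))"

text \<open>Alternation forbids a clock reset at the previous event from being reset again at
  \<open>q\<close>, so it shows the time since that event, and the other clock is the one reset at
  \<open>q\<close>. A previous event exists because position 0 is one.\<close>

lemma evts_prev:
  assumes "evts P z" "up P q \<or> dn P q" "0 < q"
  obtains p i where "p < q" "i < 2" "up P p \<or> dn P p"
    "\<And>n. p < n \<Longrightarrow> n < q \<Longrightarrow> \<not> (up P n \<or> dn P n)" "z i q = t q - t p" "z (1 - i) q = 0"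
proof -
  define R where "R = {k. k < q \<and> (up P k \<or> dn P k)}"
  have "0 \<in> R" using assms(3) by (auto simp: R_def event_iff)
  have "finite R" by (simp add: R_def)
  define p where "p = Max R"
  have p: "p \<in> R" "\<And>n. n \<in> R \<Longrightarrow> n \<le> p" using \<open>0 \<in> R\<close> \<open>finite R\<close> by (auto simp: p_def intro: Max_in)
  have none: "\<not> (up P n \<or> dn P n)" if "p < n" "n < q" for n
    using p(2)[of n] that by (auto simp: R_def)
  have E: "\<And>k. (up P k \<or> dn P k) \<longleftrightarrow> (z 0 k = 0 \<or> z 1 k = 0)"
    and A: "\<And>i k j. i < 2 \<Longrightarrow> z i k = 0 \<Longrightarrow> k < j \<Longrightarrow> z i j = 0 \<Longrightarrow> \<exists>n. k < n \<and> n < j \<and> z (1 - i) n = 0"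
    using assms(1) unfolding evts_def by blast+
  have "up P p \<or> dn P p" using p by (auto simp: R_def)
  then have "z 0 p = 0 \<or> z 1 p = 0" using E by blast
  then obtain i :: nat where i: "i < 2" "z i p = 0"
    by (metis one_less_numeral_iff pos2 semiring_norm(76))
  have i2: "i = 0 \<or> i = 1" using i by auto
  have zi: "clock (z i)" using assms(1) i2 by (auto simp: evts_def)
  have nz: "z 0 n \<noteq> 0 \<and> z 1 n \<noteq> 0" if "p < n" "n < q" for n using none[OF that] E by blast
  have "p < q" using p by (simp add: R_def)
  have "z i q \<noteq> 0" using A[OF i(1,2) \<open>p < q\<close>] nz i2 by fastforce
  have "z i q = z i p + (t q - t p)"
  proof (rule clock_unreset[OF zi])
    fix n assume "p < n" "n \<le> q"
    then show "z i n \<noteq> 0" using nz[of n] \<open>z i q \<noteq> 0\<close> i2 by (cases "n = q") auto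
  qed (use \<open>p < q\<close> in simp)
  moreover have "z (1 - i) q = 0" using E[of q] assms(2) \<open>z i q \<noteq> 0\<close> i2 by auto
  ultimately show ?thesis using that[OF \<open>p < q\<close> i(1)] none \<open>up P p \<or> dn P p\<close> i(2) by simp
qed

text \<open>At a rise after position 0 the previous event is where the current false stretch began,
  and the larger of the two clocks measures the distance to it. At position 0 this would fail, since
  \<open>z 1 0\<close> is arbitrary.\<close>

lemma evts_GU:
  assumes "evts P z" "0 < q" "0 \<le> g"
  shows "up P q \<and> (g < z 0 q \<or> g < z 1 q) \<longleftrightarrow> GU g P q"
proof (cases "up P q")
  case True
  obtain p i where p: "p < q" "i < 2" "up P p \<or> dn P p"
    "\<And>n. p < n \<Longrightarrow> n < q \<Longrightarrow> \<not> (up P n \<or> dn P n)" "z i q = t q - t p" "z (1 - i) q = 0"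
    using evts_prev[OF assms(1) _ assms(2)] True by metis
  have "i = 0 \<or> i = 1" using p(2) by auto
  then have L: "(g < z 0 q \<or> g < z 1 q) \<longleftrightarrow> t p < t q - g" using p(5,6) assms(3) by auto
  have c: "P n = P p" if "p \<le> n" "n < q" for n
    using const_without_events[of p n P] that p(4) by auto
  have "\<not> P (q - 1)" using True assms(2) by (auto simp: up_def)
  then have nP: "\<not> P n" if "p \<le> n" "n < q" for n using c[OF that] c[of "q - 1"] p(1) by auto
  show ?thesis
  proof
    assume "up P q \<and> (g < z 0 q \<or> g < z 1 q)"
    then show "GU g P q" using L nP p(1) True by (auto simp: GU_def)
  next
    assume "GU g P q"
    then obtain p' where p': "p' < q" "t p' < t q - g" "\<And>n. p' \<le> n \<Longrightarrow> n < q \<Longrightarrow> \<not> P n"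
      by (auto simp: GU_def)
    \<comment> \<open>A false stretch that ends at \<open>q\<close> cannot reach back beyond
      \<open>p\<close>: either \<open>p\<close> is 0 or \<open>P\<close> changes there.\<close>
    have "p \<le> p'"
    proof (rule ccontr)
      assume "\<not> p \<le> p'"
      then have "P p \<noteq> P (p - 1)" using p(3) by (auto simp: event_iff)
      moreover have "p' \<le> p" "p' \<le> p - 1" "p - 1 < q" using \<open>\<not> p \<le> p'\<close> p(1) by linarith+
      ultimately show False using p'(3)[of p] p'(3)[of "p - 1"] p(1) by blast
    qed
    then have "t p \<le> t p'" by simp
    then have "t p < t q - g" using p'(2) by linarith
    then show "up P q \<and> (g < z 0 q \<or> g < z 1 q)" using True L by blast
  qed
qed (auto simp: GU_def)

text \<open>Only the first rise \<open>s\<close> after \<open>q\<close> matters, and the false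
  stretch before it begins exactly at the fall \<open>q\<close>. So the clocks at \<open>s\<close>
  measure the gap from \<open>q\<close>, and a first rise beyond distance \<open>g\<close> means
  that \<open>P\<close> stays false within it.\<close>

lemma evts_GD:
  assumes "evts P z" "0 \<le> g"
  shows "dn P q \<and> (\<forall>s\<ge>q. \<not> (up P s \<and> z 0 s \<le> g \<and> z 1 s \<le> g) \<or> (\<exists>n. q \<le> n \<and> n < s \<and> up P n))
    \<longleftrightarrow> GD g P q"
proof (cases "dn P q")
  case True
  then have "\<not> P q" by (simp add: dn_def)
  have gap: "\<not> (z 0 s \<le> g \<and> z 1 s \<le> g) \<longleftrightarrow> t q + g < t s"
    if s: "q < s" "up P s" "\<forall>n. q \<le> n \<and> n < s \<longrightarrow> \<not> P n" for s
  proof -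
    have "(\<exists>p<s. t p < t s - g \<and> (\<forall>n. p \<le> n \<and> n < s \<longrightarrow> \<not> P n)) \<longleftrightarrow> t q < t s - g"
    proof
      assume "\<exists>p<s. t p < t s - g \<and> (\<forall>n. p \<le> n \<and> n < s \<longrightarrow> \<not> P n)"
      then obtain p where p: "p < s" "t p < t s - g" "\<And>n. p \<le> n \<Longrightarrow> n < s \<Longrightarrow> \<not> P n" by blast
      have "q \<le> p"
      proof (rule ccontr)
        assume "\<not> q \<le> p"
        then have "P (q - 1)" using True by (auto simp: dn_def)
        moreover have "p \<le> q - 1" "q - 1 < s" using \<open>\<not> q \<le> p\<close> s(1) by linarith+
        ultimately show False using p(3)[of "q - 1"] by blast
      qed
      then have "t q \<le> t p" by simp
      then show "t q < t s - g" using p(2) by linarith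
    qed (use s in auto)
    moreover have "\<not> (z 0 s \<le> g \<and> z 1 s \<le> g) \<longleftrightarrow> GU g P s"
      using evts_GU[OF assms(1) _ assms(2), of s] s by auto
    ultimately show ?thesis using s(2) by (auto simp: GU_def)
  qed
  show ?thesis unfolding release_first_up[of P q "\<lambda>s. z 0 s \<le> g \<and> z 1 s \<le> g", OF \<open>\<not> P q\<close>]
  proof
    assume L: "dn P q \<and> (\<forall>s>q. up P s \<longrightarrow> (\<forall>n. q \<le> n \<and> n < s \<longrightarrow> \<not> P n) \<longrightarrow> \<not> (z 0 s \<le> g \<and> z 1 s \<le> g))"
    have "\<not> P s" if "q < s" "t s \<le> t q + g" for s
    proof
      assume "P s"
      obtain s' where "q < s'" "s' \<le> s" "up P s'" "\<And>n. q \<le> n \<Longrightarrow> n < s' \<Longrightarrow> \<not> P n"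
        using first_up[OF \<open>\<not> P q\<close> \<open>q < s\<close> \<open>P s\<close>] by blast
      then have "t q + g < t s'" using L gap[of s'] by blast
      moreover have "t s' \<le> t s" using \<open>s' \<le> s\<close> by simp
      ultimately show False using that by linarith
    qed
    then show "GD g P q" using True by (auto simp: GD_def)
  next
    assume "GD g P q"
    then have R: "\<And>s. q < s \<Longrightarrow> t s \<le> t q + g \<Longrightarrow> \<not> P s" by (auto simp: GD_def)
    show "dn P q \<and> (\<forall>s>q. up P s \<longrightarrow> (\<forall>n. q \<le> n \<and> n < s \<longrightarrow> \<not> P n) \<longrightarrow> \<not> (z 0 s \<le> g \<and> z 1 s \<le> g))"
    proof (intro conjI allI impI True)
      fix s assume s: "q < s" "up P s" "\<forall>n. q \<le> n \<and> n < s \<longrightarrow> \<not> P n"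
      then have "t q + g < t s" using R[of s] by (force simp: up_def)
      then show "\<not> (z 0 s \<le> g \<and> z 1 s \<le> g)" using gap[OF s] by blast
    qed
  qed
qed (auto simp: GD_def)

end

section \<open>The clauses for the operators F\<close>

lemma ex_less_2: "(\<exists>j<2::nat. A j) \<longleftrightarrow> A 0 \<or> A 1"
  by (auto simp: less_2_cases_iff)

lemma no_up_iff: "\<not> P q \<Longrightarrow> (\<forall>s\<ge>q. \<not> up P s) \<longleftrightarrow> (\<forall>s>q. \<not> P s)"
  by (metis first_up le_eq_less_or_eq less_imp_le up_def)

context timeline
begin

text \<open>Here \<open>P\<close> and \<open>Q\<close> are the truth values of \<open>\<psi>\<close> and of \<open>\<theta>\<close> by position, \<open>x\<close> are the clocks
  \<open>X \<theta>\<close>, \<open>y\<close> the clocks \<open>Z \<theta>\<close>, and \<open>z\<close> the clocks \<open>Z \<psi>\<close> (in \<open>mFI\<close> the clocks \<open>Z \<theta>\<close>).\<close>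

definition mFB :: "real \<Rightarrow> real \<Rightarrow> nat \<Rightarrow> (nat \<Rightarrow> bool) \<Rightarrow> (nat \<Rightarrow> bool) \<Rightarrow>
    (nat \<Rightarrow> nat \<Rightarrow> real) \<Rightarrow> (nat \<Rightarrow> nat \<Rightarrow> real) \<Rightarrow> nat \<Rightarrow> bool" where
  "mFB a b d P Q z x k \<longleftrightarrow>
    (up Q k \<longleftrightarrow> 0 < k \<and> (\<exists>j<d. x j k = 0 \<and>
         (\<exists>q>k. (up P q \<and> x j q = b \<and> (b - a < z 0 q \<or> b - a < z 1 q)) \<and>
                (\<forall>n. k < n \<and> n < q \<longrightarrow> 0 < x j n))) \<or>
       k = 0 \<and> (\<exists>q. (P q \<and> (a \<le> x 0 q \<and> x 0 q \<le> b \<or> x 0 q < a \<and> a < x 0 (Suc q))) \<and>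
         (\<forall>n<q. n = 0 \<or> 0 < x 0 n))) \<and>
    (up P k \<and> (b - a < z 0 k \<or> b - a < z 1 k) \<longrightarrow> (\<exists>j<d. x j k = b)) \<and>
    (dn Q k \<longleftrightarrow> (\<exists>j<d. x j k = 0 \<and>
         (\<exists>q>k. (dn P q \<and> x j q = a \<and>
                  (\<forall>s\<ge>q. \<not> (up P s \<and> x j s \<le> b) \<or> (\<exists>n. q \<le> n \<and> n < s \<and> up P n))) \<and>
                (\<forall>n. k < n \<and> n < q \<longrightarrow> 0 < x j n))) \<or>
       k = 0 \<and> \<not> up Q k) \<and>
    (dn P k \<and> (\<forall>s\<ge>k. \<not> (up P s \<and> z 0 s \<le> b - a \<and> z 1 s \<le> b - a) \<or>
         (\<exists>n. k \<le> n \<and> n < s \<and> up P n)) \<longrightarrow> (\<exists>j<d. x j k = a))"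

definition mF0 :: "real \<Rightarrow> (nat \<Rightarrow> bool) \<Rightarrow> (nat \<Rightarrow> bool) \<Rightarrow>
    (nat \<Rightarrow> nat \<Rightarrow> real) \<Rightarrow> (nat \<Rightarrow> nat \<Rightarrow> real) \<Rightarrow> nat \<Rightarrow> bool" where
  "mF0 b P Q z y k \<longleftrightarrow>
    (up Q k \<longleftrightarrow> 0 < k \<and> \<not> P k \<and> (\<exists>j<2. y j k = 0 \<and>
         (\<exists>q>k. (up P q \<and> y j q = b \<and> (b < z 0 q \<or> b < z 1 q)) \<and>
                (\<forall>n. k < n \<and> n < q \<longrightarrow> 0 < y j n))) \<or>
       k = 0 \<and> (\<exists>q. (P q \<and> y 0 q \<le> b) \<and> (\<forall>n<q. n = 0 \<or> 0 < y 0 n))) \<and>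
    (up P k \<and> (b < z 0 k \<or> b < z 1 k) \<longrightarrow> (\<exists>j<2. y j k = b)) \<and>
    (dn Q k \<longleftrightarrow> dn P k \<and> (\<forall>s\<ge>k. \<not> (up P s \<and> z 0 s \<le> b \<and> z 1 s \<le> b) \<or>
         (\<exists>n. k \<le> n \<and> n < s \<and> up P n)))"

definition mFI :: "real \<Rightarrow> (nat \<Rightarrow> bool) \<Rightarrow> (nat \<Rightarrow> bool) \<Rightarrow> (nat \<Rightarrow> nat \<Rightarrow> real) \<Rightarrow> nat \<Rightarrow> bool" where
  "mFI a P Q z k \<longleftrightarrow>
    (up Q k \<longleftrightarrow> k = 0 \<and> (\<exists>q. (P q \<and> (a \<le> z 0 q \<or> z 0 q < a \<and> a < z 0 (Suc q))) \<and>
         (\<forall>n<q. n = 0 \<or> 0 < z 0 n))) \<and>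
    (dn Q k \<longleftrightarrow> z 1 k = 0 \<and>
         (\<exists>q>k. (dn P q \<and> z 1 q = a \<and> (\<forall>s\<ge>q. \<not> up P s)) \<and> (\<forall>n. k < n \<and> n < q \<longrightarrow> 0 < z 1 n)) \<or>
       k = 0 \<and> \<not> up Q k) \<and>
    (dn P k \<and> (\<forall>s\<ge>k. \<not> up P s) \<longrightarrow> z 1 k = a)"

section \<open>Soundness of the clauses: the edges of \<open>Q\<close> are those of the
  semantics\<close>

lemma pos_unique:
  assumes "t k \<le> w" "w < t (Suc k)" "t i \<le> w" "w < t (Suc i)"
  shows "i = k"
proof -
  have "t i < t (Suc k)" "t k < t (Suc i)" using assms by linarith+
  then show ?thesis by simp
qed

lemma tracks_step: "tracks Q (\<lambda>w. \<exists>k. t k \<le> w \<and> w < t (Suc k) \<and> Q k)"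
  unfolding tracks_def using pos_unique by blast

text \<open>\<open>h\<close> is compared with the step function of \<open>Q\<close>. The premise of
  \<open>init\<close> is what makes the origin clause usable: without events after position 0, clock
  0 of the formula is never reset and shows absolute time.\<close>

lemma tracks_if_same_edges:
  assumes D: "locfin D" "adapted D h"
    and up: "\<And>T. 0 < T \<Longrightarrow> up_edge h T \<longleftrightarrow> (\<exists>k>0. t k = T \<and> up Q k)"
    and dn: "\<And>T. 0 < T \<Longrightarrow> dn_edge h T \<longleftrightarrow> (\<exists>k>0. t k = T \<and> dn Q k)"
    and init: "(\<And>k. 0 < k \<Longrightarrow> \<not> (up Q k \<or> dn Q k)) \<Longrightarrow> h 0 = Q 0"
  shows "tracks Q h"
proof -
  define G where "G w = (\<exists>k. t k \<le> w \<and> w < t (Suc k) \<and> Q k)" for w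
  have G: "tracks Q G" using tracks_step unfolding G_def .
  have "h w = G w" if "0 \<le> w" for w
  proof (rule agree_if_same_edges[OF _ _ _ _ _ _ that])
    show "locfin (D \<union> range t)" using D locfin_range locfin_Un by blast
    show "adapted (D \<union> range t) h" "adapted (D \<union> range t) G"
      using D tracks_adapted[OF G] adapted_mono by blast+
    show "up_edge h T \<longleftrightarrow> up_edge G T" "dn_edge h T \<longleftrightarrow> dn_edge G T" if "0 < T" for T
      using that up dn tracks_edges[OF G] by auto
    show "h 0 = G 0" if no: "\<And>T. 0 < T \<Longrightarrow> \<not> up_edge G T \<and> \<not> dn_edge G T"
    proof -
      have "\<not> (up Q k \<or> dn Q k)" if "0 < k" for k
        using no[of "t k"] tracks_edges[OF G] that t_pos[of k] by blast
      then show ?thesis using init tracks_at[OF G, of 0] t0 by simp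
    qed
  qed
  then show ?thesis using G t_nonneg unfolding tracks_def by (metis order_trans)
qed

lemma edge_at:
  assumes "tracks Q h" "0 < k"
  shows "up Q k \<longleftrightarrow> up_edge h (t k)" "dn Q k \<longleftrightarrow> dn_edge h (t k)"
  using tracks_edges[OF assms(1), of "t k"] assms(2) t_pos[of k] by auto

lemma clock_delay:
  assumes "clock c" "c k = 0" "k < q" "\<forall>n. k < n \<and> n < q \<longrightarrow> 0 < c n" "0 < c q"
  shows "t q = t k + c q"
proof -
  have "c q = c k + (t q - t k)"
    using assms by (intro clock_unreset) (auto simp: order_le_less)
  then show ?thesis using assms by simp
qed

lemma evts_alternate:
  assumes "evts Q z" "i < 2" "z i k = 0" "k < j" "z i j = 0"
  shows "\<exists>n. k < n \<and> n < j \<and> z (1 - i) n = 0"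
  using assms unfolding evts_def by blast

text \<open>The test against \<open>b\<close> happens at a rise \<open>s'\<close> that may come long
  after \<open>q\<close>, and the clock may have been reset meanwhile. A reset only lowers its
  value, so a value above \<open>b\<close> still proves that more than \<open>b\<close> has passed
  since \<open>k\<close>.\<close>

lemma delayed_GD:
  assumes c: "clock c" "c k = 0" "k < q" "\<forall>n. k < n \<and> n < q \<longrightarrow> 0 < c n"
    and q: "dn P q" "c q = a" "0 < a"
    and R: "\<forall>s\<ge>q. \<not> (up P s \<and> c s \<le> b) \<or> (\<exists>n. q \<le> n \<and> n < s \<and> up P n)"
  shows "t q = t k + a \<and> GD (b - a) P q"
proof -
  have tq: "t q = t k + a" using clock_delay[OF c] q by simp
  have "\<not> P q" using q by (simp add: dn_def)
  have "\<not> P s" if "q < s" "t s \<le> t q + (b - a)" for s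
  proof
    assume "P s"
    obtain s' where s': "q < s'" "s' \<le> s" "up P s'" "\<And>n. q \<le> n \<Longrightarrow> n < s' \<Longrightarrow> \<not> P n"
      using first_up[OF \<open>\<not> P q\<close> \<open>q < s\<close> \<open>P s\<close>] by blast
    moreover have "\<not> (\<exists>n. q \<le> n \<and> n < s' \<and> up P n)" using s'(4) by (auto simp: up_def)
    ultimately have "\<not> c s' \<le> b" using R less_imp_le by blast
    moreover have "c s' \<le> c k + (t s' - t k)"
      using s' c by (intro clock_le) auto
    moreover have "t s' \<le> t s" using s' by simp
    ultimately show False using that tq c(2) by linarith
  qed
  then show ?thesis using tq q by (auto simp: GD_def)
qed

text \<open>From a semantic edge to an event: the implications of the clause that end in a clock
  test provide a clock reading \<open>b\<close> or \<open>a\<close>, and its last reset is an event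
  of \<open>Q\<close> at the right time. From an event to a semantic edge: the clock named in the
  equivalence times the distance. Rises are settled first, since a reset does not tell a rise from a
  fall.\<close>

lemma sound_FB:
  assumes tr: "tracks P f" and ab: "0 < a" "a < b" and "0 < d"
    and x: "\<And>j. j < d \<Longrightarrow> clock (x j)" "x 0 0 = 0"
    and ev: "evts P z"
    and E: "\<And>k. (up Q k \<or> dn Q k) \<longleftrightarrow> (\<exists>j<d. x j k = 0)"
    and m: "\<And>k. mFB a b d P Q z x k"
  shows "tracks Q (FB a b f)"
proof -
  have m1: "up Q k \<longleftrightarrow> (\<exists>j<d. x j k = 0 \<and>
         (\<exists>q>k. (up P q \<and> x j q = b \<and> (b - a < z 0 q \<or> b - a < z 1 q)) \<and>
                (\<forall>n. k < n \<and> n < q \<longrightarrow> 0 < x j n)))" if "0 < k" for k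
    using m[of k] that unfolding mFB_def by blast
  have m1': "up Q 0 \<longleftrightarrow> (\<exists>q. (P q \<and> (a \<le> x 0 q \<and> x 0 q \<le> b \<or> x 0 q < a \<and> a < x 0 (Suc q))) \<and>
         (\<forall>n<q. n = 0 \<or> 0 < x 0 n))"
    using m[of 0] unfolding mFB_def by blast
  have m2: "\<exists>j<d. x j k = b" if "up P k \<and> (b - a < z 0 k \<or> b - a < z 1 k)" for k
    using m[of k] that unfolding mFB_def by blast
  have m3: "\<exists>j<d. x j k = 0 \<and>
         (\<exists>q>k. (dn P q \<and> x j q = a \<and>
                  (\<forall>s\<ge>q. \<not> (up P s \<and> x j s \<le> b) \<or> (\<exists>n. q \<le> n \<and> n < s \<and> up P n))) \<and>
                (\<forall>n. k < n \<and> n < q \<longrightarrow> 0 < x j n))" if "dn Q k" "0 < k" for k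
    using m[of k] that unfolding mFB_def by blast
  have m4: "\<exists>j<d. x j k = a" if "GD (b - a) P k" for k
  proof -
    have "dn P k \<and> (\<forall>s\<ge>k. \<not> (up P s \<and> z 0 s \<le> b - a \<and> z 1 s \<le> b - a) \<or>
         (\<exists>n. k \<le> n \<and> n < s \<and> up P n))"
      using that evts_GD[OF ev, of "b - a" k] ab by simp
    then show ?thesis using m[of k] unfolding mFB_def by blast
  qed
  note GU = evts_GU[OF ev, of _ "b - a"]
  have up_iff: "up_edge (FB a b f) T \<longleftrightarrow> (\<exists>k>0. t k = T \<and> up Q k)" if "0 < T" for T
  proof -
    have "(\<exists>q. t q = T + b \<and> GU (b - a) P q) \<longleftrightarrow> (\<exists>k>0. t k = T \<and> up Q k)"
    proof
      assume "\<exists>q. t q = T + b \<and> GU (b - a) P q"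
      then obtain q where q: "t q = T + b" "GU (b - a) P q" by blast
      have "0 < q" using q that ab t_pos[of q] by simp
      then have *: "up P q \<and> (b - a < z 0 q \<or> b - a < z 1 q)" using GU q ab by simp
      then obtain j where j: "j < d" "x j q = b" using m2 by blast
      have "x j q < t q" using j q that by simp
      then obtain k where k: "0 < k" "k \<le> q" "x j k = 0" "t q - t k = x j q"
        "\<And>n. k < n \<Longrightarrow> n \<le> q \<Longrightarrow> x j n \<noteq> 0"
        using clock_last_reset[OF x(1)[OF j(1)]] by blast
      have "0 < x j n" if "k < n" "n < q" for n
        using k(5)[of n] that clock_nonneg[OF x(1)[OF j(1)], of n] by simp
      moreover have "k < q" using k(4) j(2) ab by (cases "k = q") (use k(2) in auto)
      ultimately have "up Q k" unfolding m1[OF k(1)] using j * k(3) by blast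
      moreover have "t k = T" using k(4) q j by simp
      ultimately show "\<exists>k>0. t k = T \<and> up Q k" using k(1) by blast
    next
      assume "\<exists>k>0. t k = T \<and> up Q k"
      then obtain k where k: "0 < k" "t k = T" "up Q k" by blast
      from k(3) obtain j q where j: "j < d" "x j k = 0" "k < q" "up P q" "x j q = b"
        "b - a < z 0 q \<or> b - a < z 1 q" "\<forall>n. k < n \<and> n < q \<longrightarrow> 0 < x j n"
        unfolding m1[OF k(1)] by blast
      have "t q = T + b" using clock_delay[OF x(1)[OF j(1)] j(2,3,7)] j k ab by simp
      moreover have "GU (b - a) P q" using GU[of q] j ab by simp
      ultimately show "\<exists>q. t q = T + b \<and> GU (b - a) P q" by blast
    qed
    then show ?thesis using up_edge_FB[OF tr that, of a b] ab by simp
  qed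
  show ?thesis
  proof (rule tracks_if_same_edges[OF _ adapted_FB[OF tracks_adapted[OF tr]] up_iff])
    show "locfin ((\<lambda>d. d - a) ` range t \<union> (\<lambda>d. d - b) ` range t)"
      using ab by (intro locfin_Un locfin_shift locfin_range) auto
  next
    fix T :: real assume T: "0 < T"
    have "(\<exists>q. t q = T + a \<and> GD (b - a) P q) \<longleftrightarrow> (\<exists>k>0. t k = T \<and> dn Q k)"
    proof
      assume D: "\<exists>q. t q = T + a \<and> GD (b - a) P q"
      then obtain q where q: "t q = T + a" "GD (b - a) P q" by blast
      obtain j where j: "j < d" "x j q = a" using m4[OF q(2)] by blast
      have "x j q < t q" using j q T by simp
      then obtain k where k: "0 < k" "k \<le> q" "x j k = 0" "t q - t k = x j q"
        using clock_last_reset[OF x(1)[OF j(1)]] by blast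
      then have "t k = T" using q j by simp
      \<comment> \<open>The reset only shows that \<open>Q\<close> has some event at time
        \<open>T\<close>. Rises of \<open>Q\<close> are already known to be exactly those of
        \<open>FB a b f\<close>, which falls here, so the event is a fall.\<close>
      have "dn_edge (FB a b f) T" using D dn_edge_FB[OF tr T, of a b] ab by simp
      then have "\<not> up_edge (FB a b f) T" by (auto simp: up_edge_def dn_edge_def)
      then have "\<not> up Q k" using up_iff[OF T] k(1) \<open>t k = T\<close> by blast
      moreover have "up Q k \<or> dn Q k" using E j(1) k(3) by blast
      ultimately show "\<exists>k>0. t k = T \<and> dn Q k" using k(1) \<open>t k = T\<close> by blast
    next
      assume "\<exists>k>0. t k = T \<and> dn Q k"
      then obtain k where k: "0 < k" "t k = T" "dn Q k" by blast
      from m3[OF k(3,1)] obtain j q where j: "j < d" "x j k = 0" "k < q" "dn P q" "x j q = a"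
        "\<forall>s\<ge>q. \<not> (up P s \<and> x j s \<le> b) \<or> (\<exists>n. q \<le> n \<and> n < s \<and> up P n)"
        "\<forall>n. k < n \<and> n < q \<longrightarrow> 0 < x j n"
        by blast
      show "\<exists>q. t q = T + a \<and> GD (b - a) P q"
        using delayed_GD[OF x(1)[OF j(1)] j(2,3,7,4,5) ab(1) j(6)] k(2) by blast
    qed
    then show "dn_edge (FB a b f) T \<longleftrightarrow> (\<exists>k>0. t k = T \<and> dn Q k)"
      using dn_edge_FB[OF tr T, of a b] ab by simp
  next
    assume no: "\<And>k. 0 < k \<Longrightarrow> \<not> (up Q k \<or> dn Q k)"
    \<comment> \<open>Clock 0 starts at 0 and a reset would be an event, so it shows absolute time
      and the origin clause becomes the condition of \<open>FB_0\<close>.\<close>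
    have nz: "x 0 n \<noteq> 0" if "0 < n" for n using no[OF that] E \<open>0 < d\<close> by blast
    have "x 0 q = x 0 0 + (t q - t 0)" for q
      using nz by (intro clock_unreset x \<open>0 < d\<close>) auto
    then have xt: "x 0 q = t q" for q using x(2) t0 by simp
    have "Q 0 \<longleftrightarrow> up Q 0" by (simp add: up_def)
    also have "\<dots> \<longleftrightarrow> (\<exists>q. P q \<and> (a \<le> t q \<and> t q \<le> b \<or> t q < a \<and> a < t (Suc q)))"
      unfolding m1' xt using t_pos by auto
    also have "\<dots> \<longleftrightarrow> (\<exists>k. P k \<and> t k \<le> b \<and> a < t (Suc k))"
    proof -
      have "(a \<le> t q \<and> t q \<le> b \<or> t q < a \<and> a < t (Suc q)) \<longleftrightarrow> t q \<le> b \<and> a < t (Suc q)" for q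
        using t_less[of q "Suc q"] ab by (auto simp del: t_less)
      then show ?thesis by simp
    qed
    finally show "FB a b f 0 = Q 0" using FB_0[OF tr, of a b] ab by simp
  qed (use ab in auto)
qed

text \<open>With \<open>a = 0\<close> a fall of \<open>Q\<close> coincides with a fall of
  \<open>P\<close>, so its clause involves no clock of \<open>Q\<close> and applies at position 0
  too, where it decides \<open>Q 0\<close>. Only rises need the timing argument through a clock that
  reads \<open>b\<close>.\<close>

lemma sound_F0:
  assumes tr: "tracks P f" and b: "0 < b"
    and ev: "evts P z" "evts Q y" and m: "\<And>k. mF0 b P Q z y k"
  shows "tracks Q (FB 0 b f)"
proof -
  have y: "clock (y j)" if "j < 2" for j using ev(2) that by (auto simp: evts_def less_2_cases_iff)
  have m1: "up Q k \<longleftrightarrow> \<not> P k \<and> (\<exists>j<2. y j k = 0 \<and>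
         (\<exists>q>k. (up P q \<and> y j q = b \<and> (b < z 0 q \<or> b < z 1 q)) \<and>
                (\<forall>n. k < n \<and> n < q \<longrightarrow> 0 < y j n)))" if "0 < k" for k
    using m[of k] that unfolding mF0_def by blast
  have m2: "\<exists>j<2. y j k = b" if "up P k \<and> (b < z 0 k \<or> b < z 1 k)" for k
    using m[of k] that unfolding mF0_def by blast
  have m3: "dn Q k \<longleftrightarrow> GD b P k" for k
    using m[of k] evts_GD[OF ev(1), of b k] b unfolding mF0_def by simp
  note GU = evts_GU[OF ev(1), of _ b]
  show ?thesis
  proof (rule tracks_if_same_edges[OF _ adapted_FB[OF tracks_adapted[OF tr]]])
    show "locfin ((\<lambda>d. d - 0) ` range t \<union> (\<lambda>d. d - b) ` range t)"
      using b by (intro locfin_Un locfin_shift locfin_range) auto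
  next
    fix T :: real assume T: "0 < T"
    have "(\<exists>q. t q = T + b \<and> GU b P q) \<longleftrightarrow> (\<exists>k>0. t k = T \<and> up Q k)"
    proof
      assume "\<exists>q. t q = T + b \<and> GU b P q"
      then obtain q where q: "t q = T + b" "GU b P q" by blast
      have "0 < q" using q T b t_pos[of q] by simp
      then have *: "up P q \<and> (b < z 0 q \<or> b < z 1 q)" using GU q b by simp
      then obtain j where j: "j < 2" "y j q = b" using m2 by blast
      have "y j q < t q" using j q T by simp
      then obtain k where k: "0 < k" "k \<le> q" "y j k = 0" "t q - t k = y j q"
        "\<And>n. k < n \<Longrightarrow> n \<le> q \<Longrightarrow> y j n \<noteq> 0"
        using clock_last_reset[OF y[OF j(1)]] by blast
      have "0 < y j n" if "k < n" "n < q" for n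
        using k(5)[of n] that clock_nonneg[OF y[OF j(1)], of n] by simp
      moreover have "k < q" using k(4) j(2) b by (cases "k = q") (use k(2) in auto)
      \<comment> \<open>The extra conjunct of the rise clause holds because
        \<open>t k = t q - b\<close> lies inside the false stretch before \<open>q\<close>.\<close>
      moreover have "\<not> P k"
      proof -
        obtain p where p: "t p < t q - b" "\<And>n. p \<le> n \<Longrightarrow> n < q \<Longrightarrow> \<not> P n"
          using q(2) unfolding GU_def by blast
        then have "t p < t k" using k(4) j by linarith
        then show ?thesis using p(2)[of k] \<open>k < q\<close> by simp
      qed
      ultimately have "up Q k" unfolding m1[OF k(1)] using j * k(3) by blast
      moreover have "t k = T" using k(4) q j by simp
      ultimately show "\<exists>k>0. t k = T \<and> up Q k" using k(1) by blast
    next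
      assume "\<exists>k>0. t k = T \<and> up Q k"
      then obtain k where k: "0 < k" "t k = T" "up Q k" by blast
      from k(3) obtain j q where j: "j < 2" "y j k = 0" "k < q" "up P q" "y j q = b"
        "b < z 0 q \<or> b < z 1 q" "\<forall>n. k < n \<and> n < q \<longrightarrow> 0 < y j n"
        unfolding m1[OF k(1)] by blast
      have "t q = T + b" using clock_delay[OF y[OF j(1)] j(2,3,7)] j k b by simp
      moreover have "GU b P q" using GU[of q] j b by simp
      ultimately show "\<exists>q. t q = T + b \<and> GU b P q" by blast
    qed
    then show "up_edge (FB 0 b f) T \<longleftrightarrow> (\<exists>k>0. t k = T \<and> up Q k)"
      using up_edge_FB[OF tr T, of 0 b] b by simp
    show "dn_edge (FB 0 b f) T \<longleftrightarrow> (\<exists>k>0. t k = T \<and> dn Q k)"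
      unfolding dn_edge_FB[OF tr T order.refl b] m3 using T t_pos by auto
  next
    have "Q 0 \<longleftrightarrow> \<not> GD b P 0" unfolding m3[symmetric] by (simp add: dn_def)
    also have "\<dots> \<longleftrightarrow> (\<exists>k. P k \<and> t k \<le> b \<and> 0 < t (Suc k))"
    proof -
      have "(\<exists>k. P k \<and> t k \<le> b) \<longleftrightarrow> P 0 \<or> (\<exists>k>0. P k \<and> t k \<le> b)"
        using b t0 by (metis gr0I less_imp_le)
      then show ?thesis using t0 by (auto simp: GD_def dn_def t_pos)
    qed
    finally show "FB 0 b f 0 = Q 0" using FB_0[OF tr, of 0 b] b by simp
  qed (use b in auto)
qed

text \<open>This operator never rises, so every event of \<open>Q\<close> after position 0 is a
  fall. The last conjunct of the clause puts a reset of \<open>z 1\<close> at distance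
  \<open>a\<close> before the final fall of \<open>P\<close>.\<close>

lemma sound_FI:
  assumes tr: "tracks P f" and a: "0 < a"
    and ev: "evts Q z" and m: "\<And>k. mFI a P Q z k"
  shows "tracks Q (FI a f)"
proof -
  have z: "clock (z 0)" "clock (z 1)" "z 0 0 = 0"
    and E: "\<And>k. (up Q k \<or> dn Q k) \<longleftrightarrow> (z 0 k = 0 \<or> z 1 k = 0)"
    using ev unfolding evts_def by blast+
  have m1: "\<not> up Q k" if "0 < k" for k
    using m[of k] that unfolding mFI_def by blast
  have m1': "up Q 0 \<longleftrightarrow> (\<exists>q. (P q \<and> (a \<le> z 0 q \<or> z 0 q < a \<and> a < z 0 (Suc q))) \<and>
         (\<forall>n<q. n = 0 \<or> 0 < z 0 n))"
    using m[of 0] unfolding mFI_def by blast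
  have m2: "\<exists>q>k. (dn P q \<and> z 1 q = a \<and> (\<forall>s\<ge>q. \<not> up P s)) \<and> (\<forall>n. k < n \<and> n < q \<longrightarrow> 0 < z 1 n)"
    "z 1 k = 0" if "dn Q k" "0 < k" for k
    using m[of k] that unfolding mFI_def by blast+
  have m3: "z 1 k = a" if "dn P k" "\<forall>s\<ge>k. \<not> up P s" for k
    using m[of k] that unfolding mFI_def by blast
  show ?thesis
  proof (rule tracks_if_same_edges[OF _ adapted_FI[OF tracks_adapted[OF tr]]])
    show "locfin ((\<lambda>d. d - a) ` range t)"
      using a by (intro locfin_shift locfin_range) auto
  next
    fix T :: real assume T: "0 < T"
    show "up_edge (FI a f) T \<longleftrightarrow> (\<exists>k>0. t k = T \<and> up Q k)"
      using no_up_edge_FI m1 by blast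
    have "(\<exists>q. t q = T + a \<and> dn P q \<and> (\<forall>s>q. \<not> P s)) \<longleftrightarrow> (\<exists>k>0. t k = T \<and> dn Q k)"
    proof
      assume "\<exists>q. t q = T + a \<and> dn P q \<and> (\<forall>s>q. \<not> P s)"
      then obtain q where q: "t q = T + a" "dn P q" "\<forall>s>q. \<not> P s" by blast
      have "\<not> P q" using q by (simp add: dn_def)
      then have "z 1 q = a" using m3[OF q(2)] no_up_iff q(3) by blast
      moreover have "z 1 q < t q" using q T calculation by simp
      then obtain k where k: "0 < k" "k \<le> q" "z 1 k = 0" "t q - t k = z 1 q"
        using clock_last_reset[OF z(2)] by blast
      ultimately have "t k = T" using q by simp
      then show "\<exists>k>0. t k = T \<and> dn Q k" using k E m1 by blast
    next
      assume "\<exists>k>0. t k = T \<and> dn Q k"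
      then obtain k where k: "0 < k" "t k = T" "dn Q k" by blast
      from m2[OF k(3,1)] obtain q where q: "z 1 k = 0" "k < q" "dn P q" "z 1 q = a"
        "\<forall>s\<ge>q. \<not> up P s" "\<forall>n. k < n \<and> n < q \<longrightarrow> 0 < z 1 n"
        by blast
      have "t q = T + a" using clock_delay[OF z(2) q(1,2,6)] q k a by simp
      moreover have "\<forall>s>q. \<not> P s" using no_up_iff q(3,5) by (auto simp: dn_def)
      ultimately show "\<exists>q. t q = T + a \<and> dn P q \<and> (\<forall>s>q. \<not> P s)" using q by blast
    qed
    then show "dn_edge (FI a f) T \<longleftrightarrow> (\<exists>k>0. t k = T \<and> dn Q k)"
      using dn_edge_FI[OF tr T] a by simp
  next
    assume no: "\<And>k. 0 < k \<Longrightarrow> \<not> (up Q k \<or> dn Q k)"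
    have nz: "z 0 n \<noteq> 0" if "0 < n" for n using no[OF that] E by blast
    have "z 0 q = z 0 0 + (t q - t 0)" for q
      using nz by (intro clock_unreset z) auto
    then have zt: "z 0 q = t q" for q using z t0 by simp
    have "Q 0 \<longleftrightarrow> up Q 0" by (simp add: up_def)
    also have "\<dots> \<longleftrightarrow> (\<exists>q. P q \<and> (a \<le> t q \<or> t q < a \<and> a < t (Suc q)))"
      unfolding m1' zt using t_pos by auto
    also have "\<dots> \<longleftrightarrow> (\<exists>k. P k \<and> a < t (Suc k))"
    proof -
      have "(a \<le> t q \<or> t q < a \<and> a < t (Suc q)) \<longleftrightarrow> a < t (Suc q)" for q
        using t_less[of q "Suc q"] by (auto simp del: t_less)
      then show ?thesis by simp
    qed
    finally show "FI a f 0 = Q 0" using FI_0[OF tr, of a] a by simp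
  qed (use a in auto)
qed

text \<open>Two clocks suffice because \<open>Q\<close> stays true, hence has no event, from its
  rise at \<open>t k\<close> to the rise of \<open>P\<close> at \<open>t k + b\<close>; the clock
  reset at the former runs undisturbed. \<open>init\<close> prevents a rise of \<open>P\<close> at
  position 0 from passing for the end of a long gap.\<close>

lemma complete_F0:
  assumes trP: "tracks P f" and trQ: "tracks Q (FB 0 b f)" and b: "0 < b"
    and ev: "evts P z" "evts Q y" and init: "up P 0 \<Longrightarrow> z 0 0 \<le> b \<and> z 1 0 \<le> b"
  shows "mF0 b P Q z y k"
proof -
  have y: "clock (y j)" if "j < 2" for j using ev(2) that by (auto simp: evts_def less_2_cases_iff)
  have y0: "y 0 0 = 0" using ev(2) by (simp add: evts_def)
  have E: "(up Q k \<or> dn Q k) \<longleftrightarrow> (\<exists>j<2. y j k = 0)" for k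
    using ev(2) unfolding evts_def ex_less_2 by blast
  note GU = evts_GU[OF ev(1), of _ b]
  have U: "up Q k \<longleftrightarrow> (\<exists>q. t q = t k + b \<and> GU b P q)" if "0 < k" for k
    unfolding edge_at[OF trQ that] using up_edge_FB[OF trP, of "t k" 0 b] that b t_pos by simp
  have D: "dn Q k \<longleftrightarrow> GD b P k" if "0 < k" for k
    unfolding edge_at[OF trQ that] using dn_edge_FB[OF trP, of "t k" 0 b] that b t_pos by simp
  have Q: "Q n" if "t n \<le> t q" "t q \<le> t n + b" "P q" for n q
    using tracks_at[OF trQ, of n] tracks_at[OF trP, of q] that by (auto simp: FB_def)
  have pos: "y j n = t n - t k" if "\<And>n. k \<le> n \<Longrightarrow> n \<le> q \<Longrightarrow> Q n" "j < 2" "y j k = 0" "k \<le> n" "n \<le> q"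
    for j k n q
  proof -
    have "y j n = y j k + (t n - t k)"
    proof (rule clock_unreset[OF y[OF that(2)] that(4)])
      fix i assume i: "k < i" "i \<le> n"
      then have "Q i" "Q (i - 1)" using that(1)[of i] that(1)[of "i - 1"] that(5) by auto
      then have "\<not> (up Q i \<or> dn Q i)" using i unfolding event_iff by auto
      then show "y j i \<noteq> 0" using E[of i] that(2) by blast
    qed
    then show ?thesis using that by simp
  qed
  have gap: "\<not> P k" if G: "GU b P q" "t q = t k + b" for q k
  proof -
    obtain p where p: "t p < t q - b" "\<And>n. p \<le> n \<Longrightarrow> n < q \<Longrightarrow> \<not> P n"
      using G(1) unfolding GU_def by blast
    then have "t p < t k" "t k < t q" using G(2) b by linarith+
    then show ?thesis using p(2)[of k] by simp
  qed
  have timer: "\<exists>j<2. y j k = 0 \<and> (\<forall>n. k \<le> n \<and> n \<le> q \<longrightarrow> y j n = t n - t k)"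
    if "0 < k" "t q = t k + b" "GU b P q" for k q
  proof -
    have "P q" using that by (simp add: GU_def up_def)
    have Qs: "Q n" if "k \<le> n" "n \<le> q" for n
    proof (rule Q[OF _ _ \<open>P q\<close>])
      have "t k \<le> t n" using that by simp
      then show "t q \<le> t n + b" using \<open>t q = t k + b\<close> by linarith
    qed (use that in simp)
    have "up Q k" using U that by blast
    then obtain j where "j < 2" "y j k = 0" using E by blast
    then show ?thesis using pos[of k q j] Qs by blast
  qed
  have Q0: "Q 0 \<longleftrightarrow> (\<exists>k. P k \<and> t k \<le> b)"
    using FB_0[OF trP, of 0 b] tracks_at[OF trQ, of 0] b t0 t_pos by simp
  have 1: "up Q k \<longleftrightarrow> \<not> P k \<and> (\<exists>j<2. y j k = 0 \<and>
         (\<exists>q>k. (up P q \<and> y j q = b \<and> (b < z 0 q \<or> b < z 1 q)) \<and>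
                (\<forall>n. k < n \<and> n < q \<longrightarrow> 0 < y j n)))" if "0 < k"
  proof
    assume "up Q k"
    then obtain q where q: "t q = t k + b" "GU b P q" using U[OF \<open>0 < k\<close>] by blast
    obtain j where j: "j < 2" "y j k = 0" "\<And>n. k \<le> n \<Longrightarrow> n \<le> q \<Longrightarrow> y j n = t n - t k"
      using timer[OF \<open>0 < k\<close> q] by blast
    have "t k < t q" using q b by simp
    then have "k < q" by simp
    have "up P q \<and> (b < z 0 q \<or> b < z 1 q)" using GU[of q] q(2) \<open>k < q\<close> b by simp
    moreover have "y j q = b" using j(3)[of q] q \<open>k < q\<close> by simp
    moreover have "\<forall>n. k < n \<and> n < q \<longrightarrow> 0 < y j n" using j(3) by simp
    ultimately show "\<not> P k \<and> (\<exists>j<2. y j k = 0 \<and>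
         (\<exists>q>k. (up P q \<and> y j q = b \<and> (b < z 0 q \<or> b < z 1 q)) \<and>
                (\<forall>n. k < n \<and> n < q \<longrightarrow> 0 < y j n)))"
      using gap[OF q(2,1)] j(1,2) \<open>k < q\<close> by blast
  next
    assume "\<not> P k \<and> (\<exists>j<2. y j k = 0 \<and>
         (\<exists>q>k. (up P q \<and> y j q = b \<and> (b < z 0 q \<or> b < z 1 q)) \<and>
                (\<forall>n. k < n \<and> n < q \<longrightarrow> 0 < y j n)))"
    then obtain j q where j: "j < 2" "y j k = 0" "k < q" "up P q" "y j q = b"
        "b < z 0 q \<or> b < z 1 q" "\<forall>n. k < n \<and> n < q \<longrightarrow> 0 < y j n"
      by blast
    have "t q = t k + b" using clock_delay[OF y[OF j(1)] j(2,3,7)] j b by simp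
    moreover have "GU b P q" using GU[of q] j b by simp
    ultimately show "up Q k" using U[OF that] by blast
  qed
  have 2: "up Q 0 \<longleftrightarrow> (\<exists>q. (P q \<and> y 0 q \<le> b) \<and> (\<forall>n<q. n = 0 \<or> 0 < y 0 n))"
  proof
    assume "up Q 0"
    then obtain k' where "P k'" "t k' \<le> b" using Q0 by (auto simp: up_def)
    then have Qs: "Q n" if "n \<le> k'" for n
      using Q[of n k'] that t_nonneg[of n] by simp
    have "y 0 n = t n" if "n \<le> k'" for n
      using pos[of 0 k' 0 n] Qs y0 t0 that by simp
    then show "\<exists>q. (P q \<and> y 0 q \<le> b) \<and> (\<forall>n<q. n = 0 \<or> 0 < y 0 n)"
      using \<open>P k'\<close> \<open>t k' \<le> b\<close> t_pos by (intro exI[of _ k']) auto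
  next
    assume "\<exists>q. (P q \<and> y 0 q \<le> b) \<and> (\<forall>n<q. n = 0 \<or> 0 < y 0 n)"
    then obtain q where q: "P q" "y 0 q \<le> b" "\<forall>n<q. n = 0 \<or> 0 < y 0 n" by blast
    \<comment> \<open>A reset at \<open>q\<close> would be an event of \<open>Q\<close>, but after
      position 0 both a rise and a fall of \<open>Q\<close> require \<open>P\<close> to be false
      there.\<close>
    have "y 0 q \<noteq> 0" if "0 < q"
    proof
      assume "y 0 q = 0"
      then have "up Q q \<or> dn Q q" using E[of q] pos2 by blast
      moreover have "\<not> up Q q" using U[OF that] gap q(1) by blast
      moreover have "\<not> dn Q q" using D[OF that] q(1) by (auto simp: GD_def dn_def)
      ultimately show False by blast
    qed
    then have "y 0 q = y 0 0 + (t q - t 0)"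
      using q(3) by (intro clock_unreset y) (auto simp: order_le_less)
    then have "t q \<le> b" using q y0 t0 by simp
    then show "up Q 0" using Q0 q by (auto simp: up_def)
  qed
  have 3: "\<exists>j<2. y j k = b" if "up P k \<and> (b < z 0 k \<or> b < z 1 k)"
  proof -
    have "0 < k" using that init by (cases k) auto
    then have G: "GU b P k" using GU that b by simp
    then obtain p where "t p < t k - b" by (auto simp: GU_def)
    then have T: "0 < t k - b" using t_nonneg[of p] by linarith
    have "up_edge (FB 0 b f) (t k - b)" using up_edge_FB[OF trP T, of 0 b] G b by auto
    then obtain k' where k': "0 < k'" "t k' = t k - b" using tracks_edges[OF trQ T] by blast
    obtain j where j: "j < 2" "\<And>n. k' \<le> n \<Longrightarrow> n \<le> k \<Longrightarrow> y j n = t n - t k'"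
      using timer[OF k'(1) _ G] k'(2) by auto
    have "t k' \<le> t k" using k' b by linarith
    then have "k' \<le> k" by simp
    then have "y j k = b" using j(2)[of k] k' by simp
    then show ?thesis using j(1) by blast
  qed
  have 4: "dn Q k \<longleftrightarrow> GD b P k"
  proof (cases "k = 0")
    case True
    have "\<not> GD b P 0 \<longleftrightarrow> (\<exists>k. P k \<and> t k \<le> b)"
    proof -
      have "(\<exists>k. P k \<and> t k \<le> b) \<longleftrightarrow> P 0 \<or> (\<exists>k>0. P k \<and> t k \<le> b)"
        using b t0 by (metis gr0I less_imp_le)
      then show ?thesis using t0 by (auto simp: GD_def dn_def)
    qed
    then show ?thesis using Q0 True by (auto simp: dn_def)
  qed (use D in simp)
  show ?thesis unfolding mF0_def
  proof (intro conjI)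
    show "up Q k \<longleftrightarrow> 0 < k \<and> \<not> P k \<and> (\<exists>j<2. y j k = 0 \<and>
         (\<exists>q>k. (up P q \<and> y j q = b \<and> (b < z 0 q \<or> b < z 1 q)) \<and>
                (\<forall>n. k < n \<and> n < q \<longrightarrow> 0 < y j n))) \<or>
       k = 0 \<and> (\<exists>q. (P q \<and> y 0 q \<le> b) \<and> (\<forall>n<q. n = 0 \<or> 0 < y 0 n))"
    proof (cases "k = 0")
      case True
      show ?thesis unfolding True using 2 by blast
    next
      case False
      then show ?thesis using 1 by blast
    qed
    show "up P k \<and> (b < z 0 k \<or> b < z 1 k) \<longrightarrow> (\<exists>j<2. y j k = b)" using 3 by blast
    show "dn Q k \<longleftrightarrow> dn P k \<and> (\<forall>s\<ge>k. \<not> (up P s \<and> z 0 s \<le> b \<and> z 1 s \<le> b) \<or>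
         (\<exists>n. k \<le> n \<and> n < s \<and> up P n))"
      unfolding 4 using evts_GD[OF ev(1), of b k] b by simp
  qed
qed

lemma last_dn_unique:
  assumes "dn P q" "\<forall>s>q. \<not> P s" "dn P q'" "\<forall>s>q'. \<not> P s"
  shows "q' = q"
proof -
  have *: "q' \<le> q" if "dn P q'" "\<not> P q" "\<forall>s>q. \<not> P s" for q q'
  proof (rule ccontr)
    assume "\<not> q' \<le> q"
    then have "q \<le> q' - 1" "P (q' - 1)" using that by (auto simp: dn_def)
    then show False using that by (metis le_neq_implies_less)
  qed
  show ?thesis using *[of q' q] *[of q q'] assms by (auto simp: dn_def)
qed

text \<open>At most one event follows position 0. If the final fall of \<open>P\<close> comes no
  later than time \<open>a\<close>, its counterpart lies at a time \<le> 0, and \<open>z 1\<close>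
  must start at \<open>a - t q\<close> as if it had been reset then. The hypothesis
  \<open>zero\<close> ensures that a start value 0, which could trigger the timed disjunct of the
  fall clause at position 0, goes together with \<open>Q\<close> being false there.\<close>

lemma complete_FI:
  assumes trP: "tracks P f" and trQ: "tracks Q (FI a f)" and a: "0 < a"
    and ev: "evts Q z"
    and late: "\<And>q. dn P q \<Longrightarrow> \<forall>s>q. \<not> P s \<Longrightarrow> t q \<le> a \<Longrightarrow> z 1 0 = a - t q"
    and zero: "z 1 0 = 0 \<Longrightarrow> \<exists>q. t q = a \<and> dn P q \<and> (\<forall>s>q. \<not> P s)"
  shows "mFI a P Q z k"
proof -
  have z: "clock (z 0)" "clock (z 1)" "z 0 0 = 0"
    and E: "\<And>k. (up Q k \<or> dn Q k) \<longleftrightarrow> (z 0 k = 0 \<or> z 1 k = 0)"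
    using ev unfolding evts_def by blast+
  define L where "L q \<longleftrightarrow> dn P q \<and> (\<forall>s>q. \<not> P s)" for q
  have L_unique: "q' = q" if "L q" "L q'" for q q'
    using that last_dn_unique unfolding L_def by blast
  have L_iff: "L q \<longleftrightarrow> dn P q \<and> (\<forall>s\<ge>q. \<not> up P s)" for q
    unfolding L_def using no_up_iff[of P q] by (auto simp: dn_def)
  have nU: "\<not> up Q k" if "0 < k" for k
    unfolding edge_at[OF trQ that] by (rule no_up_edge_FI)
  have D: "dn Q k \<longleftrightarrow> (\<exists>q. t q = t k + a \<and> L q)" if "0 < k" for k
    unfolding edge_at[OF trQ that] L_def using dn_edge_FI[OF trP, of "t k" a] that a t_pos by simp
  have single: "k = n" if kn: "0 < k" "up Q k \<or> dn Q k" "0 < n" "up Q n \<or> dn Q n" for k n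
  proof -
    obtain q q' where "t q = t k + a" "L q" "t q' = t n + a" "L q'"
      using D[OF kn(1)] D[OF kn(3)] nU[OF kn(1)] nU[OF kn(3)] kn(2,4) by blast
    moreover from this have "q = q'" using L_unique by blast
    ultimately show ?thesis by simp
  qed
  \<comment> \<open>After its reset at 0, \<open>z 0\<close> may be reset again only after
    \<open>z 1\<close>. That would take two events after position 0, so the only such event goes to
    \<open>z 1\<close>.\<close>
  have z0: "z 0 k \<noteq> 0" if "0 < k" for k
  proof
    assume "z 0 k = 0"
    then obtain n where n: "0 < n" "n < k" "z 1 n = 0"
      using evts_alternate[OF ev _ z(3) \<open>0 < k\<close>] by auto
    then have "n = k" using single[of n k] E \<open>z 0 k = 0\<close> that by blast
    then show False using n by simp
  qed
  have zt: "z 0 k = t k" for k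
  proof -
    have "z 0 k = z 0 0 + (t k - t 0)" using z0 by (intro clock_unreset z) auto
    then show ?thesis using z t0 by simp
  qed
  have Q0: "Q 0 \<longleftrightarrow> (\<exists>k. P k \<and> a < t (Suc k))"
    using FI_0[OF trP, of a] tracks_at[OF trQ, of 0] a t0 by simp
  have after: "z 1 k = 0" "\<And>n. k \<le> n \<Longrightarrow> z 1 n = t n - t k" if k: "0 < k" "dn Q k" for k
  proof -
    show zk: "z 1 k = 0" using E[of k] z0[of k] k by blast
    fix n assume "k \<le> n"
    have "z 1 n = z 1 k + (t n - t k)"
    proof (rule clock_unreset[OF z(2) \<open>k \<le> n\<close>])
      fix i assume "k < i" "i \<le> n"
      then have "\<not> (up Q i \<or> dn Q i)" using single[of k i] k by auto
      then show "z 1 i \<noteq> 0" using E by blast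
    qed
    then show "z 1 n = t n - t k" using zk by simp
  qed
  have 1: "up Q 0 \<longleftrightarrow> (\<exists>q. (P q \<and> (a \<le> z 0 q \<or> z 0 q < a \<and> a < z 0 (Suc q))) \<and>
         (\<forall>n<q. n = 0 \<or> 0 < z 0 n))"
  proof -
    have "(a \<le> t q \<or> t q < a \<and> a < t (Suc q)) \<longleftrightarrow> a < t (Suc q)" for q
      using t_less[of q "Suc q"] by (auto simp del: t_less)
    then show ?thesis unfolding zt using Q0 t_pos by (auto simp: up_def)
  qed
  let ?B = "\<lambda>k. \<exists>q>k. (dn P q \<and> z 1 q = a \<and> (\<forall>s\<ge>q. \<not> up P s)) \<and> (\<forall>n. k < n \<and> n < q \<longrightarrow> 0 < z 1 n)"
  have 2: "dn Q k \<longleftrightarrow> z 1 k = 0 \<and> ?B k" if "0 < k"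
  proof
    assume dn: "dn Q k"
    then obtain q where q: "t q = t k + a" "L q" using D[OF \<open>0 < k\<close>] by blast
    have "t k < t q" using q a by simp
    then have "k < q" by simp
    moreover have "z 1 q = a" using after(2)[OF that dn, of q] q \<open>k < q\<close> by simp
    moreover have "\<forall>n. k < n \<and> n < q \<longrightarrow> 0 < z 1 n" using after(2)[OF that dn] by simp
    ultimately show "z 1 k = 0 \<and> ?B k"
      using after(1)[OF that dn] q(2) unfolding L_iff by blast
  next
    assume "z 1 k = 0 \<and> ?B k"
    then show "dn Q k" using E nU[OF that] by blast
  qed
  have 3: "\<not> up Q 0" if "z 1 0 = 0"
  proof -
    obtain q where q: "t q = a" "L q" using zero[OF \<open>z 1 0 = 0\<close>] by (auto simp: L_def)
    have "\<not> P k" if "a < t (Suc k)" for k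
    proof -
      have "t q < t (Suc k)" using that q by simp
      then have "q \<le> k" by simp
      then show ?thesis using q(2) by (cases "q = k") (auto simp: L_def dn_def)
    qed
    then show ?thesis using Q0 by (auto simp: up_def)
  qed
  have 4: "z 1 k = a" if "L k"
  proof (cases "t k \<le> a")
    case True
    have "z 1 k = z 1 0 + (t k - t 0)"
    proof (intro clock_unreset z)
      fix n :: nat assume n: "0 < n" "n \<le> k"
      show "z 1 n \<noteq> 0"
      proof
        assume "z 1 n = 0"
        then have "dn Q n" using E nU n by blast
        then obtain q where q: "t q = t n + a" "L q" using D n by blast
        then have "q = k" using L_unique that by blast
        then have "t n \<le> 0" using q True by simp
        then show False using t_pos[of n] n by simp
      qed
    qed simp
    then show ?thesis using late[of k] that True t0 by (simp add: L_def)
  next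
    case False
    then have T: "0 < t k - a" by simp
    have "dn_edge (FI a f) (t k - a)" using dn_edge_FI[OF trP T] a that by (auto simp: L_def)
    then obtain k' where k': "0 < k'" "t k' = t k - a" "dn Q k'" using tracks_edges[OF trQ T] by blast
    have "t k' \<le> t k" using k' a by linarith
    then have "k' \<le> k" by simp
    then show ?thesis using after(2)[OF k'(1,3), of k] k' by simp
  qed
  have dn0: "dn Q 0 \<longleftrightarrow> \<not> up Q 0" by (auto simp: dn_def up_def)
  show ?thesis unfolding mFI_def L_iff[symmetric]
  proof (cases "k = 0")
    case True
    have 4: "L 0 \<longrightarrow> z 1 0 = a" using 4 True by blast
    have "z 1 0 = 0 \<and> ?B 0 \<longrightarrow> \<not> up Q 0" using 3 by blast
    then show "(up Q k \<longleftrightarrow> k = 0 \<and> (\<exists>q. (P q \<and> (a \<le> z 0 q \<or> z 0 q < a \<and> a < z 0 (Suc q))) \<and>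
         (\<forall>n<q. n = 0 \<or> 0 < z 0 n))) \<and> (dn Q k \<longleftrightarrow> z 1 k = 0 \<and> ?B k \<or> k = 0 \<and> \<not> up Q k) \<and>
         (L k \<longrightarrow> z 1 k = a)"
      unfolding True using 1 4 dn0 by blast
  next
    case False
    then have "0 < k" by simp
    show "(up Q k \<longleftrightarrow> k = 0 \<and> (\<exists>q. (P q \<and> (a \<le> z 0 q \<or> z 0 q < a \<and> a < z 0 (Suc q))) \<and>
         (\<forall>n<q. n = 0 \<or> 0 < z 0 n))) \<and> (dn Q k \<longleftrightarrow> z 1 k = 0 \<and> ?B k \<or> k = 0 \<and> \<not> up Q k) \<and>
         (L k \<longrightarrow> z 1 k = a)"
      using nU[OF \<open>0 < k\<close>] 2[OF \<open>0 < k\<close>] 4 False by blast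
  qed
qed

end

section \<open>Cyclic clocks\<close>

text \<open>The index of the latest event, with position 0 as event number 0. Event number
  \<open>n\<close> is going to reset clock \<open>n mod d\<close>, so clock 0 is the one reset at
  the start.\<close>

primrec cnt :: "(nat \<Rightarrow> bool) \<Rightarrow> nat \<Rightarrow> nat" where
  "cnt Q 0 = 0"
| "cnt Q (Suc k) = cnt Q k + (if Q (Suc k) \<noteq> Q k then 1 else 0)"

lemma cnt_mono: "k \<le> q \<Longrightarrow> cnt Q k \<le> cnt Q q"
  by (induction q rule: dec_induct) auto

lemma cnt_less:
  assumes "k < q" "up Q q \<or> dn Q q"
  shows "cnt Q k < cnt Q q"
proof -
  obtain q' where q': "q = Suc q'" using assms(1) by (cases q) auto
  have "cnt Q k \<le> cnt Q q'" using assms(1) q' by (intro cnt_mono) simp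
  then show ?thesis using assms q' by (simp add: event_iff)
qed

lemma cnt_eq_card:
  "k \<le> q \<Longrightarrow> cnt Q q = cnt Q k + card {i. k < i \<and> i \<le> q \<and> (up Q i \<or> dn Q i)}"
proof (induction q rule: dec_induct)
  case (step n)
  have "{i. k < i \<and> i \<le> Suc n \<and> (up Q i \<or> dn Q i)} =
     (if Q (Suc n) \<noteq> Q n then insert (Suc n) else id) {i. k < i \<and> i \<le> n \<and> (up Q i \<or> dn Q i)}"
    using step.hyps unfolding event_iff by (auto simp: le_Suc_eq)
  then show ?case using step by simp
qed simp

lemma cnt_attained:
  assumes "k \<le> q" "cnt Q k < c" "c \<le> cnt Q q"
  shows "\<exists>n. k < n \<and> n \<le> q \<and> cnt Q n = c \<and> (up Q n \<or> dn Q n)"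
  using assms
proof (induction q rule: dec_induct)
  case (step n)
  show ?case
  proof (cases "c \<le> cnt Q n")
    case True
    then obtain i where "k < i \<and> i \<le> n \<and> cnt Q i = c \<and> (up Q i \<or> dn Q i)" using step by blast
    then show ?thesis using le_SucI by blast
  next
    case False
    then have "cnt Q (Suc n) = c" "Q (Suc n) \<noteq> Q n" using step.prems by (auto split: if_splits)
    then show ?thesis using step.hyps by (intro exI[of _ "Suc n"]) (simp add: event_iff del: cnt.simps)
  qed
qed simp

lemma mod_eq_gap:
  fixes i j d :: nat
  assumes "i mod d = j mod d" "i < j"
  shows "i + d \<le> j"
proof -
  have "d dvd j - i" using assms by (metis less_imp_le mod_eq_dvd_iff_nat)
  then show ?thesis using assms(2) dvd_imp_le[of d "j - i"] by simp
qed

lemma card_spaced: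
  fixes S :: "real set"
  assumes "finite S" "S \<noteq> {}" and sp: "\<And>x y. x \<in> S \<Longrightarrow> y \<in> S \<Longrightarrow> x < y \<Longrightarrow> g < y - x"
    and "S \<subseteq> {lo<..hi}"
  shows "(real (card S) - 1) * g < hi - lo"
proof -
  have "(real (card S) - 1) * g \<le> Max S - Min S"
    using assms(1,2) sp
  proof (induction S rule: finite_linorder_max_induct)
    case (insert b A)
    show ?case
    proof (cases "A = {}")
      case False
      have "Max A \<in> A" using insert False by simp
      then have "g < b - Max A" using insert.prems(2)[of "Max A" b] insert.hyps(2) by blast
      moreover have "(real (card A) - 1) * g \<le> Max A - Min A"
        using insert False by (meson insertCI)
      moreover have "Max (insert b A) = b"
        using insert.hyps by (intro Max_eqI) (auto intro: less_imp_le)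
      moreover have "b \<notin> A" using insert.hyps by blast
      moreover have "Min (insert b A) = Min A"
        using insert.hyps(2) Min_in[OF insert.hyps(1) False]
        by (simp add: Min_insert[OF insert.hyps(1) False] min_def) (meson not_le)
      ultimately show ?thesis using insert.hyps(1) by (simp add: algebra_simps)
    qed simp
  qed simp
  moreover have "Max S \<le> hi" "lo < Min S"
    using assms Max_in[OF assms(1,2)] Min_in[OF assms(1,2)] by auto
  ultimately show ?thesis by linarith
qed

context timeline
begin

primrec clk :: "(nat \<Rightarrow> bool) \<Rightarrow> nat \<Rightarrow> (nat \<Rightarrow> real) \<Rightarrow> nat \<Rightarrow> nat \<Rightarrow> real" where
  "clk Q d c j 0 = c j"
| "clk Q d c j (Suc k) =
    (if Q (Suc k) \<noteq> Q k \<and> cnt Q (Suc k) mod d = j then 0 else clk Q d c j k + (t (Suc k) - t k))"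

lemma clk_nonneg: "0 \<le> c j \<Longrightarrow> 0 \<le> clk Q d c j k"
  by (induction k) auto

lemma clock_clk: "0 \<le> c j \<Longrightarrow> clock (clk Q d c j)"
  unfolding clock_def using clk_nonneg by auto

lemma clk_zero_Suc:
  assumes "0 \<le> c j" "0 < k"
  shows "clk Q d c j k = 0 \<longleftrightarrow> (up Q k \<or> dn Q k) \<and> cnt Q k mod d = j"
proof -
  obtain k' where k: "k = Suc k'" using assms(2) by (cases k) auto
  have "t k' < t (Suc k')" by simp
  then have "0 < clk Q d c j k' + (t (Suc k') - t k')"
    using clk_nonneg[of c j Q d k'] assms(1) by linarith
  then show ?thesis unfolding k by (simp add: event_iff)
qed

lemma clk_zero:
  assumes "0 \<le> c j" "c j = 0 \<longleftrightarrow> j = 0"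
  shows "clk Q d c j k = 0 \<longleftrightarrow> (up Q k \<or> dn Q k) \<and> cnt Q k mod d = j"
proof (cases "k = 0")
  case True
  then show ?thesis using assms by (auto simp: event_iff)
qed (use clk_zero_Suc assms in simp)

text \<open>The same clock comes up again only after a full round of \<open>d\<close>
  events.\<close>

lemma clk_since:
  assumes "0 \<le> c j" "clk Q d c j k = 0" "cnt Q k mod d = j" "k \<le> q" "cnt Q q < cnt Q k + d"
  shows "clk Q d c j q = t q - t k"
proof -
  have "clk Q d c j q = clk Q d c j k + (t q - t k)"
  proof (rule clock_unreset[OF clock_clk[of c j, OF assms(1)] assms(4)])
    fix n assume n: "k < n" "n \<le> q"
    show "clk Q d c j n \<noteq> 0"
    proof
      assume "clk Q d c j n = 0"
      then have "up Q n \<or> dn Q n" "cnt Q n mod d = j" using clk_zero_Suc[of c j n] assms(1) n by auto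
      then have "cnt Q k + d \<le> cnt Q n" using assms(3) cnt_less n by (intro mod_eq_gap) auto
      then show False using cnt_mono[OF n(2), of Q] assms(5) by simp
    qed
  qed
  then show ?thesis using assms(2) by simp
qed

text \<open>The first reset of clock \<open>j\<close> after position 0 is event number
  \<open>j\<close>; until then its start value acts like a reset before time 0.\<close>

lemma clk_initially:
  assumes "0 \<le> c j" "cnt Q q < j" "j < d"
  shows "clk Q d c j q = c j + t q"
proof -
  have "clk Q d c j q = clk Q d c j 0 + (t q - t 0)"
  proof (rule clock_unreset[OF clock_clk[of c j, OF assms(1)]])
    fix n assume n: "0 < n" "n \<le> q"
    have "cnt Q n < j" using cnt_mono[OF n(2), of Q] assms(2) by simp
    then show "clk Q d c j n \<noteq> 0" using clk_zero_Suc[of c j n] assms n by simp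
  qed simp
  then show ?thesis using t0 by simp
qed

text \<open>Events are numbered consecutively: if clock \<open>l\<close> is not the successor of
  \<open>i\<close>, its reset at \<open>s\<close> comes at least two events after \<open>k\<close>,
  and the event directly after \<open>k\<close> resets the successor.\<close>

lemma clk_cyclic:
  assumes c: "\<And>j. 0 \<le> c j" "\<And>j. c j = 0 \<longleftrightarrow> j = 0"
    and "clk Q d c i k = 0" "k < s" "clk Q d c l s = 0" "l \<noteq> Suc i mod d"
  shows "\<exists>n. k < n \<and> n < s \<and> clk Q d c (Suc i mod d) n = 0"
proof -
  have i: "cnt Q k mod d = i" and l: "up Q s \<or> dn Q s" "cnt Q s mod d = l"
    using assms clk_zero[of c] by auto
  have "cnt Q k < cnt Q s" using cnt_less assms(4) l by blast
  moreover have "cnt Q s \<noteq> Suc (cnt Q k)" using i l(2) assms(6) by (metis mod_Suc_eq)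
  ultimately have "Suc (cnt Q k) < cnt Q s" by simp
  then obtain n where n: "k < n" "n \<le> s" "cnt Q n = Suc (cnt Q k)" "up Q n \<or> dn Q n"
    using cnt_attained[of k s Q "Suc (cnt Q k)"] assms(4) by auto
  have "n \<noteq> s" using n(3) \<open>Suc (cnt Q k) < cnt Q s\<close> by auto
  moreover have "clk Q d c (Suc i mod d) n = 0"
    using clk_zero[of c "Suc i mod d"] c n(3,4) i by (metis mod_Suc_eq)
  ultimately show ?thesis using n by auto
qed

lemma evts_exists:
  assumes "0 \<le> e" "e = 0 \<Longrightarrow> \<forall>k>0. \<not> (up Q k \<or> dn Q k)"
  shows "\<exists>z. evts Q z \<and> z 1 0 = e"
proof -
  define c where "c j = (if j = 0 then 0 else if j = 1 then e else 1)" for j :: nat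
  define z where "z = clk Q 2 c"
  have c: "0 \<le> c j" for j using assms(1) by (simp add: c_def)
  have zero: "(up Q k \<or> dn Q k) \<longleftrightarrow> z 0 k = 0 \<or> z 1 k = 0" for k
  proof (cases "k = 0")
    case True
    then show ?thesis by (simp add: z_def c_def event_iff)
  next
    case False
    have "cnt Q k mod 2 = 0 \<or> cnt Q k mod 2 = 1" by auto
    then show ?thesis using False clk_zero_Suc[of c _ k Q 2] c unfolding z_def by auto
  qed
  have alt: "\<exists>n. k < n \<and> n < s \<and> z (1 - i) n = 0" if h: "i < 2" "z i k = 0" "k < s" "z i s = 0" for i k s
  proof (cases "e = 0")
    case True
    have "0 < s" "z 0 s = 0 \<or> z 1 s = 0" using h by (auto simp: less_2_cases_iff)
    then show ?thesis using assms(2)[OF True] zero[of s] by blast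
  next
    case False
    then have c': "c j = 0 \<longleftrightarrow> j = 0" for j by (simp add: c_def)
    have i: "Suc i mod 2 = 1 - i" "i \<noteq> Suc i mod 2" using h(1) by (auto simp: less_2_cases_iff)
    show ?thesis using clk_cyclic[of c Q 2 i k s i, OF c c'] h(2-4) i unfolding z_def by simp
  qed
  have "evts Q z"
    unfolding evts_def
  proof (intro conjI allI impI)
    show "clock (z 0)" "clock (z 1)" unfolding z_def by (rule clock_clk, rule c)+
  qed (use zero alt in \<open>auto simp: z_def c_def\<close>)
  then show ?thesis by (auto simp: z_def c_def intro!: exI[of _ z])
qed

definition auxc :: "(nat \<Rightarrow> bool) \<Rightarrow> nat \<Rightarrow> (nat \<Rightarrow> nat \<Rightarrow> real) \<Rightarrow> bool" where
  "auxc Q d x \<longleftrightarrow> x 0 0 = 0 \<and> (\<forall>k. ((up Q k \<or> dn Q k) \<longleftrightarrow> (\<exists>j<d. x j k = 0)) \<and>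
     (\<forall>i<d. \<forall>j<d. i \<noteq> j \<longrightarrow> \<not> (x i k = 0 \<and> x j k = 0)) \<and>
     (\<forall>i<d. x i k = 0 \<longrightarrow> (\<forall>s>k. (\<forall>l<d. l \<noteq> Suc i mod d \<longrightarrow> 0 < x l s) \<or>
        (\<exists>n. k < n \<and> n < s \<and> x (Suc i mod d) n = 0))))"

lemma auxc_clk:
  assumes c: "\<And>j. 0 \<le> c j" "\<And>j. c j = 0 \<longleftrightarrow> j = 0" and "0 < d"
  shows "auxc Q d (clk Q d c)"
  unfolding auxc_def
proof (intro conjI allI impI)
  fix k
  show "(up Q k \<or> dn Q k) \<longleftrightarrow> (\<exists>j<d. clk Q d c j k = 0)"
    using clk_zero[of c] c \<open>0 < d\<close> by auto
next
  fix k i j :: nat assume "i \<noteq> j"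
  then show "\<not> (clk Q d c i k = 0 \<and> clk Q d c j k = 0)"
    using clk_zero[of c] c by auto
next
  fix k i s :: nat assume "clk Q d c i k = 0" "k < s"
  then show "(\<forall>l<d. l \<noteq> Suc i mod d \<longrightarrow> 0 < clk Q d c l s) \<or>
        (\<exists>n. k < n \<and> n < s \<and> clk Q d c (Suc i mod d) n = 0)"
    using clk_cyclic[of c, OF c] clk_nonneg[of c, OF c(1)] by (metis order_le_less)
qed (use c in simp)

text \<open>Times may be negative here: an edge of \<open>P\<close> whose counterpart would lie
  before time 0 still makes the clause require a clock that reads \<open>a\<close> or
  \<open>b\<close>.\<close>

definition edges :: "real \<Rightarrow> real \<Rightarrow> (nat \<Rightarrow> bool) \<Rightarrow> real set" where
  "edges a b P = {t q - b |q. GU (b - a) P q} \<union> {t q - a |q. GD (b - a) P q}"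

text \<open>The false stretch of length more than \<open>g\<close> before \<open>q'\<close> starts
  after \<open>q\<close>, as \<open>P q\<close> holds. So rises of this kind, like the falls in the
  next lemma, are more than \<open>g\<close> apart.\<close>

lemma GU_gap:
  assumes "GU g P q'" "P q" "q < q'"
  shows "t q < t q' - g"
proof -
  obtain p where p: "t p < t q' - g" "\<And>n. p \<le> n \<Longrightarrow> n < q' \<Longrightarrow> \<not> P n"
    using assms(1) unfolding GU_def by blast
  have "q < p" using p(2)[of q] assms by (meson not_le)
  then have "t q < t p" by simp
  then show ?thesis using p(1) by linarith
qed

lemma GD_gap:
  assumes "GD g P q" "dn P q'" "q < q'"
  shows "t q + g < t q'"
proof -
  have "P (q' - 1)" "\<not> P q" using assms by (auto simp: dn_def GD_def)
  then have "q < q' - 1" using assms(3) by (metis Suc_leI Suc_pred' diff_is_0_eq' le_neq_implies_less less_Suc_eq_le neq0_conv not_less0)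
  then have "\<not> t (q' - 1) \<le> t q + g" using assms(1) \<open>P (q' - 1)\<close> by (auto simp: GD_def)
  moreover have "t (q' - 1) < t q'" using assms(3) by simp
  ultimately show ?thesis by linarith
qed

lemma finite_edges: "finite (edges a b P \<inter> {lo<..hi})"
proof -
  have "edges a b P \<inter> {lo<..hi} \<subseteq> (\<lambda>k. t k - b) ` {k. t k \<le> hi + b} \<union> (\<lambda>k. t k - a) ` {k. t k \<le> hi + a}"
    by (auto simp: edges_def)
  then show ?thesis using finite_le by (meson finite_UnI finite_imageI finite_subset)
qed

text \<open>Each of the two kinds of edges is spaced by more than \<open>b - a\<close>. If
  \<open>n\<close> of one kind lie in a half-open window of length \<open>a\<close>, then
  \<open>(n - 1) * (b - a) < a\<close>, that is \<open>n < b / (b - a)\<close>, so each kind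
  contributes at most \<open>\<lceil>b / (b - a)\<rceil> - 1\<close>.\<close>

lemma edges_window:
  assumes ab: "0 < a" "a < b"
  shows "card (edges a b P \<inter> {y<..y + a}) \<le> 2 * nat \<lceil>b / (b - a)\<rceil> - 2"
proof -
  let ?K = "nat \<lceil>b / (b - a)\<rceil>"
  have *: "card S \<le> ?K - 1"
    if S: "S \<subseteq> {y<..y + a}" "finite S" "\<And>u v. u \<in> S \<Longrightarrow> v \<in> S \<Longrightarrow> u < v \<Longrightarrow> b - a < v - u" for S
  proof (cases "S = {}")
    case False
    have "(real (card S) - 1) * (b - a) < y + a - y"
      by (rule card_spaced[OF S(2) False S(3,1)])
    then have "real (card S) * (b - a) < b" by (simp add: algebra_simps)
    then have "real (card S) < b / (b - a)" using ab by (simp add: field_simps)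
    then have "card S < ?K" by linarith
    then show ?thesis by simp
  qed simp
  let ?U = "{t q - b |q. GU (b - a) P q}" and ?D = "{t q - a |q. GD (b - a) P q}"
  have fin: "finite (?U \<inter> {y<..y + a})" "finite (?D \<inter> {y<..y + a})"
    by (rule finite_subset[OF _ finite_edges[of a b P y "y + a"]]; auto simp: edges_def)+
  have "card (?U \<inter> {y<..y + a}) \<le> ?K - 1"
  proof (rule *[OF _ fin(1)])
    fix u v assume "u \<in> ?U \<inter> {y<..y + a}" "v \<in> ?U \<inter> {y<..y + a}" "u < v"
    then obtain q q' where q: "u = t q - b" "GU (b - a) P q" "v = t q' - b" "GU (b - a) P q'" by auto
    then have "t q < t q'" using \<open>u < v\<close> by linarith
    then have "q < q'" by simp
    moreover have "P q" using q by (simp add: GU_def up_def)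
    ultimately show "b - a < v - u" using GU_gap[OF q(4)] q by fastforce
  qed simp
  moreover have "card (?D \<inter> {y<..y + a}) \<le> ?K - 1"
  proof (rule *[OF _ fin(2)])
    fix u v assume "u \<in> ?D \<inter> {y<..y + a}" "v \<in> ?D \<inter> {y<..y + a}" "u < v"
    then obtain q q' where q: "u = t q - a" "GD (b - a) P q" "v = t q' - a" "GD (b - a) P q'" by auto
    then have "t q < t q'" using \<open>u < v\<close> by linarith
    then have "q < q'" by simp
    moreover have "dn P q'" using q by (simp add: GD_def)
    ultimately show "b - a < v - u" using GD_gap[OF q(2)] q by fastforce
  qed simp
  ultimately have "card (?U \<inter> {y<..y + a} \<union> ?D \<inter> {y<..y + a}) \<le> 2 * ?K - 2"
    using card_Un_le[of "?U \<inter> {y<..y + a}" "?D \<inter> {y<..y + a}"] by linarith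
  moreover have "edges a b P \<inter> {y<..y + a} = (?U \<inter> {y<..y + a}) \<union> (?D \<inter> {y<..y + a})"
    by (auto simp: edges_def)
  ultimately show ?thesis by simp
qed

text \<open>After rising at \<open>t q - b\<close> the operator stays true as long as
  \<open>t q\<close> is in its window, that is up to and including \<open>t q - a\<close>. The
  argument is about \<open>P\<close> alone, so that it also covers negative times.\<close>

lemma edges_after_GU:
  assumes q: "GU (b - a) P q" and v: "v \<in> edges a b P" "t q - b < v" and "a < b"
  shows "t q - a < v"
proof -
  have "P q" using q by (simp add: GU_def up_def)
  from v(1) consider q' where "v = t q' - b" "GU (b - a) P q'" | q' where "v = t q' - a" "GD (b - a) P q'"
    by (auto simp: edges_def)
  then show ?thesis
  proof cases
    case 1
    then have "t q < t q'" using v by linarith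
    then have "q < q'" by simp
    then show ?thesis using GU_gap[OF 1(2) \<open>P q\<close>] 1(1) by linarith
  next
    case 2
    have "\<not> q' \<le> q"
    proof
      assume "q' \<le> q"
      obtain p where p: "t p < t q - (b - a)" "\<And>n. p \<le> n \<Longrightarrow> n < q \<Longrightarrow> \<not> P n"
        using q unfolding GU_def by blast
      have "t p < t q'" using p v 2 by linarith
      then have "p < q'" by simp
      then have "P (q' - 1)" "p \<le> q' - 1" "q' - 1 < q" using 2(2) \<open>q' \<le> q\<close> by (auto simp: GD_def dn_def)
      then show False using p(2) by blast
    qed
    then have "t q < t q'" by simp
    then show ?thesis using 2(1) by linarith
  qed
qed

text \<open>A clock reset at a rise has to run for \<open>b\<close> rather than \<open>a\<close>;
  but the first \<open>b - a\<close> of that time is free of edges, so the count for windows of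
  length \<open>a\<close> applies.\<close>

lemma edges_window_GU:
  assumes ab: "0 < a" "a < b" and q: "GU (b - a) P q"
  shows "card (edges a b P \<inter> {t q - b<..t q}) \<le> 2 * nat \<lceil>b / (b - a)\<rceil> - 2"
proof -
  have "edges a b P \<inter> {t q - b<..t q} \<subseteq> edges a b P \<inter> {t q - a<..t q - a + a}"
    using edges_after_GU[OF q _ _ ab(2)] by auto
  then have "card (edges a b P \<inter> {t q - b<..t q}) \<le> card (edges a b P \<inter> {t q - a<..t q - a + a})"
    using finite_edges card_mono by blast
  then show ?thesis using edges_window[OF ab, of P "t q - a"] by linarith
qed

end

section \<open>The bounded operator with positive lower bound\<close>

context timeline
begin

text \<open>Edges that would lie at negative times have no position at which a clock could be reset. An
  edge at \<open>v < 0\<close> is served by the initial value \<open>-v\<close> of the clock that the cyclic order would have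
  assigned to it, counting backwards from clock \<open>0\<close>, which is reset at time \<open>0\<close>.\<close>

definition init_value :: "real \<Rightarrow> real \<Rightarrow> (nat \<Rightarrow> bool) \<Rightarrow> nat \<Rightarrow> nat \<Rightarrow> real" where
  "init_value a b P d j =
    (if j = 0 then 0
     else if \<exists>v\<in>edges a b P. v < 0 \<and> card (edges a b P \<inter> {v<..<0}) + 1 + j = d
     then - (SOME v. v \<in> edges a b P \<and> v < 0 \<and> card (edges a b P \<inter> {v<..<0}) + 1 + j = d)
     else 1)"

lemma finite_edges_neg: "finite (edges a b P \<inter> {v<..<0})"
  by (rule finite_subset[OF _ finite_edges[of a b P v 0]]) auto

text \<open>Distinct negative edges have distinct ranks, so the \<open>SOME\<close> in
  \<open>init_value\<close> has a single candidate.\<close>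

lemma edges_rank_inj:
  assumes "v \<in> edges a b P" "w \<in> edges a b P" "v < 0" "w < 0"
    and "card (edges a b P \<inter> {v<..<0}) = card (edges a b P \<inter> {w<..<0})"
  shows "v = w"
proof -
  have *: "card (edges a b P \<inter> {w<..<0}) < card (edges a b P \<inter> {v<..<0})"
    if "v < w" "w \<in> edges a b P" "w < 0" for v w
  proof (rule psubset_card_mono[OF finite_edges_neg])
    have "w \<in> edges a b P \<inter> {v<..<0}" "w \<notin> edges a b P \<inter> {w<..<0}" using that by simp_all
    moreover have "edges a b P \<inter> {w<..<0} \<subseteq> edges a b P \<inter> {v<..<0}" using that by auto
    ultimately show "edges a b P \<inter> {w<..<0} \<subset> edges a b P \<inter> {v<..<0}" by blast
  qed
  show ?thesis using *[of v w] *[of w v] assms by (cases v w rule: linorder_cases) auto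
qed

lemma init_value_edge:
  assumes "v \<in> edges a b P" "v < 0" "card (edges a b P \<inter> {v<..<0}) + 1 + j = d" "j \<noteq> 0"
  shows "init_value a b P d j = - v"
proof -
  have "(SOME w. w \<in> edges a b P \<and> w < 0 \<and> card (edges a b P \<inter> {w<..<0}) + 1 + j = d) = v"
  proof (rule some_equality)
    fix w assume "w \<in> edges a b P \<and> w < 0 \<and> card (edges a b P \<inter> {w<..<0}) + 1 + j = d"
    then show "w = v" using assms by (intro edges_rank_inj) auto
  qed (use assms in blast)
  then show ?thesis using assms unfolding init_value_def by auto
qed

lemma init_value_pos: "j \<noteq> 0 \<Longrightarrow> 0 < init_value a b P d j"
proof (cases "\<exists>v\<in>edges a b P. v < 0 \<and> card (edges a b P \<inter> {v<..<0}) + 1 + j = d")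
  case True
  assume "j \<noteq> 0"
  then show ?thesis using True init_value_edge[of _ a b P j d] by force
qed (auto simp: init_value_def)

lemma init_value_0 [simp]: "init_value a b P d 0 = 0"
  by (simp add: init_value_def)

lemma init_value_nonneg: "0 \<le> init_value a b P d j"
  using init_value_pos[of j a b P d] by (cases "j = 0") auto

lemma init_value_eq_0_iff: "init_value a b P d j = 0 \<longleftrightarrow> j = 0"
  using init_value_pos[of j a b P d] by (cases "j = 0") auto

text \<open>The cyclic clocks work if the one reset at an edge is not reused before it has been
  read. The bound \<open>d - 2\<close> on the edges of a window leaves a margin of one reset, which
  is spent on position 0 or on a lone edge at \<open>t s - b\<close> below. \<open>steps\<close> and
  \<open>a_pos\<close> serve the origin clause; \<open>init\<close> keeps a rise of \<open>P\<close>
  at position 0 from counting as the end of a long gap.\<close>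

lemma complete_FB:
  assumes trP: "tracks P f" and trQ: "tracks Q (FB a b f)" and ab: "1 \<le> a" "a < b"
    and steps: "\<And>k. t (Suc k) - t k \<le> 1" and a_pos: "a \<in> range t"
    and d: "d = 2 * nat \<lceil>b / (b - a)\<rceil>"
    and ev: "evts P z" and init: "up P 0 \<Longrightarrow> z 0 0 \<le> b - a \<and> z 1 0 \<le> b - a"
  shows "\<exists>x. (\<forall>j. clock (x j)) \<and> auxc Q d x \<and> (\<forall>k. mFB a b d P Q z x k)"
proof -
  define c where "c = init_value a b P d"
  define x where "x = clk Q d c"
  define G where "G = edges a b P"
  have a0: "0 < a" using ab by simp
  have c: "0 \<le> c j" "c j = 0 \<longleftrightarrow> j = 0" for j
    unfolding c_def by (rule init_value_nonneg init_value_eq_0_iff)+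
  have "0 < \<lceil>b / (b - a)\<rceil>" using ab by (simp add: divide_pos_pos)
  then have d2: "2 \<le> d" unfolding d by linarith
  have clock: "clock (x j)" for j unfolding x_def using clock_clk c by blast
  have aux: "auxc Q d x" unfolding x_def using auxc_clk[of c d Q] c d2 by simp
  have zero: "x j k = 0 \<longleftrightarrow> (up Q k \<or> dn Q k) \<and> cnt Q k mod d = j" for j k
    unfolding x_def using clk_zero[of c] c by blast
  note fin = finite_edges[of a b P, folded G_def]
  have win: "card (G \<inter> {y<..y + a}) \<le> d - 2" for y
    unfolding G_def d using edges_window ab by simp
  have winU: "card (G \<inter> {t q - b<..t q}) \<le> d - 2" if "GU (b - a) P q" for q
    unfolding G_def d using edges_window_GU that ab by simp
  note GU = evts_GU[OF ev, of _ "b - a"]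
  have U: "up Q k \<longleftrightarrow> (\<exists>q. t q = t k + b \<and> GU (b - a) P q)" if "0 < k" for k
    unfolding edge_at[OF trQ that] using up_edge_FB[OF trP, of "t k" a b] that ab t_pos by simp
  have D: "dn Q k \<longleftrightarrow> (\<exists>q. t q = t k + a \<and> GD (b - a) P q)" if "0 < k" for k
    unfolding edge_at[OF trQ that] using dn_edge_FB[OF trP, of "t k" a b] that ab t_pos by simp
  have edge: "t k \<in> G" if k: "0 < k" "up Q k \<or> dn Q k" for k
  proof -
    from k obtain q where "t k = t q - b \<and> GU (b - a) P q \<or> t k = t q - a \<and> GD (b - a) P q"
      using U[OF k(1)] D[OF k(1)] by (metis add_diff_cancel_right')
    then show ?thesis unfolding G_def edges_def by blast
  qed
  have position: "\<exists>k>0. t k = v \<and> (up Q k \<or> dn Q k)" if "v \<in> G" "0 < v" for v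
  proof -
    have "up_edge (FB a b f) v \<or> dn_edge (FB a b f) v"
      using that up_edge_FB[OF trP that(2), of a b] dn_edge_FB[OF trP that(2), of a b] ab
      by (auto simp: G_def edges_def)
    then show ?thesis using tracks_edges[OF trQ that(2)] by blast
  qed
  \<comment> \<open>Every event after position 0 sits at an edge time, so counting edges bounds the
    number of resets.\<close>
  have cnt_le: "cnt Q q \<le> cnt Q k + card (G \<inter> {t k<..t q})" if "k \<le> q" for k q
  proof -
    let ?I = "{i. k < i \<and> i \<le> q \<and> (up Q i \<or> dn Q i)}"
    have "t ` ?I \<subseteq> G \<inter> {t k<..t q}" using edge by auto
    then have "card (t ` ?I) \<le> card (G \<inter> {t k<..t q})" using fin card_mono by blast
    moreover have "card (t ` ?I) = card ?I" by (intro card_image inj_onI) simp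
    ultimately show ?thesis using cnt_eq_card[OF that, of Q] by simp
  qed
  have since: "x (cnt Q k mod d) n = t n - t k"
    if "up Q k \<or> dn Q k" "card (G \<inter> {t k<..t q}) < d" "k \<le> n" "n \<le> q" for k n q
    unfolding x_def
  proof (rule clk_since)
    have "cnt Q n \<le> cnt Q q" using that(4) by (rule cnt_mono)
    then show "cnt Q n < cnt Q k + d" using cnt_le[of k q] that by simp
    show "clk Q d c (cnt Q k mod d) k = 0" using zero that unfolding x_def by simp
  qed (use c that in auto)
  have timer: "\<exists>j<d. x j q = t q - v"
    if v: "v \<in> G" "v \<le> t q" "card (G \<inter> {v<..t q}) \<le> d - 2" for v q
  proof (cases "v < 0")
    case True
    let ?r = "card (G \<inter> {v<..<0}) + 1"
    \<comment> \<open>The edges in \<open>(v, 0)\<close> and in \<open>(0, t q]\<close> all lie in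
      \<open>(v, t q]\<close>; the extra 1 in \<open>?r\<close> stands for the reset at position 0,
      which happens whether or not 0 is an edge. So clock \<open>d - ?r\<close> has not been reset
      by \<open>q\<close> and still carries its start value.\<close>
    have "card (G \<inter> {v<..<0}) + card (G \<inter> {0<..t q}) = card (G \<inter> {v<..<0} \<union> G \<inter> {0<..t q})"
      using fin finite_edges_neg[of a b P v] by (subst card_Un_disjoint) (auto simp: G_def)
    also have "\<dots> \<le> card (G \<inter> {v<..t q})"
      using fin[of v "t q"] True t_nonneg[of q] by (intro card_mono) auto
    finally have r: "?r + cnt Q q < d"
      using v(3) d2 cnt_le[of 0 q] t0 by simp
    define j where "j = d - ?r"
    have j: "cnt Q q < j" "j < d" using r by (auto simp: j_def)
    have "j \<noteq> 0" "?r + j = d" using r j by (simp_all add: j_def)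
    then have "c j = - v" unfolding c_def
      using v(1) True by (intro init_value_edge) (simp_all add: G_def)
    then have "x j q = t q - v" unfolding x_def using clk_initially[of c j Q q d] c(1)[of j] j by simp
    then show ?thesis using j by blast
  next
    case False
    \<comment> \<open>For \<open>v = 0\<close> position 0 serves, being an event in any
      case.\<close>
    then obtain k where k: "t k = v" "up Q k \<or> dn Q k"
      using position[OF v(1)] t0 by (metis event_iff linorder_neqE_linordered_idom)
    have "t k \<le> t q" using k v by simp
    then have "x (cnt Q k mod d) q = t q - t k"
      using k v d2 by (intro since[of k q q]) auto
    then show ?thesis using k d2 by (intro exI[of _ "cnt Q k mod d"]) simp
  qed
  have Q0: "Q 0 \<longleftrightarrow> (\<exists>k. P k \<and> t k \<le> b \<and> a < t (Suc k))"
    using FB_0[OF trP, of a b] tracks_at[OF trQ, of 0] ab t0 by simp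
  let ?A = "\<lambda>k. \<exists>j<d. x j k = 0 \<and>
         (\<exists>q>k. (up P q \<and> x j q = b \<and> (b - a < z 0 q \<or> b - a < z 1 q)) \<and>
                (\<forall>n. k < n \<and> n < q \<longrightarrow> 0 < x j n))"
  have 1: "up Q k \<longleftrightarrow> ?A k" if k0: "0 < k" for k
  proof
    assume up: "up Q k"
    then obtain q where q: "t q = t k + b" "GU (b - a) P q" using U[OF k0] by blast
    have "t k < t q" using q ab by simp
    then have "k < q" by simp
    have "card (G \<inter> {t k<..t q}) < d" using winU[OF q(2)] q(1) d2 by simp
    then have j: "x (cnt Q k mod d) n = t n - t k" if "k \<le> n" "n \<le> q" for n
      using since[of k q n] up that by blast
    have *: "\<forall>n. k < n \<and> n < q \<longrightarrow> 0 < x (cnt Q k mod d) n" using j by simp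
    have "up P q \<and> (b - a < z 0 q \<or> b - a < z 1 q)" using GU[of q] q(2) \<open>k < q\<close> ab by simp
    moreover have "x (cnt Q k mod d) q = b" "x (cnt Q k mod d) k = 0" "cnt Q k mod d < d"
      using j[of q] j[of k] q \<open>k < q\<close> d2 by simp_all
    ultimately show "?A k" using \<open>k < q\<close> * by blast
  next
    assume "?A k"
    then obtain j q where j: "j < d" "x j k = 0" "k < q" "up P q" "x j q = b"
        "b - a < z 0 q \<or> b - a < z 1 q" "\<forall>n. k < n \<and> n < q \<longrightarrow> 0 < x j n"
      by blast
    have "t q = t k + b" using clock_delay[OF clock j(2,3,7)] j ab by simp
    moreover have "GU (b - a) P q" using GU[of q] j ab by simp
    ultimately show "up Q k" using U[OF k0] by blast
  qed
  let ?B = "\<exists>q. (P q \<and> (a \<le> x 0 q \<and> x 0 q \<le> b \<or> x 0 q < a \<and> a < x 0 (Suc q))) \<and>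
         (\<forall>n<q. n = 0 \<or> 0 < x 0 n)"
  have x0: "x 0 n = t n" if "card (G \<inter> {0<..t q}) < d" "n \<le> q" for n q
    using since[of 0 q n] that t0 by (simp add: event_iff)
  have 2: "up Q 0 \<longleftrightarrow> ?B"
  proof
    assume "up Q 0"
    then obtain k' where k': "P k'" "t k' \<le> b" "a < t (Suc k')" using Q0 by (auto simp: up_def)
    obtain ka where ka: "t ka = a" using a_pos by auto
    \<comment> \<open>The given witness \<open>k'\<close> may come after clock 0 has been reused.
      Time \<open>a\<close> itself, or else the first rise of \<open>P\<close> after it, is an early
      enough witness.\<close>
    have "\<exists>s. P s \<and> a \<le> t s \<and> t s \<le> b \<and> card (G \<inter> {0<..t s}) \<le> d - 2"
    proof (cases "P ka")
      case True
      then show ?thesis using ka ab win[of 0] by (intro exI[of _ ka]) simp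
    next
      case False
      have "t ka < t (Suc k')" using ka k' by simp
      then have "ka < k'" using False k'(1) by (cases "ka = k'") auto
      then obtain s where s: "ka < s" "s \<le> k'" "up P s" "\<And>n. ka \<le> n \<Longrightarrow> n < s \<Longrightarrow> \<not> P n"
        using first_up[OF False _ k'(1)] by blast
      have "t ka < t s" "t s \<le> t k'" using s by simp_all
      then have ts: "a < t s" "t s \<le> b" using ka k' by linarith+
      have "P s" using s by (simp add: up_def)
      \<comment> \<open>As \<open>P\<close> is false from time \<open>a\<close> until just before
        \<open>s\<close>, an edge at a positive time comes from a rise more than
        \<open>b - a\<close> after \<open>t s\<close> or from a fall after \<open>s\<close>. Hence
        the positive edges up to \<open>t s\<close> fit into one window of length
        \<open>a\<close>.\<close>
      have "t s - a < v" if v: "v \<in> G" "0 < v" for v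
      proof -
        from v(1) consider q' where "v = t q' - b" "GU (b - a) P q'" | q' where "v = t q' - a" "GD (b - a) P q'"
          by (auto simp: G_def edges_def)
        then show ?thesis
        proof cases
          case 1
          then have "t s < t q'" using ts v by linarith
          then have "s < q'" by simp
          then show ?thesis using GU_gap[OF 1(2) \<open>P s\<close>] 1(1) by linarith
        next
          case 2
          then have "t ka < t q'" using v ka by linarith
          then have "ka \<le> q' - 1" "P (q' - 1)" "0 < q'" using 2(2) by (auto simp: GD_def dn_def)
          then have "s < q'" using s(4)[of "q' - 1"] by (meson Suc_pred' le_less_trans less_Suc_eq_le not_le_imp_less diff_less zero_less_one)
          then have "t s < t q'" by simp
          then show ?thesis using 2 by linarith
        qed
      qed
      then have "G \<inter> {0<..t s} \<subseteq> G \<inter> {t s - a<..t s - a + a}" by auto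
      then have "card (G \<inter> {0<..t s}) \<le> card (G \<inter> {t s - a<..t s - a + a})"
        using fin card_mono by blast
      then show ?thesis using win[of "t s - a"] \<open>P s\<close> ts by (intro exI[of _ s]) linarith
    qed
    then obtain s where s: "P s" "a \<le> t s" "t s \<le> b" "card (G \<inter> {0<..t s}) \<le> d - 2" by blast
    have "x 0 n = t n" if "n \<le> s" for n using x0[of s n] s(4) d2 that by linarith
    then show ?B using s t_pos by (intro exI[of _ s]) auto
  next
    assume ?B
    then obtain q where q: "P q" "a \<le> x 0 q \<and> x 0 q \<le> b \<or> x 0 q < a \<and> a < x 0 (Suc q)"
      "\<forall>n<q. n = 0 \<or> 0 < x 0 n" by blast
    have x00: "x 0 0 = 0" using zero[of 0 0] by (simp add: event_iff)
    \<comment> \<open>If clock 0 were reset at \<open>q\<close>, the first disjunct would fail by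
      \<open>0 < a\<close>, and in the second the next value would be at most 1, which does not
      exceed \<open>a\<close>.\<close>
    have "x 0 q \<noteq> 0"  if "0 < q"
    proof
      assume "x 0 q = 0"
      moreover have "x 0 (Suc q) \<le> x 0 q + (t (Suc q) - t q)" by (intro clock_le clock) simp
      ultimately show False using q(2) steps[of q] ab by linarith
    qed
    then have "x 0 q = x 0 0 + (t q - t 0)"
      using q(3) by (intro clock_unreset clock) (auto simp: order_le_less)
    then have xq: "x 0 q = t q" using x00 t0 by simp
    have "x 0 (Suc q) \<le> x 0 0 + (t (Suc q) - t 0)" by (intro clock_le clock) simp
    then have "x 0 (Suc q) \<le> t (Suc q)" using x00 t0 by simp
    moreover have "t q < t (Suc q)" by simp
    ultimately have "t q \<le> b \<and> a < t (Suc q)" using q(2) xq ab by linarith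
    then show "up Q 0" using Q0 q by (auto simp: up_def)
  qed
  have 3: "\<exists>j<d. x j k = b" if "up P k \<and> (b - a < z 0 k \<or> b - a < z 1 k)" for k
  proof -
    have "0 < k" using that init by (cases k) auto
    then have "GU (b - a) P k" using GU that ab by simp
    then show ?thesis
      using timer[of "t k - b" k] winU[of k] ab by (fastforce simp: G_def edges_def)
  qed
  have 4: "\<exists>j<d. x j k = a" if "GD (b - a) P k" for k
    using timer[of "t k - a" k] win[of "t k - a"] that ab by (fastforce simp: G_def edges_def)
  let ?C = "\<lambda>k. \<exists>j<d. x j k = 0 \<and>
         (\<exists>q>k. (dn P q \<and> x j q = a \<and>
                  (\<forall>s\<ge>q. \<not> (up P s \<and> x j s \<le> b) \<or> (\<exists>n. q \<le> n \<and> n < s \<and> up P n))) \<and>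
                (\<forall>n. k < n \<and> n < q \<longrightarrow> 0 < x j n))"
  have C_D: "\<exists>q. t q = t k + a \<and> GD (b - a) P q" if "?C k" for k
    using that delayed_GD[OF clock _ _ _ _ _ a0] by blast
  have 5: "dn Q k \<longleftrightarrow> ?C k" if k0: "0 < k" for k
  proof
    assume dn: "dn Q k"
    then obtain q where q: "t q = t k + a" "GD (b - a) P q" using D[OF k0] by blast
    have "t k < t q" using q ab by simp
    then have "k < q" by simp
    define j where "j = cnt Q k mod d"
    have "card (G \<inter> {t k<..t q}) < d" using win[of "t k"] q(1) d2 by simp
    then have j: "x j n = t n - t k" if "k \<le> n" "n \<le> q" for n
      unfolding j_def using since[of k q n] dn that by blast
    have *: "\<forall>n. k < n \<and> n < q \<longrightarrow> 0 < x j n" using j by simp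
    have "dn P q" "\<not> P q" using q(2) by (auto simp: GD_def dn_def)
    \<comment> \<open>Only the first rise \<open>s\<close> after the fall is tested, but it may be
      far away, and the clock reset at \<open>k\<close> has to survive until then. After
      \<open>t k\<close> and up to \<open>t s\<close> the only edges are possibly one at
      \<open>t s - b\<close> and those in the last window of length \<open>a\<close>, fewer than
      \<open>d\<close> in all.\<close>
    have "\<not> x j s \<le> b" if s: "q < s" "up P s" "\<forall>n. q \<le> n \<and> n < s \<longrightarrow> \<not> P n" for s
    proof -
      have "P s" using s by (simp add: up_def)
      then have "t q + (b - a) < t s" using q(2) s(1) by (force simp: GD_def)
      then have ts: "t k + b < t s" "t q < t s - (b - a)" using q by linarith+
      have gs: "GU (b - a) P s" using s ts by (auto simp: GU_def)
      have "v = t s - b \<or> t s - a < v" if v: "v \<in> G" "t k < v" for v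
      proof -
        from v(1) consider q' where "v = t q' - b" "GU (b - a) P q'" | q' where "v = t q' - a" "GD (b - a) P q'"
          by (auto simp: G_def edges_def)
        then show ?thesis
        proof cases
          case 1
          then have "t q < t q'" using v q ab by linarith
          then have "s \<le> q'" using s(3) 1(2) by (metis GU_def less_imp_le not_le t_less up_def)
          then have "s = q' \<or> t s < t q'" by auto
          then show ?thesis
            using edges_after_GU[OF gs v(1)[unfolded G_def]] 1(1) ab by fastforce
        next
          case 2
          then have "t q < t q'" using v q by linarith
          then have "q \<le> q' - 1" "P (q' - 1)" "0 < q'" using 2(2) by (auto simp: GD_def dn_def)
          then have "s < q'" using s(3) by (metis Suc_pred' le_less_trans less_Suc_eq_le not_le_imp_less diff_less zero_less_one)
          then have "t s < t q'" by simp
          then show ?thesis using 2 by linarith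
        qed
      qed
      then have "G \<inter> {t k<..t s} \<subseteq> insert (t s - b) (G \<inter> {t s - a<..t s - a + a})"
        by fastforce
      then have "card (G \<inter> {t k<..t s}) \<le> card (insert (t s - b) (G \<inter> {t s - a<..t s - a + a}))"
        using fin by (intro card_mono) auto
      also have "\<dots> \<le> Suc (card (G \<inter> {t s - a<..t s - a + a}))" by (rule card_insert_le_m1) auto
      finally have "card (G \<inter> {t k<..t s}) < d" using win[of "t s - a"] d2 by linarith
      moreover have "k \<le> s" using s \<open>k < q\<close> by simp
      ultimately have "x j s = t s - t k" unfolding j_def using since[of k s s] dn by blast
      then show ?thesis using ts by simp
    qed
    then have "\<forall>s\<ge>q. \<not> (up P s \<and> x j s \<le> b) \<or> (\<exists>n. q \<le> n \<and> n < s \<and> up P n)"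
      unfolding release_first_up[of P q "\<lambda>s. x j s \<le> b", OF \<open>\<not> P q\<close>] by blast
    moreover have "x j q = a" "x j k = 0" "j < d"
      using j[of q] j[of k] q \<open>k < q\<close> d2 by (simp_all add: j_def)
    ultimately show "?C k" using \<open>k < q\<close> * \<open>dn P q\<close> by blast
  next
    assume "?C k"
    then show "dn Q k" using C_D D[OF k0] by blast
  qed
  \<comment> \<open>The timed disjunct of the fall clause must not hold at position 0 while
    \<open>Q\<close> rises there. It would give a fall of \<open>P\<close> at time \<open>a\<close>
    with \<open>P\<close> false throughout \<open>[a, b]\<close>, so \<open>Q 0\<close>
    fails.\<close>
  have 6: "\<not> up Q 0" if C0: "?C 0"
  proof -
    obtain q where q: "t q = a" "GD (b - a) P q" using C_D[OF C0] t0 by auto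
    have "\<not> P k" if k: "t k \<le> b" "a < t (Suc k)" for k
    proof -
      have "t q < t (Suc k)" using k q by simp
      then have "q \<le> k" by simp
      then show ?thesis using q k by (cases "q = k") (auto simp: GD_def dn_def)
    qed
    then show ?thesis using Q0 by (auto simp: up_def)
  qed
  have dn0: "dn Q 0 \<longleftrightarrow> \<not> up Q 0" by (auto simp: dn_def up_def)
  have "mFB a b d P Q z x k" for k
    unfolding mFB_def
  proof (intro conjI)
    show "up Q k \<longleftrightarrow> 0 < k \<and> ?A k \<or> k = 0 \<and> ?B"
    proof (cases "k = 0")
      case True
      then show ?thesis using 2 by blast
    next
      case False
      then show ?thesis using 1[of k] by blast
    qed
    show "up P k \<and> (b - a < z 0 k \<or> b - a < z 1 k) \<longrightarrow> (\<exists>j<d. x j k = b)" using 3 by blast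
    show "dn Q k \<longleftrightarrow> ?C k \<or> k = 0 \<and> \<not> up Q k"
    proof (cases "k = 0")
      case True
      then show ?thesis using 6 dn0 by blast
    next
      case False
      then show ?thesis using 5[of k] by blast
    qed
    show "dn P k \<and> (\<forall>s\<ge>k. \<not> (up P s \<and> z 0 s \<le> b - a \<and> z 1 s \<le> b - a) \<or>
         (\<exists>n. k \<le> n \<and> n < s \<and> up P n)) \<longrightarrow> (\<exists>j<d. x j k = a)"
      using evts_GD[OF ev, of "b - a" k] 4[of k] ab by simp
  qed
  then show ?thesis using clock aux by blast
qed

end

section \<open>From formulas to clauses\<close>

lemma cltl_sat_Up [simp]: "cltl_sat \<pi> \<sigma> k (Up \<theta>) \<longleftrightarrow> up (\<lambda>i. \<theta> \<in> \<pi> i) k"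
  by (auto simp: Up_def up_def)

lemma cltl_sat_Dn [simp]: "cltl_sat \<pi> \<sigma> k (Dn \<theta>) \<longleftrightarrow> dn (\<lambda>i. \<theta> \<in> \<pi> i) k"
  by (auto simp: Dn_def dn_def)

lemma cltl_sat_Disjs_upt:
  "cltl_sat \<pi> \<sigma> k (Disjs (map f [0..<d])) \<longleftrightarrow> (\<exists>j<d. cltl_sat \<pi> \<sigma> k (f j))"
  by auto

lemma cltl_sat_Disjs_01:
  "cltl_sat \<pi> \<sigma> k (Disjs (map f [0, 1])) \<longleftrightarrow> cltl_sat \<pi> \<sigma> k (f 0) \<or> cltl_sat \<pi> \<sigma> k (f 1)"
  by auto

lemma cltl_sat_Conjs_01:
  "cltl_sat \<pi> \<sigma> k (Conjs (map f [0, 1])) \<longleftrightarrow> cltl_sat \<pi> \<sigma> k (f 0) \<and> cltl_sat \<pi> \<sigma> k (f 1)"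
  by auto

lemma cltl_sat_Next_Until:
  "cltl_sat \<pi> \<sigma> k (Next (\<alpha> \<^bold>U \<beta>)) \<longleftrightarrow>
    (\<exists>q>k. cltl_sat \<pi> \<sigma> q \<beta> \<and> (\<forall>n. k < n \<and> n < q \<longrightarrow> cltl_sat \<pi> \<sigma> n \<alpha>))"
  by (simp add: Suc_le_eq)

lemma cltl_sat_Next_Release:
  "cltl_sat \<pi> \<sigma> k (Next (\<alpha> \<^bold>R \<beta>)) \<longleftrightarrow>
    (\<forall>j>k. cltl_sat \<pi> \<sigma> j \<beta> \<or> (\<exists>n. k < n \<and> n < j \<and> cltl_sat \<pi> \<sigma> n \<alpha>))"
  by (simp add: cltl_sat_release Suc_le_eq)

lemma cltl_sat_Next_Cmp: "cltl_sat \<pi> \<sigma> k (Next (Cmp y r c)) \<longleftrightarrow> compare r (\<sigma> (Suc k) y) (real c)"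
  by simp

lemma origin_Until:
  "k = 0 \<and> cltl_sat \<pi> \<sigma> k (\<alpha> \<^bold>U \<beta>) \<longleftrightarrow>
    k = 0 \<and> (\<exists>q. cltl_sat \<pi> \<sigma> q \<beta> \<and> (\<forall>n<q. cltl_sat \<pi> \<sigma> n \<alpha>))"
  by auto

text \<open>Collected so that \<open>unfolding\<close> reaches the clauses almost literally:
  \<open>Next\<close> of an until or a release turns at once into quantifiers over strictly later
  positions.\<close>

lemmas cltl_sat_unfold = cltl_sat_derived cltl_sat_Disjs_upt cltl_sat_Disjs_01 cltl_sat_Conjs_01
  cltl_sat_Next_Until cltl_sat_Next_Release cltl_sat_Next_Cmp origin_Until cltl_sat_release cltl_sat_Up cltl_sat_Dn
  cltl_sat.simps(1-5) compare.simps

context timeline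
begin

lemma cltl_sat_m_FBnd:
  assumes "0 < a" "a < b"
  shows "cltl_sat \<pi> \<sigma> k (m (FBnd l a b \<psi>)) \<longleftrightarrow>
    mFB a b (nclocks (FBnd l a b \<psi>)) (\<lambda>i. \<psi> \<in> \<pi> i) (\<lambda>i. FBnd l a b \<psi> \<in> \<pi> i)
      (\<lambda>i k. \<sigma> k (Z \<psi> i)) (\<lambda>j k. \<sigma> k (X (FBnd l a b \<psi>) j)) k"
proof -
  have ba: "real (b - a) = real b - real a" using assms by simp
  show ?thesis
    unfolding m.simps Let_def if_P[OF assms(1)] mFB_def cltl_sat_unfold ba
    by (simp only: neq0_conv of_nat_0 simp_thms conj_assoc)
qed

lemma cltl_sat_m_FBnd_0:
  "cltl_sat \<pi> \<sigma> k (m (FBnd l 0 b \<psi>)) \<longleftrightarrow>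
    mF0 b (\<lambda>i. \<psi> \<in> \<pi> i) (\<lambda>i. FBnd l 0 b \<psi> \<in> \<pi> i)
      (\<lambda>i k. \<sigma> k (Z \<psi> i)) (\<lambda>j k. \<sigma> k (Z (FBnd l 0 b \<psi>) j)) k"
  unfolding m.simps Let_def if_not_P[OF less_irrefl] mF0_def cltl_sat_unfold ex_less_2
  by (simp only: neq0_conv of_nat_0 simp_thms conj_assoc)

lemma cltl_sat_m_FInf:
  "cltl_sat \<pi> \<sigma> k (m (FInf l a \<psi>)) \<longleftrightarrow>
    mFI a (\<lambda>i. \<psi> \<in> \<pi> i) (\<lambda>i. FInf l a \<psi> \<in> \<pi> i) (\<lambda>i k. \<sigma> k (Z (FInf l a \<psi>) i)) k"
  unfolding m.simps Let_def mFI_def cltl_sat_unfold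
  by (simp only: neq0_conv of_nat_0 simp_thms conj_assoc)

lemma cltl_sat_events:
  assumes "\<And>x. clock (\<lambda>k. \<sigma> k x)"
  shows "cltl_sat \<pi> \<sigma> 0 (events \<phi>) \<longleftrightarrow>
    (\<forall>\<theta>\<in>set (sub \<phi>). evts (\<lambda>i. \<theta> \<in> \<pi> i) (\<lambda>i k. \<sigma> k (Z \<theta> i)))"
proof -
  have 1: "cltl_sat \<pi> \<sigma> k (((Up \<theta> \<^bold>\<or> Dn \<theta>) \<^bold>\<Leftrightarrow> (Z \<theta> 0 \<^bold>= 0 \<^bold>\<or> Z \<theta> 1 \<^bold>= 0)) \<^bold>\<and>
       Conjs (map (\<lambda>i. Z \<theta> i \<^bold>= 0 \<^bold>\<Rightarrow> Next ((Z \<theta> (1 - i) \<^bold>= 0) \<^bold>R (Z \<theta> i \<^bold>\<noteq> 0))) [0, 1])) \<longleftrightarrow>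
     ((up (\<lambda>i. \<theta> \<in> \<pi> i) k \<or> dn (\<lambda>i. \<theta> \<in> \<pi> i) k) \<longleftrightarrow> (\<sigma> k (Z \<theta> 0) = 0 \<or> \<sigma> k (Z \<theta> 1) = 0)) \<and>
     (\<forall>i<2. \<sigma> k (Z \<theta> i) = 0 \<longrightarrow>
       (\<forall>j>k. \<sigma> j (Z \<theta> i) \<noteq> 0 \<or> (\<exists>n. k < n \<and> n < j \<and> \<sigma> n (Z \<theta> (1 - i)) = 0)))" for \<theta> k
  proof -
    have *: "(\<forall>i<2. A i) \<longleftrightarrow> A 0 \<and> A (1::nat)" for A by (auto simp: less_2_cases_iff)
    show ?thesis unfolding cltl_sat_unfold * by (simp only: of_nat_0)
  qed
  have G: "((\<forall>\<theta>\<in>S. A \<theta>) \<and> (\<forall>j\<ge>0. \<forall>\<theta>\<in>S. B \<theta> j \<and> (\<forall>i<2. C \<theta> i j))) \<longleftrightarrow>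
      (\<forall>\<theta>\<in>S. A \<theta> \<and> (\<forall>j. B \<theta> j) \<and> (\<forall>i<2. \<forall>j. C \<theta> i j))"
    for S :: "'a mitl set" and A and B :: "'a mitl \<Rightarrow> nat \<Rightarrow> bool" and C :: "'a mitl \<Rightarrow> nat \<Rightarrow> nat \<Rightarrow> bool"
    by blast
  have 2: "cltl_sat \<pi> \<sigma> 0 (Conjs (map (\<lambda>\<theta>. Z \<theta> 0 \<^bold>= 0) (sub \<phi>))) \<longleftrightarrow>
      (\<forall>\<theta>\<in>set (sub \<phi>). \<sigma> 0 (Z \<theta> 0) = 0)" by simp
  have 3: "cltl_sat \<pi> \<sigma> k (Conjs (map f (sub \<phi>))) \<longleftrightarrow> (\<forall>\<theta>\<in>set (sub \<phi>). cltl_sat \<pi> \<sigma> k (f \<theta>))" for f k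
    by simp
  show ?thesis
    unfolding events_def cltl_sat_derived(4) cltl_sat.simps(5)[of _ _ 0] 2 3 1 evts_def
      cltl_sat.simps(3) compare.simps of_nat_0 G
    by (simp only: assms simp_thms)
qed

lemma cltl_sat_auxclocks:
  "cltl_sat \<pi> \<sigma> 0 (auxclocks \<theta>) \<longleftrightarrow>
    auxc (\<lambda>i. \<theta> \<in> \<pi> i) (nclocks \<theta>) (\<lambda>j k. \<sigma> k (X \<theta> j))"
proof -
  have 1: "cltl_sat \<pi> \<sigma> k (Conjs [\<^bold>\<not> (X \<theta> i \<^bold>= 0 \<^bold>\<and> X \<theta> j \<^bold>= 0). i \<leftarrow> [0..<d], j \<leftarrow> [0..<d], i \<noteq> j]) \<longleftrightarrow>
     (\<forall>i<d. \<forall>j<d. i \<noteq> j \<longrightarrow> \<not> (\<sigma> k (X \<theta> i) = 0 \<and> \<sigma> k (X \<theta> j) = 0))" for d k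
  proof -
    have S: "set [\<^bold>\<not> (X \<theta> i \<^bold>= 0 \<^bold>\<and> X \<theta> j \<^bold>= 0). i \<leftarrow> [0..<d], j \<leftarrow> [0..<d], i \<noteq> j] =
      (\<Union>i\<in>{..<d}. \<Union>j\<in>{..<d} - {i}. {\<^bold>\<not> (X \<theta> i \<^bold>= 0 \<^bold>\<and> X \<theta> j \<^bold>= 0)})"
      by (auto split: if_splits)
    show ?thesis unfolding cltl_sat_Conjs S by auto
  qed
  have 2: "cltl_sat \<pi> \<sigma> k (Conjs [X \<theta> k \<^bold>> 0. k \<leftarrow> [0..<d], k \<noteq> i]) \<longleftrightarrow>
     (\<forall>l<d. l \<noteq> i \<longrightarrow> 0 < \<sigma> k (X \<theta> l))" for d k i
    by auto
  have 3: "cltl_sat \<pi> \<sigma> k (Conjs (map f [0..<d])) \<longleftrightarrow> (\<forall>i<d. cltl_sat \<pi> \<sigma> k (f i))" for f d k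
    by auto
  show ?thesis
    unfolding auxclocks_def auxc_def Let_def cltl_sat_unfold 1 2 3
    by (simp only: of_nat_0 Suc_eq_plus1[symmetric] simp_thms le0)
qed

text \<open>The two untils differ only at the current position. Times just after \<open>w\<close>
  still belong to the interval of \<open>k\<close>, which forces \<open>P k\<close>; and
  \<open>j = k\<close> is allowed because \<open>g\<close> then holds at a later time of the same
  interval.\<close>

lemma UT_iff:
  assumes P: "tracks P f" and R: "tracks R g" and w: "t k \<le> w" "w < t (Suc k)"
  shows "UT f g w \<longleftrightarrow> P k \<and> (\<exists>j\<ge>k. R j \<and> (\<forall>n. k \<le> n \<and> n < j \<longrightarrow> P n))"
proof
  assume "UT f g w"
  then obtain w' where w': "w < w'" "g w'" "\<forall>v\<in>{w<..<w'}. f v" by (auto simp: UT_def)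
  have "0 \<le> w'" using w w' t_nonneg[of k] by linarith
  then obtain j where j: "t j \<le> w'" "w' < t (Suc j)" using ex_pos by blast
  have "t k < t (Suc j)" using w w' j by linarith
  then have "k \<le> j" by simp
  have "R j" using tracksD[OF R j] w' by simp
  have before: "P n" if n: "k \<le> n" "n < j" for n
  proof -
    define v where "v = (max w (t n) + t (Suc n)) / 2"
    have "t (Suc k) \<le> t (Suc n)" "t (Suc n) \<le> t j" "t n < t (Suc n)" using n by simp_all
    then have "max w (t n) < t (Suc n)" using w by linarith
    then have v: "max w (t n) < v" "v < t (Suc n)" by (simp_all add: v_def)
    have "w < v" "v < w'" using v \<open>t (Suc n) \<le> t j\<close> j(1) by linarith+
    then have "f v" using w'(3) by simp
    then show ?thesis using tracksD[OF P, of n v] v by auto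
  qed
  have "P k"
  proof (cases "j = k")
    case True
    have "f ((w + w') / 2)" using w' by auto
    then show ?thesis using tracksD[OF P, of k "(w + w') / 2"] w w' j True by auto
  qed (use before[of k] \<open>k \<le> j\<close> in simp)
  then show "P k \<and> (\<exists>j\<ge>k. R j \<and> (\<forall>n. k \<le> n \<and> n < j \<longrightarrow> P n))"
    using \<open>k \<le> j\<close> \<open>R j\<close> before by blast
next
  assume "P k \<and> (\<exists>j\<ge>k. R j \<and> (\<forall>n. k \<le> n \<and> n < j \<longrightarrow> P n))"
  then obtain j where j: "P k" "k \<le> j" "R j" "\<And>n. k \<le> n \<Longrightarrow> n < j \<Longrightarrow> P n" by blast
  show "UT f g w"
  proof (cases "j = k")
    case True
    have "g ((w + t (Suc k)) / 2)" using tracksD[OF R, of k "(w + t (Suc k)) / 2"] w j True by simp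
    moreover have "f v" if "w < v" "v < (w + t (Suc k)) / 2" for v
      using tracksD[OF P, of k v] w j that by simp
    ultimately show ?thesis unfolding UT_def using w
      by (intro exI[of _ "(w + t (Suc k)) / 2"]) auto
  next
    case False
    then have "t (Suc k) \<le> t j" using j by simp
    then have "w < t j" using w by linarith
    moreover have "g (t j)" using tracks_at[OF R] j by simp
    moreover have "f v" if v: "w < v" "v < t j" for v
    proof -
      have "0 \<le> v" using v w t_nonneg[of k] by linarith
      then obtain n where n: "t n \<le> v" "v < t (Suc n)" using ex_pos by blast
      have "t k < t (Suc n)" "t n < t j" using n w v by linarith+
      then show ?thesis using tracksD[OF P n] j(4)[of n] by simp
    qed
    ultimately show ?thesis unfolding UT_def by (intro exI[of _ "t j"]) auto
  qed
qed

lemma tracks_cong: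
  assumes "tracks P f" "\<And>w. 0 \<le> w \<Longrightarrow> f w = g w"
  shows "tracks P g"
  using assms t_nonneg unfolding tracks_def by (metis order_trans)

text \<open>The clocks \<open>Z \<theta>\<close> have two roles: as timer of F they may have to
  start at \<open>a - t q\<close>, and as gap meter for an enclosing bounded F they must start at
  most at 1 if \<open>\<theta>\<close> holds at 0. The roles do not collide: if F holds at 0, there
  is no final fall of \<open>P\<close> at or before time \<open>a\<close>, and the start value can
  be chosen small.\<close>

lemma FI_clocks_exist:
  assumes trP: "tracks P f" and trQ: "tracks Q (FI a f)" and a: "0 < a"
  shows "\<exists>z. evts Q z \<and> (up Q 0 \<longrightarrow> z 0 0 \<le> 1 \<and> z 1 0 \<le> 1) \<and> (\<forall>k. mFI a P Q z k)"
proof -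
  define L where "L q \<longleftrightarrow> dn P q \<and> (\<forall>s>q. \<not> P s)" for q
  have uniq: "q' = q" if "L q" "L q'" for q q' using that last_dn_unique unfolding L_def by blast
  \<comment> \<open>The default 1/2 is nonzero, so that the resets alternate, and at most 1, hence
    at most \<open>b - a\<close> for every enclosing bounded operator.\<close>
  define e where "e = (if \<exists>q. L q \<and> t q \<le> a then a - t (THE q. L q) else 1 / 2)"
  have e: "e = a - t q" if "L q" "t q \<le> a" for q
  proof -
    have "(THE q. L q) = q" using that uniq by (intro the_equality) auto
    then show ?thesis using that by (auto simp: e_def)
  qed
  have none: "\<not> (up Q k \<or> dn Q k)" if q: "L q" "t q \<le> a" and k: "0 < k" for q k
  proof
    assume "up Q k \<or> dn Q k"
    then have "dn_edge (FI a f) (t k)" using edge_at[OF trQ k] no_up_edge_FI by blast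
    then obtain q' where "t q' = t k + a" "L q'"
      using dn_edge_FI[OF trP, of "t k" a] k a t_pos by (auto simp: L_def)
    then have "t k \<le> 0" using uniq[OF q(1), of q'] q(2) by simp
    then show False using t_pos[of k] k by simp
  qed
  have "0 \<le> e" using e by (cases "\<exists>q. L q \<and> t q \<le> a") (auto simp: e_def)
  moreover have zero: "\<exists>q. L q \<and> t q = a" if "e = 0"
  proof -
    have "\<exists>q. L q \<and> t q \<le> a" using that by (auto simp: e_def split: if_splits)
    then show ?thesis using e that by fastforce
  qed
  ultimately obtain z where z: "evts Q z" "z 1 0 = e"
    using evts_exists[of e Q] none by (metis order.refl)
  have small: "z 0 0 \<le> 1 \<and> z 1 0 \<le> 1" if "up Q 0"
  proof -
    have "Q 0" using that by (simp add: up_def)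
    then obtain k where k: "P k" "a < t (Suc k)"
      using FI_0[OF trP, of a] tracks_at[OF trQ, of 0] a t0 by auto
    have "\<not> (L q \<and> t q \<le> a)" for q
    proof
      assume q: "L q \<and> t q \<le> a"
      then have "t q < t (Suc k)" using k by linarith
      then have "q \<le> k" by simp
      then show False using q k by (cases "q = k") (auto simp: L_def dn_def)
    qed
    then have "e = 1 / 2" unfolding e_def by (intro if_not_P) blast
    then show ?thesis using z by (simp add: evts_def)
  qed
  have "mFI a P Q z k" for k
    by (rule complete_FI[OF trP trQ a z(1)]) (use e zero z(2) in \<open>auto simp: L_def\<close>)
  then show ?thesis using z small by blast
qed

end

section \<open>Subformulas, change points of a signal, and the positions of a model\<close>

lemma set_sub [simp]:
  "set (sub (Neg \<psi>)) = insert (Neg \<psi>) (set (sub \<psi>))"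
  "set (sub (Conj \<gamma> \<psi>)) = insert (Conj \<gamma> \<psi>) (set (sub \<gamma>) \<union> set (sub \<psi>))"
  "set (sub (Until \<gamma> \<psi>)) = insert (Until \<gamma> \<psi>) (set (sub \<gamma>) \<union> set (sub \<psi>))"
  "set (sub (FBnd l a b \<psi>)) = insert (FBnd l a b \<psi>) (set (sub \<psi>))"
  "set (sub (FInf l a \<psi>)) = insert (FInf l a \<psi>) (set (sub \<psi>))"
  unfolding sub.simps set_remdups list.set set_append by simp_all

declare sub.simps(2-) [simp del]

lemma self_in_sub: "\<theta> \<in> set (sub \<theta>)"
  by (cases \<theta>) auto

lemma sub_trans: "\<psi> \<in> set (sub \<theta>) \<Longrightarrow> set (sub \<psi>) \<subseteq> set (sub \<theta>)"
  by (induction \<theta>) auto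

lemma mitl_over_sub: "mitl_over AP \<phi> \<Longrightarrow> \<theta> \<in> set (sub \<phi>) \<Longrightarrow> mitl_over AP \<theta>"
  by (induction \<phi>) auto

text \<open>Each operator creates change points only at those of its operands, possibly shifted to
  the left by the interval bounds, so local finiteness survives the induction.\<close>

lemma adapted_sat:
  assumes "lcro_nonzeno M" "mitl_over AP \<theta>"
  shows "\<exists>D. locfin D \<and> adapted D (\<lambda>t. mitl_sat M t \<theta>)"
  using assms(2)
proof (induction \<theta>)
  case (Atom p)
  obtain \<tau> where \<tau>: "\<tau> 0 = 0" "strict_mono \<tau>" "filterlim \<tau> at_top sequentially"
    "\<And>i. M constant_on {\<tau> i..<\<tau> (Suc i)}"
    using assms(1) unfolding lcro_nonzeno_def by blast
  interpret timeline \<tau> by unfold_locales (use \<tau> in auto)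
  have "M w = M (\<tau> k)" if "\<tau> k \<le> w" "w < \<tau> (Suc k)" for k w
    using \<tau>(4)[of k] that unfolding constant_on_def
    by (metis atLeastLessThan_iff le_less_trans order.refl)
  then have "tracks (\<lambda>k. p \<in> M (\<tau> k)) (\<lambda>w. p \<in> M w)" by (auto simp: tracks_def)
  then show ?case using tracks_adapted locfin_range by auto
next
  case (Neg \<theta>)
  then obtain D where "locfin D" "adapted D (\<lambda>t. mitl_sat M t \<theta>)" by auto
  then show ?case by (auto simp: adapted_def intro!: exI[of _ D])
next
  case (Conj \<gamma> \<psi>)
  then obtain D E where "locfin D" "adapted D (\<lambda>t. mitl_sat M t \<gamma>)"
    "locfin E" "adapted E (\<lambda>t. mitl_sat M t \<psi>)" by auto
  then have "locfin (D \<union> E)" "adapted (D \<union> E) (\<lambda>t. mitl_sat M t \<gamma>)"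
    "adapted (D \<union> E) (\<lambda>t. mitl_sat M t \<psi>)"
    by (blast intro: locfin_Un adapted_mono)+
  then have "locfin (D \<union> E) \<and> adapted (D \<union> E) (\<lambda>t. mitl_sat M t (Conj \<gamma> \<psi>))"
    unfolding adapted_def mitl_sat.simps by metis
  then show ?case by blast
next
  case (Until \<gamma> \<psi>)
  then obtain D E where "locfin D" "adapted D (\<lambda>t. mitl_sat M t \<gamma>)"
    "locfin E" "adapted E (\<lambda>t. mitl_sat M t \<psi>)" by auto
  then have "locfin (D \<union> E)" "adapted (D \<union> E) (\<lambda>t. mitl_sat M t \<gamma>)"
    "adapted (D \<union> E) (\<lambda>t. mitl_sat M t \<psi>)"
    by (blast intro: locfin_Un adapted_mono)+
  then show ?case unfolding sat_Until using adapted_UT by blast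
next
  case (FBnd l a b \<psi>)
  then obtain D where D: "locfin D" "adapted D (\<lambda>t. mitl_sat M t \<psi>)" and ab: "a < b" by auto
  have "adapted ((\<lambda>d. d - a) ` D \<union> (\<lambda>d. d - b) ` D) (\<lambda>t. mitl_sat M t (FBnd l a b \<psi>))"
    by (rule adapted_cong[OF adapted_FB[OF D(2), of a b]]) (use sat_FBnd[OF D _ ab] ab in auto)
  then show ?case using D(1) locfin_Un locfin_shift of_nat_0_le_iff by blast
next
  case (FInf l a \<psi>)
  then obtain D where D: "locfin D" "adapted D (\<lambda>t. mitl_sat M t \<psi>)" by auto
  have "adapted ((\<lambda>d. d - a) ` D) (\<lambda>t. mitl_sat M t (FInf l a \<psi>))"
    by (rule adapted_cong[OF adapted_FI[OF D(2), of a]]) (use sat_FInf[OF D] in auto)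
  then show ?case using D(1) locfin_shift of_nat_0_le_iff by blast
qed

text \<open>Each position is followed by the next point of \<open>D\<close>. The naturals in
  \<open>D\<close> guarantee one within distance 1, and local finiteness prevents the positions from
  accumulating.\<close>

lemma timeline_through:
  assumes D: "locfin D" and nat: "range real \<subseteq> D"
  shows "\<exists>t. timeline t \<and> (\<forall>x\<in>D. 0 < x \<longrightarrow> x \<in> range t) \<and> (\<forall>k. t (Suc k) - t k \<le> 1)"
proof -
  define t where "t = rec_nat (0::real) (\<lambda>_ s. Min (D \<inter> {s<..s + 1}))"
  have t_simps: "t 0 = 0" "t (Suc k) = Min (D \<inter> {t k<..t k + 1})" for k
    by (simp_all add: t_def)
  have step: "t (Suc k) \<in> D \<inter> {t k<..t k + 1} \<and> (\<forall>x\<in>D \<inter> {t k<..t k + 1}. t (Suc k) \<le> x)"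
    if "0 \<le> t k" for k
  proof -
    have fin: "finite (D \<inter> {t k<..t k + 1})"
      by (rule finite_subset[of _ "D \<inter> {0<..t k + 1}"]) (use D that in \<open>auto simp: locfin_def\<close>)
    have "real (nat \<lfloor>t k\<rfloor> + 1) \<in> D" using nat by blast
    moreover have "real (nat \<lfloor>t k\<rfloor> + 1) = of_int \<lfloor>t k\<rfloor> + 1" using that by simp
    then have "t k < real (nat \<lfloor>t k\<rfloor> + 1)" "real (nat \<lfloor>t k\<rfloor> + 1) \<le> t k + 1" by linarith+
    ultimately have "real (nat \<lfloor>t k\<rfloor> + 1) \<in> D \<inter> {t k<..t k + 1}" by simp
    then have "D \<inter> {t k<..t k + 1} \<noteq> {}" by blast
    then show ?thesis unfolding t_simps(2)[of k] using fin Min_in Min_le by blast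
  qed
  have nonneg: "0 \<le> t k" for k
    by (induction k) (use t_simps(1) step in force)+
  have less: "t k < t (Suc k)" "t (Suc k) \<le> t k + 1" "t (Suc k) \<in> D" for k
    using step[OF nonneg[of k]] by auto
  have mono: "strict_mono t" using less by (simp add: strict_mono_Suc_iff)
  have unbounded: "\<exists>n. w < t n" for w
  proof (rule ccontr)
    assume "\<not> (\<exists>n. w < t n)"
    then have "t (Suc n) \<in> D \<inter> {0<..w}" for n
      using less(1,3)[of n] nonneg[of n] by (auto simp: not_less)
    then have "range (\<lambda>n. t (Suc n)) \<subseteq> D \<inter> {0<..w}" by blast
    moreover have "inj (\<lambda>n. t (Suc n))"
      using mono by (auto simp: inj_def strict_mono_eq)
    ultimately show False
      using D finite_subset finite_imageD infinite_UNIV_nat unfolding locfin_def by metis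
  qed
  have "filterlim t at_top sequentially"
    unfolding filterlim_at_top_dense eventually_sequentially
    using unbounded mono by (metis less_le_trans strict_mono_less_eq)
  then interpret timeline t using t_simps mono by unfold_locales
  have "x \<in> range t" if x: "x \<in> D" "0 < x" for x
  proof -
    obtain k where k: "t k \<le> x" "x < t (Suc k)" using ex_pos[of x] x by auto
    show ?thesis
    proof (cases "t k = x")
      case False
      then have "x \<in> D \<inter> {t k<..t k + 1}" using x k less(2)[of k] by auto
      then have "t (Suc k) \<le> x" using step[OF nonneg[of k]] by blast
      then show ?thesis using k by simp
    qed auto
  qed
  moreover have "t (Suc k) - t k \<le> 1" for k using less(2)[of k] by linarith
  ultimately show ?thesis using timeline_axioms by blast
qed


lemma nclocks_FBnd:
  assumes "a < b"
  shows "nclocks (FBnd l a b \<psi>) = 2 * nat \<lceil>real b / (real b - real a)\<rceil>" "0 < nclocks (FBnd l a b \<psi>)"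
proof -
  have "0 < \<lceil>real b / (real b - real a)\<rceil>" using assms by (simp add: divide_pos_pos)
  then show "nclocks (FBnd l a b \<psi>) = 2 * nat \<lceil>real b / (real b - real a)\<rceil>"
    "0 < nclocks (FBnd l a b \<psi>)" by (simp_all add: nat_mult_distrib)
qed

section \<open>Soundness and completeness for all subformulas together\<close>

context timeline
begin

text \<open>The soundness lemma for a bounded F reads the event clocks of the operand, and those are
  constrained only for members of \<open>sub \<phi>\<close>. Therefore the induction carries an
  inclusion of subformula sets.\<close>

lemma tracks_sat:
  assumes clock: "\<And>x. clock (\<lambda>k. \<sigma> k x)"
    and m: "\<And>\<theta> k. \<theta> \<in> set (sub \<phi>) \<Longrightarrow> cltl_sat \<pi> \<sigma> k (m \<theta>)"
    and ev: "cltl_sat \<pi> \<sigma> 0 (events \<phi>)"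
    and aux: "\<And>\<theta>. \<theta> \<in> set (sub \<phi>) \<Longrightarrow> is_FBnd \<theta> \<Longrightarrow> cltl_sat \<pi> \<sigma> 0 (auxclocks \<theta>)"
    and over: "mitl_over AP \<phi>" and pos: "\<forall>l a \<psi>. FInf l a \<psi> \<in> set (sub \<phi>) \<longrightarrow> 0 < a"
    and M: "\<And>p. p \<in> AP \<Longrightarrow> tracks (\<lambda>k. Atom p \<in> \<pi> k) (\<lambda>w. p \<in> M w)"
  shows "set (sub \<theta>) \<subseteq> set (sub \<phi>) \<Longrightarrow> tracks (\<lambda>k. \<theta> \<in> \<pi> k) (\<lambda>w. mitl_sat M w \<theta>)"
proof (induction \<theta>)
  case (Atom p)
  then have "p \<in> AP" using mitl_over_sub[OF over, of "Atom p"] by simp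
  then show ?case using M by simp
next
  case (Neg \<psi>)
  have "\<And>k. Neg \<psi> \<in> \<pi> k \<longleftrightarrow> \<psi> \<notin> \<pi> k" using m[of "Neg \<psi>"] Neg.prems by simp
  then show ?case using Neg by (simp add: tracks_def)
next
  case (Conj \<gamma> \<psi>)
  have "\<And>k. Conj \<gamma> \<psi> \<in> \<pi> k \<longleftrightarrow> \<gamma> \<in> \<pi> k \<and> \<psi> \<in> \<pi> k" using m[of "Conj \<gamma> \<psi>"] Conj.prems by simp
  then show ?case using Conj by (simp add: tracks_def)
next
  case (Until \<gamma> \<psi>)
  have "Until \<gamma> \<psi> \<in> \<pi> k \<longleftrightarrow> \<gamma> \<in> \<pi> k \<and> (\<exists>j\<ge>k. \<psi> \<in> \<pi> j \<and> (\<forall>n. k \<le> n \<and> n < j \<longrightarrow> \<gamma> \<in> \<pi> n))" for k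
    using m[of "Until \<gamma> \<psi>" k] Until.prems by simp
  moreover have "tracks (\<lambda>k. \<gamma> \<in> \<pi> k) (\<lambda>w. mitl_sat M w \<gamma>)" "tracks (\<lambda>k. \<psi> \<in> \<pi> k) (\<lambda>w. mitl_sat M w \<psi>)"
    using Until by simp_all
  ultimately show ?case unfolding sat_Until tracks_def[of _ "UT _ _"] using UT_iff by blast
next
  case (FBnd l a b \<psi>)
  let ?\<theta> = "FBnd l a b \<psi>"
  have sub: "?\<theta> \<in> set (sub \<phi>)" "\<psi> \<in> set (sub \<phi>)" using FBnd.prems self_in_sub by auto
  have ab: "a < b" using mitl_over_sub[OF over sub(1)] by simp
  have tr: "tracks (\<lambda>k. \<psi> \<in> \<pi> k) (\<lambda>w. mitl_sat M w \<psi>)" using FBnd by simp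
  have ev: "evts (\<lambda>i. \<theta> \<in> \<pi> i) (\<lambda>i k. \<sigma> k (Z \<theta> i))" if "\<theta> \<in> set (sub \<phi>)" for \<theta>
    using ev that cltl_sat_events[of \<sigma>] clock by blast
  have "tracks (\<lambda>k. ?\<theta> \<in> \<pi> k) (FB a b (\<lambda>w. mitl_sat M w \<psi>))"
  proof (cases "a = 0")
    case True
    then show ?thesis
      using sound_F0[OF tr _ ev[OF sub(2)] ev[OF sub(1)], of b] m[OF sub(1)] ab
      by (simp add: cltl_sat_m_FBnd_0 del: m.simps)
  next
    case False
    have A: "auxc (\<lambda>i. ?\<theta> \<in> \<pi> i) (nclocks ?\<theta>) (\<lambda>j k. \<sigma> k (X ?\<theta> j))"
    proof -
      have "is_FBnd ?\<theta>" by simp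
      from aux[OF sub(1) this] show ?thesis unfolding cltl_sat_auxclocks .
    qed
    show ?thesis
    proof (rule sound_FB[OF tr _ _ nclocks_FBnd(2)[OF ab] _ _ ev[OF sub(2)]])
      show "mFB a b (nclocks ?\<theta>) (\<lambda>k. \<psi> \<in> \<pi> k) (\<lambda>k. ?\<theta> \<in> \<pi> k) (\<lambda>i k. \<sigma> k (Z \<psi> i))
          (\<lambda>j k. \<sigma> k (X ?\<theta> j)) k" for k
        using m[OF sub(1), of k] cltl_sat_m_FBnd[OF _ ab, of \<pi> \<sigma> k l \<psi>] False by simp
    qed (use A ab False clock in \<open>auto simp: auxc_def\<close>)
  qed
  then show ?case
    by (rule tracks_cong) (use sat_FBnd[OF locfin_range tracks_adapted[OF tr] _ ab] in simp)
next
  case (FInf l a \<psi>)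
  let ?\<theta> = "FInf l a \<psi>"
  have sub: "?\<theta> \<in> set (sub \<phi>)" using FInf.prems self_in_sub by auto
  have tr: "tracks (\<lambda>k. \<psi> \<in> \<pi> k) (\<lambda>w. mitl_sat M w \<psi>)" using FInf by simp
  have ev: "evts (\<lambda>i. ?\<theta> \<in> \<pi> i) (\<lambda>i k. \<sigma> k (Z ?\<theta> i))"
    using ev sub cltl_sat_events[of \<sigma>] clock by blast
  have "0 < a" using pos sub by blast
  have "tracks (\<lambda>k. ?\<theta> \<in> \<pi> k) (FI a (\<lambda>w. mitl_sat M w \<psi>))"
  proof (rule sound_FI[OF tr _ ev])
    show "mFI a (\<lambda>k. \<psi> \<in> \<pi> k) (\<lambda>k. ?\<theta> \<in> \<pi> k) (\<lambda>i k. \<sigma> k (Z ?\<theta> i)) k" for k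
      using m[OF sub, of k] unfolding cltl_sat_m_FInf .
  qed (use \<open>0 < a\<close> in simp)
  then show ?case
    by (rule tracks_cong) (use sat_FInf[OF locfin_range tracks_adapted[OF tr]] in simp)
qed

text \<open>The clocks \<open>Z\<close> are fixed first, independently for each subformula, because
  the clause of a bounded F mentions the event clocks of its operand; the clocks \<open>X\<close>
  are then built against these. Separate names let all choices be combined into one
  \<open>\<sigma>\<close>.\<close>

lemma model_exists:
  assumes tr: "\<And>\<theta>. \<theta> \<in> set (sub \<phi>) \<Longrightarrow> tracks (\<lambda>k. \<theta> \<in> \<pi> k) (\<lambda>w. mitl_sat M w \<theta>)"
    and steps: "\<And>k. t (Suc k) - t k \<le> 1" and nat: "range real \<subseteq> range t"
    and over: "mitl_over AP \<phi>" and pos: "\<forall>l a \<psi>. FInf l a \<psi> \<in> set (sub \<phi>) \<longrightarrow> 0 < a"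
  shows "\<exists>\<sigma>. (\<forall>y. clock (\<lambda>k. \<sigma> k y)) \<and> (\<forall>\<theta>\<in>set (sub \<phi>). \<forall>k. cltl_sat \<pi> \<sigma> k (m \<theta>)) \<and>
    cltl_sat \<pi> \<sigma> 0 (events \<phi>) \<and>
    (\<forall>\<theta>\<in>set (sub \<phi>). is_FBnd \<theta> \<longrightarrow> cltl_sat \<pi> \<sigma> 0 (auxclocks \<theta>))"
proof -
  let ?S = "set (sub \<phi>)"
  let ?P = "\<lambda>\<theta> k. \<theta> \<in> \<pi> k"
  have sub: "\<psi> \<in> ?S" if "\<theta> \<in> ?S" "\<psi> \<in> set (sub \<theta>)" for \<theta> \<psi> using sub_trans that by blast
  have trFB: "tracks (?P (FBnd l a b \<psi>)) (FB a b (\<lambda>w. mitl_sat M w \<psi>))"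
    and tr\<psi>: "tracks (?P \<psi>) (\<lambda>w. mitl_sat M w \<psi>)"
    and ab: "a < b" if h: "FBnd l a b \<psi> \<in> ?S" for l a b \<psi>
  proof -
    show ab: "a < b" using mitl_over_sub[OF over h] by simp
    show tr\<psi>: "tracks (?P \<psi>) (\<lambda>w. mitl_sat M w \<psi>)"
      using sub[OF h, of \<psi>] self_in_sub[of \<psi>] by (intro tr) simp
    show "tracks (?P (FBnd l a b \<psi>)) (FB a b (\<lambda>w. mitl_sat M w \<psi>))"
      by (rule tracks_cong[OF tr[OF h]]) (use sat_FBnd[OF locfin_range tracks_adapted[OF tr\<psi>] _ ab] in simp)
  qed
  have "\<exists>z. \<theta> \<in> ?S \<longrightarrow> evts (?P \<theta>) z \<and> (up (?P \<theta>) 0 \<longrightarrow> z 0 0 \<le> 1 \<and> z 1 0 \<le> 1) \<and>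
      (\<forall>l a \<psi>. \<theta> = FInf l a \<psi> \<longrightarrow> (\<forall>k. mFI a (?P \<psi>) (?P \<theta>) z k))" for \<theta>
  proof (cases "\<theta> \<in> ?S \<and> (\<exists>l a \<psi>. \<theta> = FInf l a \<psi>)")
    case True
    then obtain l a \<psi> where \<theta>: "\<theta> \<in> ?S" "\<theta> = FInf l a \<psi>" by blast
    have tr\<psi>: "tracks (?P \<psi>) (\<lambda>w. mitl_sat M w \<psi>)"
      using sub[OF \<theta>(1), of \<psi>] self_in_sub[of \<psi>] \<theta>(2) by (intro tr) simp
    have "tracks (?P \<theta>) (FI a (\<lambda>w. mitl_sat M w \<psi>))"
      by (rule tracks_cong[OF tr[OF \<theta>(1)]])
        (use sat_FInf[OF locfin_range tracks_adapted[OF tr\<psi>]] \<theta>(2) in simp)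
    moreover have "0 < a" using pos \<theta> by blast
    ultimately show ?thesis using FI_clocks_exist[OF tr\<psi>, of "?P \<theta>" a] \<theta>(2) by auto
  next
    case False
    obtain z where "evts (?P \<theta>) z" "z 1 0 = 1 / 2" using evts_exists[of "1 / 2" "?P \<theta>"] by auto
    then show ?thesis using False by (intro exI[of _ z]) (auto simp: evts_def)
  qed
  then obtain z where z: "\<And>\<theta>. \<theta> \<in> ?S \<Longrightarrow> evts (?P \<theta>) (z \<theta>)"
    "\<And>\<theta>. \<theta> \<in> ?S \<Longrightarrow> up (?P \<theta>) 0 \<Longrightarrow> z \<theta> 0 0 \<le> 1 \<and> z \<theta> 1 0 \<le> 1"
    "\<And>l a \<psi> k. FInf l a \<psi> \<in> ?S \<Longrightarrow> mFI a (?P \<psi>) (?P (FInf l a \<psi>)) (z (FInf l a \<psi>)) k"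
    by metis
  have "\<exists>x. \<theta> \<in> ?S \<longrightarrow> is_FBnd \<theta> \<longrightarrow> (\<forall>j. clock (x j)) \<and> auxc (?P \<theta>) (nclocks \<theta>) x \<and>
      (\<forall>l a b \<psi>. \<theta> = FBnd l a b \<psi> \<longrightarrow> 0 < a \<longrightarrow> (\<forall>k. mFB a b (nclocks \<theta>) (?P \<psi>) (?P \<theta>) (z \<psi>) x k))" for \<theta>
  proof (cases "\<theta> \<in> ?S \<and> is_FBnd \<theta>")
    case True
    then obtain l a b \<psi> where \<theta>: "FBnd l a b \<psi> \<in> ?S" "\<theta> = FBnd l a b \<psi>" by (cases \<theta>) auto
    note ab = ab[OF \<theta>(1)]
    have "\<psi> \<in> ?S" using sub[OF \<theta>(1), of \<psi>] self_in_sub[of \<psi>] by simp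
    show ?thesis
    proof (cases "a = 0")
      case True
      \<comment> \<open>The clause for \<open>a = 0\<close> times with \<open>Z\<close>, but
        \<open>auxclocks\<close> still constrains the clocks \<open>X\<close>; a cyclic family in
        which only clock 0 starts at 0 satisfies it.\<close>
      let ?c = "\<lambda>j::nat. if j = 0 then 0 else 1 :: real"
      have "auxc (?P \<theta>) (nclocks \<theta>) (clk (?P \<theta>) (nclocks \<theta>) ?c)"
        using nclocks_FBnd(2)[OF ab] \<theta>(2) by (intro auxc_clk) auto
      moreover have "clock (clk (?P \<theta>) (nclocks \<theta>) ?c j)" for j by (rule clock_clk) simp
      ultimately show ?thesis using True \<theta>(2)
        by (intro exI[of _ "clk (?P \<theta>) (nclocks \<theta>) ?c"]) (simp del: nclocks.simps)
    next
      case False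
      have "\<exists>x. (\<forall>j. clock (x j)) \<and> auxc (?P \<theta>) (nclocks \<theta>) x \<and>
          (\<forall>k. mFB a b (nclocks \<theta>) (?P \<psi>) (?P \<theta>) (z \<psi>) x k)"
      proof (rule complete_FB[OF tr\<psi>[OF \<theta>(1)] _ _ _ steps])
        show "tracks (?P \<theta>) (FB a b (\<lambda>w. mitl_sat M w \<psi>))" using trFB[OF \<theta>(1)] \<theta>(2) by simp
        show "nclocks \<theta> = 2 * nat \<lceil>real b / (real b - real a)\<rceil>"
          unfolding \<theta>(2) by (rule nclocks_FBnd(1)[OF ab])
        show "evts (?P \<psi>) (z \<psi>)" using z(1) \<open>\<psi> \<in> ?S\<close> .
        show "z \<psi> 0 0 \<le> real b - real a \<and> z \<psi> 1 0 \<le> real b - real a" if "up (?P \<psi>) 0"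
        proof -
          have "1 \<le> real b - real a" using ab by linarith
          then show ?thesis using z(2)[OF \<open>\<psi> \<in> ?S\<close> that] by linarith
        qed
      qed (use ab False nat in auto)
      then show ?thesis using \<theta>(2) by auto
    qed
  qed auto
  then obtain x where x: "\<And>\<theta> j. \<theta> \<in> ?S \<Longrightarrow> is_FBnd \<theta> \<Longrightarrow> clock (x \<theta> j)"
    "\<And>\<theta>. \<theta> \<in> ?S \<Longrightarrow> is_FBnd \<theta> \<Longrightarrow> auxc (?P \<theta>) (nclocks \<theta>) (x \<theta>)"
    "\<And>l a b \<psi> k. FBnd l a b \<psi> \<in> ?S \<Longrightarrow> 0 < a \<Longrightarrow>
      mFB a b (nclocks (FBnd l a b \<psi>)) (?P \<psi>) (?P (FBnd l a b \<psi>)) (z \<psi>) (x (FBnd l a b \<psi>)) k"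
    using is_FBnd.simps(1) by metis
  \<comment> \<open>Names outside the vocabulary must behave as clocks too; \<open>t\<close> itself
    is one, never reset after position 0.\<close>
  define \<sigma> where "\<sigma> k y = (case y of
      Z \<theta> i \<Rightarrow> if \<theta> \<in> ?S \<and> i < 2 then z \<theta> i k else t k
    | X \<theta> j \<Rightarrow> if \<theta> \<in> ?S \<and> is_FBnd \<theta> then x \<theta> j k else t k)" for k y
  have "clock t" unfolding clock_def using t_nonneg by simp
  have z_clock: "clock (z \<theta> i)" if "\<theta> \<in> ?S" "i < 2" for \<theta> i
    using z(1)[OF that(1)] that(2) by (auto simp: evts_def less_2_cases_iff)
  have clock: "clock (\<lambda>k. \<sigma> k y)" for y
  proof (cases y)
    case (Z \<theta> i)
    then show ?thesis using z_clock \<open>clock t\<close> by (cases "\<theta> \<in> ?S \<and> i < 2") (auto simp: \<sigma>_def)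
  next
    case (X \<theta> j)
    then show ?thesis using x(1) \<open>clock t\<close> by (cases "\<theta> \<in> ?S \<and> is_FBnd \<theta>") (auto simp: \<sigma>_def)
  qed
  have ev: "evts (?P \<theta>) (\<lambda>i k. \<sigma> k (Z \<theta> i))" if "\<theta> \<in> ?S" for \<theta>
  proof -
    have "Suc 0 - i < 2" for i by linarith
    then show ?thesis using z(1)[OF that] that unfolding evts_def \<sigma>_def by simp
  qed
  have X\<sigma>: "(\<lambda>j k. \<sigma> k (X \<theta> j)) = x \<theta>" if "\<theta> \<in> ?S" "is_FBnd \<theta>" for \<theta>
    using that by (simp add: \<sigma>_def)
  have Z\<sigma>: "\<sigma> k (Z \<theta> i) = z \<theta> i k" if "\<theta> \<in> ?S" "i < 2" for \<theta> k i
    using that by (simp add: \<sigma>_def)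
  have "cltl_sat \<pi> \<sigma> k (m \<theta>)" if \<theta>: "\<theta> \<in> ?S" for \<theta> k
  proof (cases \<theta>)
    case (Neg \<psi>)
    have "\<psi> \<in> ?S" using sub[OF \<theta>, of \<psi>] self_in_sub[of \<psi>] Neg by simp
    then show ?thesis using tracks_at[OF tr, of \<theta> k] tracks_at[OF tr, of \<psi> k] \<theta> Neg by simp
  next
    case (Conj \<gamma> \<psi>)
    have "\<gamma> \<in> ?S" "\<psi> \<in> ?S" using sub[OF \<theta>, of \<gamma>] sub[OF \<theta>, of \<psi>] self_in_sub[of \<gamma>] self_in_sub[of \<psi>] Conj by simp_all
    then show ?thesis
      using tracks_at[OF tr, of \<theta> k] tracks_at[OF tr, of \<gamma> k] tracks_at[OF tr, of \<psi> k] \<theta> Conj by simp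
  next
    case (Until \<gamma> \<psi>)
    have "\<gamma> \<in> ?S" "\<psi> \<in> ?S" using sub[OF \<theta>, of \<gamma>] sub[OF \<theta>, of \<psi>] self_in_sub[of \<gamma>] self_in_sub[of \<psi>] Until by simp_all
    then have "UT (\<lambda>w. mitl_sat M w \<gamma>) (\<lambda>w. mitl_sat M w \<psi>) (t k) \<longleftrightarrow>
        \<gamma> \<in> \<pi> k \<and> (\<exists>j\<ge>k. \<psi> \<in> \<pi> j \<and> (\<forall>n. k \<le> n \<and> n < j \<longrightarrow> \<gamma> \<in> \<pi> n))"
      by (intro UT_iff tr) simp_all
    then show ?thesis using tracks_at[OF tr[OF \<theta>], of k] Until by (simp add: UT_def)
  next
    case (FBnd l a b \<psi>)
    note FB = \<theta>[unfolded FBnd]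
    have "\<psi> \<in> ?S" using sub[OF FB, of \<psi>] self_in_sub[of \<psi>] by simp
    note ab = ab[OF FB]
    show ?thesis
    proof (cases "a = 0")
      case True
      have "mF0 b (?P \<psi>) (?P \<theta>) (\<lambda>i k. \<sigma> k (Z \<psi> i)) (\<lambda>i k. \<sigma> k (Z \<theta> i)) k"
      proof (rule complete_F0[OF tr\<psi>[OF FB]])
        show "tracks (?P \<theta>) (FB 0 b (\<lambda>w. mitl_sat M w \<psi>))" using trFB[OF FB] True FBnd by simp
        show "\<sigma> 0 (Z \<psi> 0) \<le> real b \<and> \<sigma> 0 (Z \<psi> 1) \<le> real b" if "up (?P \<psi>) 0"
        proof -
          have "1 \<le> real b" using ab by linarith
          then show ?thesis using z(2)[OF \<open>\<psi> \<in> ?S\<close> that] Z\<sigma>[OF \<open>\<psi> \<in> ?S\<close>] by simp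
        qed
      qed (use ev \<theta> \<open>\<psi> \<in> ?S\<close> ab in auto)
      then show ?thesis unfolding FBnd True cltl_sat_m_FBnd_0 .
    next
      case False
      have "mFB a b (nclocks \<theta>) (?P \<psi>) (?P \<theta>) (\<lambda>i k. \<sigma> k (Z \<psi> i)) (x \<theta>) k"
        using x(3)[OF FB, of k] False FBnd unfolding mFB_def by (simp add: Z\<sigma>[OF \<open>\<psi> \<in> ?S\<close>])
      moreover have "0 < a" "is_FBnd \<theta>" using False FBnd by simp_all
      ultimately show ?thesis
        using cltl_sat_m_FBnd[OF \<open>0 < a\<close> ab, of \<pi> \<sigma> k l \<psi>] X\<sigma>[OF \<theta>] unfolding FBnd by metis
    qed
  next
    case (FInf l a \<psi>)
    have "mFI a (?P \<psi>) (?P \<theta>) (\<lambda>i k. \<sigma> k (Z \<theta> i)) k"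
      using z(3)[of l a \<psi> k] \<theta> FInf unfolding mFI_def by (simp add: Z\<sigma>)
    then show ?thesis using FInf cltl_sat_m_FInf by blast
  qed simp
  moreover have "cltl_sat \<pi> \<sigma> 0 (events \<phi>)" using cltl_sat_events[of \<sigma>] clock ev by blast
  moreover have "cltl_sat \<pi> \<sigma> 0 (auxclocks \<theta>)" if "\<theta> \<in> ?S" "is_FBnd \<theta>" for \<theta>
    unfolding cltl_sat_auxclocks X\<sigma>[OF that] by (rule x(2)[OF that])
  ultimately show ?thesis using clock by blast
qed

end

theorem theorem1:
  fixes AP :: "'p set" and \<phi> :: "'p mitl"
  assumes "finite AP"
    and "mitl_over AP \<phi>"
    and "\<forall>l a \<psi>. FInf l a \<psi> \<in> set (sub \<phi>) \<longrightarrow> 0 < a"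
  shows "mitl_satisfiable AP \<phi> \<longleftrightarrow>
    cltl_satisfiable
      (Up \<phi> \<^bold>\<and>
       Conjs (map (\<lambda>\<theta>. Globally (m \<theta>)) (sub \<phi>)) \<^bold>\<and>
       events \<phi> \<^bold>\<and>
       Conjs (map auxclocks (filter is_FBnd (sub \<phi>))))"
proof -
  have sat_iff: "cltl_sat \<pi> \<sigma> 0 (Up \<phi> \<^bold>\<and> Conjs (map (\<lambda>\<theta>. Globally (m \<theta>)) (sub \<phi>)) \<^bold>\<and>
       events \<phi> \<^bold>\<and> Conjs (map auxclocks (filter is_FBnd (sub \<phi>)))) \<longleftrightarrow>
     \<phi> \<in> \<pi> 0 \<and> (\<forall>\<theta>\<in>set (sub \<phi>). \<forall>k. cltl_sat \<pi> \<sigma> k (m \<theta>)) \<and> cltl_sat \<pi> \<sigma> 0 (events \<phi>) \<and>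
     (\<forall>\<theta>\<in>set (sub \<phi>). is_FBnd \<theta> \<longrightarrow> cltl_sat \<pi> \<sigma> 0 (auxclocks \<theta>))" for \<pi> \<sigma>
    by (auto simp: up_def simp del: m.simps)
  show ?thesis
  proof
    assume "mitl_satisfiable AP \<phi>"
    then obtain M where M: "lcro_nonzeno M" "mitl_sat M 0 \<phi>" unfolding mitl_satisfiable_def by blast
    have "\<forall>\<theta>. \<exists>D. \<theta> \<in> set (sub \<phi>) \<longrightarrow> locfin D \<and> adapted D (\<lambda>t. mitl_sat M t \<theta>)"
      using adapted_sat[OF M(1)] mitl_over_sub[OF assms(2)] by blast
    then obtain D where D: "\<And>\<theta>. \<theta> \<in> set (sub \<phi>) \<Longrightarrow> locfin (D \<theta>)"
      "\<And>\<theta>. \<theta> \<in> set (sub \<phi>) \<Longrightarrow> adapted (D \<theta>) (\<lambda>t. mitl_sat M t \<theta>)" by metis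
    define E where "E = (\<Union>\<theta>\<in>set (sub \<phi>). D \<theta>) \<union> range real"
    have "locfin (range real)"
      unfolding locfin_def
    proof
      fix w
      have "range real \<inter> {0<..w} \<subseteq> real ` {..nat \<lfloor>w\<rfloor>}" by (auto simp: le_nat_floor)
      then show "finite (range real \<inter> {0<..w})" using finite_subset by blast
    qed
    then have "locfin E" unfolding E_def using D(1) by (intro locfin_Un locfin_UN) auto
    then obtain t where t: "timeline t" "\<And>x. x \<in> E \<Longrightarrow> 0 < x \<Longrightarrow> x \<in> range t"
      "\<And>k. t (Suc k) - t k \<le> 1"
      using timeline_through[of E] unfolding E_def by blast
    interpret timeline t by fact
    define \<pi> where "\<pi> k = {\<theta>. mitl_sat M (t k) \<theta>}" for k
    have tr: "tracks (\<lambda>k. \<theta> \<in> \<pi> k) (\<lambda>w. mitl_sat M w \<theta>)" if "\<theta> \<in> set (sub \<phi>)" for \<theta>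
      unfolding \<pi>_def using tracks_if_adapted[OF D(2)[OF that]] t(2) that by (auto simp: E_def)
    have "range real \<subseteq> range t"
    proof
      fix x assume "x \<in> range real"
      then show "x \<in> range t" using t(2)[of x] t0 by (cases "x = 0") (auto simp: E_def)
    qed
    then obtain \<sigma> where \<sigma>: "\<forall>y. clock (\<lambda>k. \<sigma> k y)"
      "\<forall>\<theta>\<in>set (sub \<phi>). \<forall>k. cltl_sat \<pi> \<sigma> k (m \<theta>)" "cltl_sat \<pi> \<sigma> 0 (events \<phi>)"
      "\<forall>\<theta>\<in>set (sub \<phi>). is_FBnd \<theta> \<longrightarrow> cltl_sat \<pi> \<sigma> 0 (auxclocks \<theta>)"
      using model_exists[OF tr t(3) _ assms(2,3)] by blast
    have "\<phi> \<in> \<pi> 0" using M(2) t0 by (simp add: \<pi>_def)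
    moreover have "cltl_model \<sigma> (\<lambda>k. t (Suc k) - t k)"
      unfolding cltl_model_def using \<sigma>(1) lim
      by (simp add: clock_def sum_lessThan_telescope t0)
    ultimately show "cltl_satisfiable (Up \<phi> \<^bold>\<and> Conjs (map (\<lambda>\<theta>. Globally (m \<theta>)) (sub \<phi>)) \<^bold>\<and>
       events \<phi> \<^bold>\<and> Conjs (map auxclocks (filter is_FBnd (sub \<phi>))))"
      unfolding cltl_satisfiable_def sat_iff using \<sigma>(2-4) by blast
  next
    assume "cltl_satisfiable (Up \<phi> \<^bold>\<and> Conjs (map (\<lambda>\<theta>. Globally (m \<theta>)) (sub \<phi>)) \<^bold>\<and>
       events \<phi> \<^bold>\<and> Conjs (map auxclocks (filter is_FBnd (sub \<phi>))))"
    then obtain \<pi> \<sigma> \<delta> where \<delta>: "cltl_model \<sigma> \<delta>" and "\<phi> \<in> \<pi> 0"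
      and \<sigma>: "\<forall>\<theta>\<in>set (sub \<phi>). \<forall>k. cltl_sat \<pi> \<sigma> k (m \<theta>)" "cltl_sat \<pi> \<sigma> 0 (events \<phi>)"
      "\<forall>\<theta>\<in>set (sub \<phi>). is_FBnd \<theta> \<longrightarrow> cltl_sat \<pi> \<sigma> 0 (auxclocks \<theta>)"
      unfolding cltl_satisfiable_def sat_iff by blast
    define t where "t n = (\<Sum>i<n. \<delta> i)" for n
    interpret timeline t
      by unfold_locales (use \<delta> in \<open>auto simp: cltl_model_def t_def[abs_def] strict_mono_Suc_iff\<close>)
    have clock: "clock (\<lambda>k. \<sigma> k y)" for y
      using \<delta> by (auto simp: clock_def cltl_model_def t_def)
    define M where "M w = {p \<in> AP. \<exists>k. t k \<le> w \<and> w < t (Suc k) \<and> Atom p \<in> \<pi> k}" for w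
    have M: "tracks (\<lambda>k. Atom p \<in> \<pi> k) (\<lambda>w. p \<in> M w)" if "p \<in> AP" for p
      using tracks_step[of "\<lambda>k. Atom p \<in> \<pi> k"] that by (simp add: M_def)
    have "tracks (\<lambda>k. \<phi> \<in> \<pi> k) (\<lambda>w. mitl_sat M w \<phi>)"
      by (rule tracks_sat[OF clock _ \<sigma>(2) _ assms(2,3) M]) (use \<sigma> in auto)
    from tracks_at[OF this, of 0] have "mitl_sat M 0 \<phi>" using \<open>\<phi> \<in> \<pi> 0\<close> t0 by simp
    moreover have "lcro_nonzeno M"
    proof -
      have "M w = {p \<in> AP. Atom p \<in> \<pi> k}" if "t k \<le> w" "w < t (Suc k)" for k w
        using pos_unique[OF that] that unfolding M_def by blast
      then have "M constant_on {t k..<t (Suc k)}" for k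
        unfolding constant_on_def by (intro exI[of _ "{p \<in> AP. Atom p \<in> \<pi> k}"]) simp
      then show ?thesis unfolding lcro_nonzeno_def using t0 mono lim by blast
    qed
    ultimately show "mitl_satisfiable AP \<phi>"
      unfolding mitl_satisfiable_def by (intro exI[of _ M]) (auto simp: M_def)
  qed
qed

end
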